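(* Let $n\ge 2$, let $f_1(z_1), g_1(z_1)$ be inner functions on $\mathbb D$, and let $f_2(z_2,\dots,z_n), g_2(z_2,\dots,z_n)$ be functions in $H^\infty(\mathbb D^{n-1})$ with $f_2^{-1}, g_2^{-1}\in L^\infty(\mathbb T^{n-1})$. Let $$M_1=f_1H^2(\mathbb D^n)+f_2H^2(\mathbb D^n),\qquad M_2=g_1H^2(\mathbb D^n)+g_2H^2(\mathbb D^n).$$ Then $M_1$ is unitarily equivalent to $M_2$ only if $M_1=M_2$.
   Context: $\mathbb D$ is the open unit disc, $\mathbb T$ the unit circle. $H^2(\mathbb D^m)$ is the Hardy space of holomorphic functions $f(z)=\sum_{\alpha\in\mathbb Z_+^m}c(\alpha)z^\alpha$ on $\mathbb D^m$ with $\|f\|_2^2=\sum_\alpha|c(\alpha)|^2<\infty$; $f^*$ denotes the radial boundary function, defined a.e. on $\mathbb T^m$. $H^\infty(\mathbb D^m)$ is the space of bounded holomorphic functions on $\mathbb D^m$. For $f\in H^\infty(\mathbb D^m)$, "$f^{-1}\in L^\infty(\mathbb T^m)$" means $1/f^*\in L^\infty(\mathbb T^m)$. An inner function on $\mathbb D$ is $g\in H^\infty(\mathbb D)$ with $|g^*|=1$ a.e. on $\mathbb T$. An invariant subspace of $H^2(\mathbb D^n)$ is a closed linear subspace that is mapped into itself by multiplication by each of $z_1,\dots,z_n$. Two invariant subspaces $M_1,M_2$ of $H^2(\mathbb D^n)$ are unitarily equivalent if there is a unitary operator $U:M_1\to M_2$ such that $U(\varphi f)=\varphi(Uf)$ for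 all $\varphi\in H^\infty(\mathbb D^n)$ and $f\in M_1$. *)

theory Defs
  imports "HOL-Complex_Analysis.Complex_Analysis"
begin

text \<open>
  Coordinates are labelled by a finite set \<open>I\<close> of natural numbers, and a point of \<open>\<complex>\<^sup>I\<close> is an
  extensional function on \<open>I\<close>. Thus \<open>\<D>\<^sup>n\<close> with coordinates \<open>z\<^sub>1, \<dots>, z\<^sub>n\<close> is
  \<open>polydisc {1..n}\<close>, and \<open>\<D>\<^sup>n\<^sup>-\<^sup>1\<close> with coordinates \<open>z\<^sub>2, \<dots>, z\<^sub>n\<close> is \<open>polydisc {2..n}\<close>.
\<close>

type_synonym point = "nat \<Rightarrow> complex"

definition polydisc :: "nat set \<Rightarrow> point set" where
  "polydisc I = (\<Pi>\<^sub>E i\<in>I. ball 0 1)"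

text \<open>
  Holomorphy in several variables: jointly continuous and holomorphic in each variable. Continuity
  is with respect to the product topology on \<open>nat \<Rightarrow> complex\<close>, which on \<open>polydisc I\<close> is the usual
  one because the coordinates outside \<open>I\<close> are constant there.
\<close>

definition holomorphic_polydisc :: "nat set \<Rightarrow> (point \<Rightarrow> complex) \<Rightarrow> bool" where
  "holomorphic_polydisc I f \<longleftrightarrow>
     continuous_on (polydisc I) f \<and>
     (\<forall>z\<in>polydisc I. \<forall>i\<in>I. (\<lambda>w. f (z(i := w))) holomorphic_on ball 0 1)"

definition Hinf :: "nat set \<Rightarrow> (point \<Rightarrow> complex) set" where
  "Hinf I = {f. holomorphic_polydisc I f \<and> bounded (f ` polydisc I)}"

definition multi_indices :: "nat set \<Rightarrow> (nat \<Rightarrow> nat) set" where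
  "multi_indices I = (\<Pi>\<^sub>E i\<in>I. UNIV)"

definition has_power_series ::
    "nat set \<Rightarrow> (point \<Rightarrow> complex) \<Rightarrow> ((nat \<Rightarrow> nat) \<Rightarrow> complex) \<Rightarrow> bool" where
  "has_power_series I f c \<longleftrightarrow>
     (\<forall>z\<in>polydisc I. ((\<lambda>\<alpha>. c \<alpha> * (\<Prod>i\<in>I. z i ^ \<alpha> i)) has_sum f z) (multi_indices I))"

text \<open>
  Elements of the Hardy space are made to vanish off the polydisc, so that equality of HOL
  functions is equality of functions on the polydisc. This is preserved by the pointwise linear
  operations and by pointwise multiplication with an arbitrary function, which is why no such
  normalisation is imposed on the multipliers in \<open>Hinf\<close>.
\<close>

definition H2 :: "nat set \<Rightarrow> (point \<Rightarrow> complex) set" where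
  "H2 I = {f. (\<forall>z. z \<notin> polydisc I \<longrightarrow> f z = 0) \<and> holomorphic_polydisc I f \<and>
     (\<exists>c. has_power_series I f c \<and> (\<lambda>\<alpha>. (cmod (c \<alpha>))\<^sup>2) summable_on multi_indices I)}"

text \<open>
  The coefficients of \<open>f\<close> are unique on \<open>multi_indices I\<close>; the values elsewhere are never used.
\<close>

definition power_series_coeff ::
    "nat set \<Rightarrow> (point \<Rightarrow> complex) \<Rightarrow> (nat \<Rightarrow> nat) \<Rightarrow> complex" where
  "power_series_coeff I f = (SOME c. has_power_series I f c)"

text \<open>The inner product of \<open>H2 I\<close>, that is, the one inducing \<open>\<parallel>f\<parallel>\<^sup>2 = (\<Sum>\<alpha>. \<bar>c(\<alpha>)\<bar>\<^sup>2)\<close>.\<close>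

definition H2_inner :: "nat set \<Rightarrow> (point \<Rightarrow> complex) \<Rightarrow> (point \<Rightarrow> complex) \<Rightarrow> complex" where
  "H2_inner I f g =
     (\<Sum>\<^sub>\<infinity>\<alpha>\<in>multi_indices I. power_series_coeff I f \<alpha> * cnj (power_series_coeff I g \<alpha>))"

text \<open>
  Normalised arc length on the circle and its products. The spaces of these measures are exactly
  \<open>sphere 0 1\<close> and \<open>\<Pi>\<^sub>E i\<in>I. sphere 0 1\<close>.
\<close>

definition circle_measure :: "complex measure" where
  "circle_measure =
     distr (uniform_measure lborel {0..2 * pi}) (restrict_space borel (sphere 0 1)) cis"

definition torus_measure :: "nat set \<Rightarrow> point measure" where
  "torus_measure I = PiM I (\<lambda>_. circle_measure)"

text \<open>
  Radial boundary functions. For bounded holomorphic functions the limits exist almost everywhere;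
  where a limit does not exist, \<open>Lim\<close> is an unspecified constant.
\<close>

definition radial_limit_disc :: "(complex \<Rightarrow> complex) \<Rightarrow> complex \<Rightarrow> complex" where
  "radial_limit_disc f \<zeta> = Lim (at_left 1) (\<lambda>r. f (complex_of_real r * \<zeta>))"

definition radial_limit :: "nat set \<Rightarrow> (point \<Rightarrow> complex) \<Rightarrow> point \<Rightarrow> complex" where
  "radial_limit I f \<zeta> = Lim (at_left 1) (\<lambda>r. f (\<lambda>i\<in>I. complex_of_real r * \<zeta> i))"

definition Linf :: "'a measure \<Rightarrow> ('a \<Rightarrow> complex) set" where
  "Linf M = {f. f \<in> borel_measurable M \<and> (\<exists>C. AE x in M. cmod (f x) \<le> C)}"

text \<open>
  \<open>1 / f\<^sup>* \<in> L\<^sup>\<infinity>\<close>. As \<open>1 / 0 = 0\<close> in HOL, it has to be said that \<open>1 / f\<^sup>*\<close> is defined almost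
  everywhere.
\<close>

definition inverse_in_Linf :: "nat set \<Rightarrow> (point \<Rightarrow> complex) \<Rightarrow> bool" where
  "inverse_in_Linf I f \<longleftrightarrow>
     (AE \<zeta> in torus_measure I. radial_limit I f \<zeta> \<noteq> 0) \<and>
     (\<lambda>\<zeta>. 1 / radial_limit I f \<zeta>) \<in> Linf (torus_measure I)"

definition inner_function :: "(complex \<Rightarrow> complex) \<Rightarrow> bool" where
  "inner_function g \<longleftrightarrow>
     g holomorphic_on ball 0 1 \<and> bounded (g ` ball 0 1) \<and>
     (AE \<zeta> in circle_measure. cmod (radial_limit_disc g \<zeta>) = 1)"

text \<open>
  A unitary operator is a linear bijection preserving the inner product of \<open>H2 I\<close>. The
  definition is used for invariant subspaces \<open>M1\<close> and \<open>M2\<close> of \<open>H2 I\<close>, but nothing in its wording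
  depends on their being closed or invariant.
\<close>

definition unitarily_equivalent ::
    "nat set \<Rightarrow> (point \<Rightarrow> complex) set \<Rightarrow> (point \<Rightarrow> complex) set \<Rightarrow> bool" where
  "unitarily_equivalent I M1 M2 \<longleftrightarrow>
     (\<exists>U. bij_betw U M1 M2 \<and>
        (\<forall>f\<in>M1. \<forall>g\<in>M1. \<forall>a b. U (\<lambda>z. a * f z + b * g z) = (\<lambda>z. a * U f z + b * U g z)) \<and>
        (\<forall>f\<in>M1. \<forall>g\<in>M1. H2_inner I (U f) (U g) = H2_inner I f g) \<and>
        (\<forall>\<phi>\<in>Hinf I. \<forall>f\<in>M1. U (\<lambda>z. \<phi> z * f z) = (\<lambda>z. \<phi> z * U f z)))"

end

theory Submission
  imports Defs
begin

text \<open>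
  Let \<open>U\<close> be a unitary operator from \<open>M1\<close> to \<open>M2\<close> commuting with bounded holomorphic multipliers, and put
  \<open>F1 = U f1\<close>, \<open>F2 = U f2\<close>. Computing \<open>U (f1 f2)\<close> in two ways gives \<open>f2 F1 = f1 F2\<close>, so \<open>U\<close> ought to be
  multiplication by the common quotient \<open>F1 / f1 = F2 / f2\<close>. It is shown that this quotient is a
  constant \<open>\<kappa>\<close> of modulus one; then \<open>M2 = U ` M1 = \<kappa> M1 = M1\<close>.

  First, \<open>|F1| \<le> 1\<close> and \<open>F2\<close> is bounded. If \<open>k\<close> is the reproducing kernel at \<open>a\<close>, then \<open>k\<close> is a bounded
  multiplier and \<open>\<parallel>k F1\<parallel> = \<parallel>k f1\<parallel> \<le> \<parallel>k\<parallel>\<close>; evaluating at \<open>a\<close> gives \<open>|F1 a| \<le> 1\<close>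
  (\<open>unitary_intertwiner_generator_bound\<close>). This rests on the fact that a holomorphic function bounded by
  \<open>C\<close> multiplies \<open>H2\<close> into itself with norm at most \<open>C\<close> (\<open>H2_multiplier\<close>), which is proved by averaging over
  roots of unity in place of integrating over the torus.

  Second, \<open>|F2| \<le> |f2|\<close>. Freeze \<open>z\<^sub>2, \<dots>, z\<^sub>n\<close> at a point where \<open>f2\<close> does not vanish. In the variable \<open>z\<^sub>1\<close>
  the quotient \<open>\<phi> = F2 / f2\<close> is bounded, and \<open>|f1 \<phi>| = |F1| \<le> 1\<close>. Because \<open>f1\<close> is inner, \<open>|\<phi>| \<le> 1\<close>
  follows (\<open>inner_function_cancel_bound\<close>). Inner functions are defined by their radial limits, so
  this step uses Fatou's theorem (\<open>Fatou_radial_limit\<close>). It is derived here from the almost everywhere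
  differentiability of Lipschitz functions, applied to the boundary values of a primitive, and a
  maximum principle that carries a derivative along the circle over to the radius.

  Third, the inverse of \<open>U\<close> maps \<open>g2\<close> to a function \<open>G2\<close> with \<open>|G2| \<le> |g2|\<close>, and computing
  \<open>U (f2 G2)\<close> in two ways gives \<open>F2 G2 = f2 g2\<close>. So both bounds are equalities off the zeros of \<open>f2 g2\<close>. In the
  variable \<open>z\<^sub>1\<close> the quotient \<open>F2 / f2\<close> then has constant modulus, so it does not depend on \<open>z\<^sub>1\<close>; as a
  function of the other variables it is holomorphic, because it equals \<open>F1 / f1\<close> at a suitable value of
  \<open>z\<^sub>1\<close>, and it has modulus one. Hence it is constant (\<open>intertwiner_is_scalar\<close>). Identities and
  inequalities are carried across zero sets by \<open>zero_set_nowhere_dense\<close>; the boundary conditions on \<open>f2\<close>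
  and \<open>g2\<close> enter through the fact that these functions do not vanish identically.
\<close>

section \<open>Lipschitz functions are differentiable almost everywhere\<close>

text \<open>
  Adding a steep linear function to \<open>u\<close> gives a bi-Lipschitz homeomorphism \<open>H\<close> of the line. Lebesgue
  measure pushed forward along \<open>H\<^sup>-\<^sup>1\<close> gives \<open>{a..b}\<close> the mass \<open>H b - H a\<close>, and it is absolutely
  continuous because the Lipschitz map \<open>H\<close> preserves null sets. Its Radon--Nikodym density, corrected
  by the slope of the linear function, is the almost everywhere derivative of \<open>u\<close>.
\<close>

lemma lipschitz_density:
  fixes u :: "real \<Rightarrow> real"
  assumes lip: "C-lipschitz_on UNIV u"
  obtains g where "\<And>a b. a \<le> b \<Longrightarrow> (g has_integral (u b - u a)) {a..b}"
proof -
  have C: "0 \<le> C" using lip by (rule lipschitz_on_nonneg)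
  define H where "H x = u x + (C + 1) * x" for x
  have ud: "\<bar>u y - u x\<bar> \<le> C * \<bar>y - x\<bar>" for x y
    using lipschitz_onD[OF lip, of y x] by (simp add: dist_real_def)
  have H_lower: "H y - H x \<ge> y - x" if "x \<le> y" for x y
    using ud[of y x] that by (simp add: H_def algebra_simps abs_if split: if_splits)
  have H_upper: "\<bar>H y - H x\<bar> \<le> (2 * C + 1) * \<bar>y - x\<bar>" for x y
  proof -
    have "H y - H x = (u y - u x) + (C + 1) * (y - x)" by (simp add: H_def algebra_simps)
    then have "\<bar>H y - H x\<bar> \<le> \<bar>u y - u x\<bar> + \<bar>(C + 1) * (y - x)\<bar>" by linarith
    also have "\<dots> \<le> C * \<bar>y - x\<bar> + (C + 1) * \<bar>y - x\<bar>"
      using ud[of y x] C by (simp add: abs_mult)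
    finally show ?thesis by (simp add: algebra_simps)
  qed
  have H_le: "H x \<le> H y \<longleftrightarrow> x \<le> y" for x y
    using H_lower[of x y] H_lower[of y x] by (cases "x \<le> y") auto
  have H_inj: "inj H"
    by (rule injI) (metis H_le order_antisym order_refl)
  have H_cont: "continuous_on UNIV H"
    unfolding H_def using lipschitz_on_continuous_on[OF lip] by (intro continuous_intros)
  have H_surj: "\<exists>x. H x = y" for y
  proof -
    define m where "m = \<bar>y\<bar> + \<bar>H 0\<bar>"
    have "H (-m) \<le> y" using H_lower[of "-m" 0] abs_ge_minus_self[of y] abs_ge_self[of "H 0"] unfolding m_def by linarith
    moreover have "y \<le> H m" using H_lower[of 0 m] abs_ge_self[of y] abs_ge_minus_self[of "H 0"] unfolding m_def by linarith
    moreover have "-m \<le> m" by (simp add: m_def)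
    ultimately show ?thesis
      using IVT'[of H "-m" y m] continuous_on_subset[OF H_cont] by auto
  qed
  have bijH: "bij H" using H_inj H_surj by (metis bijI surjI)
  define K where "K = inv H"
  have HK: "H (K y) = y" and KH: "K (H x) = x" for x y
    using bijH by (auto simp: K_def bij_is_surj surj_f_inv_f H_inj)
  have K_mono: "mono K"
    by (rule monoI) (metis H_le HK)
  have K_meas: "K \<in> borel_measurable borel" by (rule borel_measurable_mono[OF K_mono])
  \<comment> \<open>Since \<open>K\<close> inverts \<open>H\<close>, this measure is \<open>A \<mapsto> |H ` A|\<close>.\<close>
  define \<mu> where "\<mu> = distr lborel lborel K"
  have K_meas': "K \<in> measurable lborel lborel" using K_meas by simp
  have vimage: "K -` A = H ` A" for A
    using HK KH by (auto simp: image_iff) (metis HK)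
  have \<mu>_eq: "emeasure \<mu> A = emeasure lborel (H ` A)" if "A \<in> sets borel" for A
    unfolding \<mu>_def using that by (subst emeasure_distr[OF K_meas']) (auto simp: vimage)
  have "absolutely_continuous lborel \<mu>"
    unfolding absolutely_continuous_def
  proof
    fix A assume A: "A \<in> null_sets (lborel :: real measure)"
    have "negligible A"
      using A by (metis negligible_iff_null_sets null_sets_completionI)
    have "negligible (H ` A)"
    proof (rule negligible_locally_Lipschitz_image[OF order_refl \<open>negligible A\<close>])
      fix x assume "x \<in> A"
      show "\<exists>T B. open T \<and> x \<in> T \<and> (\<forall>y\<in>A \<inter> T. norm (H y - H x) \<le> B * norm (y - x))"
        using H_upper by (intro exI[of _ UNIV] exI[of _ "2*C+1"]) auto
    qed
    moreover have "H ` A \<in> sets borel"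
      using measurable_sets[OF K_meas', of A] A by (auto simp: vimage)
    ultimately have "emeasure lborel (H ` A) = 0"
      by (simp add: negligible_iff_null_sets null_sets_def)
    then show "A \<in> null_sets \<mu>"
      using A \<mu>_eq[of A] by (auto simp: null_sets_def \<mu>_def)
  qed
  from sigma_finite_measure.Radon_Nikodym[OF sigma_finite_lborel this] obtain f
    where f: "f \<in> borel_measurable lborel" and dens: "density lborel f = \<mu>"
    by (auto simp: \<mu>_def)
  have Himg: "H ` {a..b} = {H a..H b}" for a b
  proof (intro equalityI subsetI)
    fix y assume "y \<in> {H a..H b}"
    then have "K y \<in> {a..b}" using H_le HK by (metis atLeastAtMost_iff)
    then show "y \<in> H ` {a..b}" using HK by (metis imageI)
  qed (auto simp: H_le)
  have nn: "(\<integral>\<^sup>+x. f x * indicator {a..b} x \<partial>lborel) = ennreal (H b - H a)" if "a \<le> b" for a b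
  proof -
    have "(\<integral>\<^sup>+x. f x * indicator {a..b} x \<partial>lborel) = emeasure \<mu> {a..b}"
      using f by (subst dens[symmetric], subst emeasure_density) auto
    also have "\<dots> = ennreal (H b - H a)"
      using that by (subst \<mu>_eq) (auto simp: Himg H_le)
    finally show ?thesis .
  qed
  \<comment> \<open>The density takes extended values; it is finite almost everywhere because bounded intervals have finite mass.\<close>
  have fin: "AE x in lborel. f x \<noteq> \<infinity>"
  proof -
    have "AE x in lborel. f x * indicator {-real n..real n} x \<noteq> \<infinity>" for n :: nat
      using f nn[of "-real n" "real n"] by (intro nn_integral_PInf_AE) auto
    then have "AE x in lborel. \<forall>n::nat. f x * indicator {-real n..real n} x \<noteq> \<infinity>"
      by (simp add: AE_all_countable)
    then show ?thesis
    proof eventually_elim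
      case (elim x)
      obtain n :: nat where "\<bar>x\<bar> \<le> real n" using real_arch_simple by blast
      then have "x \<in> {-real n..real n}" by auto
      then show ?case using elim[rule_format, of n] by simp
    qed
  qed
  define g where "g x = enn2real (f x)" for x
  have gI: "((\<lambda>x. g x * indicator {a..b} x) has_integral (H b - H a)) UNIV" if "a \<le> b" for a b
  proof (rule nn_integral_has_integral)
    show "(\<lambda>x. g x * indicator {a..b} x) \<in> borel_measurable borel"
      using f unfolding g_def by measurable
    show "0 \<le> g x * indicator {a..b} x" for x by (auto simp: g_def indicator_def)
    have "(\<integral>\<^sup>+x. ennreal (g x * indicator {a..b} x) \<partial>lborel) = (\<integral>\<^sup>+x. f x * indicator {a..b} x \<partial>lborel)"
    proof (rule nn_integral_cong_AE)
      show "AE x in lborel. ennreal (g x * indicator {a..b} x) = f x * indicator {a..b} x"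
        using fin by eventually_elim (auto simp: g_def indicator_def ennreal_enn2real_if)
    qed
    then show "(\<integral>\<^sup>+x. ennreal (g x * indicator {a..b} x) \<partial>lborel) = ennreal (H b - H a)"
      using nn[OF that] by simp
    show "0 \<le> H b - H a" using H_le that by simp
  qed
  show ?thesis
  proof
    fix a b :: real assume ab: "a \<le> b"
    have "(\<lambda>x. g x * indicator {a..b} x) = (\<lambda>x. if x \<in> {a..b} then g x else 0)"
      by (auto simp: indicator_def)
    then have "(g has_integral (H b - H a)) {a..b}"
      using gI[OF ab] by (simp only: has_integral_restrict_UNIV)
    moreover have "((\<lambda>x. C + 1) has_integral (C + 1) * (b - a)) {a..b}"
      using has_integral_const_real[of "C+1" a b] ab by (simp add: mult.commute)
    ultimately have "((\<lambda>x. g x - (C + 1)) has_integral (H b - H a - (C + 1) * (b - a))) {a..b}"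
      by (rule has_integral_diff)
    then show "((\<lambda>x. g x - (C + 1)) has_integral (u b - u a)) {a..b}"
      by (simp add: H_def algebra_simps)
  qed
qed

text \<open>
  Lebesgue's differentiation theorem, in the form \<open>integrable_ccontinuous_explicit\<close>, treats averages
  over \<open>{x..x+h}\<close> with \<open>h > 0\<close>. Applying it to the density and to its reflection yields the right and the left derivative,
  both equal to the value of the same density.
\<close>

lemma lipschitz_negligible_nondifferentiable:
  fixes u :: "real \<Rightarrow> real"
  assumes lip: "C-lipschitz_on UNIV u"
  obtains N where "negligible N" "\<And>x. x \<notin> N \<Longrightarrow> \<exists>D. (u has_real_derivative D) (at x)"
proof -
  obtain g where g: "\<And>a b. a \<le> b \<Longrightarrow> (g has_integral (u b - u a)) {a..b}"
    using lipschitz_density[OF lip] by blast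
  have gi: "g integrable_on cbox a b" for a b
    using g[of a b] by (cases "a \<le> b") (auto simp: integrable_on_def)
  define g' where "g' x = g (- x)" for x
  have g'I: "(g' has_integral (u (-a) - u (-b))) {a..b}" if "a \<le> b" for a b
    using has_integral_reflect_lemma_real[OF g[of "-b" "-a"]] that by (simp add: g'_def[abs_def])
  have g'i: "g' integrable_on cbox a b" for a b
    using g'I[of a b] by (cases "a \<le> b") (auto simp: integrable_on_def)
  obtain N1 where N1: "negligible N1"
    "\<And>x e. x \<notin> N1 \<Longrightarrow> 0 < e \<Longrightarrow> \<exists>d>0. \<forall>h. 0 < h \<and> h < d \<longrightarrow>
        norm (integral (cbox x (x + h *\<^sub>R One)) g /\<^sub>R h ^ DIM(real) - g x) < e"
    using integrable_ccontinuous_explicit[of g] gi by blast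
  obtain N2 where N2: "negligible N2"
    "\<And>x e. x \<notin> N2 \<Longrightarrow> 0 < e \<Longrightarrow> \<exists>d>0. \<forall>h. 0 < h \<and> h < d \<longrightarrow>
        norm (integral (cbox x (x + h *\<^sub>R One)) g' /\<^sub>R h ^ DIM(real) - g' x) < e"
    using integrable_ccontinuous_explicit[of g'] g'i by blast
  have "negligible (uminus ` N2)"
    by (rule negligible_differentiable_image_negligible[OF order_refl N2(1)])
      (intro derivative_intros)
  then have "negligible (N1 \<union> uminus ` N2)" using N1(1) by (simp add: negligible_Un)
  moreover have "(u has_real_derivative g x) (at x)" if "x \<notin> N1 \<union> uminus ` N2" for x
    unfolding DERIV_def LIM_eq
  proof (intro allI impI)
    fix e :: real assume e: "0 < e"
    have "- x \<notin> N2" using that by (metis UnCI add.inverse_inverse image_eqI)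
    from N2(2)[OF this e] obtain d2 where d2: "d2 > 0" and
      l: "\<And>h. 0 < h \<Longrightarrow> h < d2 \<Longrightarrow> \<bar>integral {-x..-x+h} g' / h - g x\<bar> < e"
      by (auto simp: g'_def divide_inverse mult.commute)
    from N1(2)[of x e] that e obtain d1 where d1: "d1 > 0" and
      r: "\<And>h. 0 < h \<Longrightarrow> h < d1 \<Longrightarrow> \<bar>integral {x..x+h} g / h - g x\<bar> < e"
      by (auto simp: divide_inverse mult.commute)
    show "\<exists>s>0. \<forall>h::real. h \<noteq> 0 \<and> norm (h - 0) < s \<longrightarrow> norm ((u (x + h) - u x) / h - g x) < e"
    proof (intro exI[of _ "min d1 d2"] conjI allI impI)
      fix h :: real assume h: "h \<noteq> 0 \<and> norm (h - 0) < min d1 d2"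
      show "norm ((u (x + h) - u x) / h - g x) < e"
      proof (cases "h > 0")
        case True
        then have "integral {x..x+h} g = u (x + h) - u x"
          using g[of x "x+h"] by (simp add: integral_unique)
        then show ?thesis using r[of h] h True by simp
      next
        case False
        then have hn: "h < 0" using h by simp
        then have "integral {-x..-x+(-h)} g' = u x - u (x + h)"
          using g'I[of "-x" "-x+(-h)"] by (simp add: integral_unique add.commute)
        then have "\<bar>(u x - u (x + h)) / (-h) - g x\<bar> < e"
          using l[of "-h"] h hn by (auto simp del: divide_minus_right)
        moreover have "(u x - u (x + h)) / (-h) = (u (x + h) - u x) / h"
          using hn by (simp add: field_simps)
        ultimately show ?thesis by simp
      qed
    qed (use d1 d2 in auto)
  qed
  ultimately show ?thesis using that by blast
qed

section \<open>Radial limits of bounded holomorphic functions\<close>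

text \<open>
  Used to discard constants: an estimate that survives all powers with a fixed constant holds with
  constant 1.
\<close>

lemma le_if_powers_dominated:
  fixes x y c K :: real
  assumes "c > 0" "y > 0" "\<And>m::nat. c * x ^ m \<le> K * y ^ m"
  shows "x \<le> y"
proof (rule ccontr)
  assume "\<not> x \<le> y"
  then have "1 < x / y" using assms(2) by simp
  then obtain m where m: "K / c < (x / y) ^ m" using real_arch_pow by blast
  have "K * y ^ m < c * x ^ m"
    using m assms(1,2) by (simp add: field_simps power_divide)
  with assms(3)[of m] show False by simp
qed

text \<open>
  A two-constants estimate. On the circle the quotient \<open>E z / (z - 1)\<close> is at most \<open>\<epsilon>\<close> near 1 and at
  most \<open>M\<close> elsewhere. The factor \<open>exp (- \<kappa> (1 - z))\<close> has modulus at most 1 on the disc, and since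
  \<open>2 Re (1 - w) = |w - 1|\<^sup>2\<close> on the circle, the chosen \<open>\<kappa>\<close> makes it at most \<open>\<epsilon> / M\<close> far from 1. So the
  product \<open>q\<close> is at most \<open>\<epsilon>\<close> on the circle without the point 1. There \<open>q\<close> may fail to be continuous, so
  the maximum principle is applied to \<open>(1 - z) q\<^sup>m\<close>, and \<open>m\<close> tends to infinity. In the conclusion the
  exponential tends to 1 as \<open>z\<close> tends to 1.
\<close>

lemma boundary_decay_transfers_inside:
  fixes E :: "complex \<Rightarrow> complex"
  assumes cont: "continuous_on (cball 0 1) E" and hol: "E holomorphic_on ball 0 1"
    and lip: "\<And>z. z \<in> cball 0 1 \<Longrightarrow> norm (E z) \<le> M * norm (z - 1)"
    and M: "M > 0" and \<epsilon>: "0 < \<epsilon>" "\<epsilon> \<le> M" and \<delta>: "\<delta> > 0"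
    and near: "\<And>w. norm w = 1 \<Longrightarrow> norm (w - 1) < \<delta> \<Longrightarrow> norm (E w) \<le> \<epsilon> * norm (w - 1)"
    and z: "z \<in> ball 0 1"
  shows "norm (E z) \<le> \<epsilon> * exp ((2 / \<delta>\<^sup>2) * ln (M / \<epsilon>) * Re (1 - z)) * norm (z - 1)"
proof -
  define \<kappa> where "\<kappa> = (2 / \<delta>\<^sup>2) * ln (M / \<epsilon>)"
  have kap0: "\<kappa> \<ge> 0" using \<epsilon> M by (simp add: \<kappa>_def)
  define q where "q z = E z / (z - 1) * exp (- \<kappa> * (1 - z))" for z :: complex
  have normq: "norm (q z) = norm (E z) / norm (z - 1) * exp (- \<kappa> * Re (1 - z))" for z :: complex
    by (simp add: q_def norm_mult norm_divide)
  have Re1: "Re (1 - w) \<ge> 0" if "w \<in> cball 0 1" for w :: complex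
    using complex_Re_le_cmod[of w] that by simp
  have qM: "norm (q w) \<le> M" if w: "w \<in> cball 0 1" "w \<noteq> 1" for w
  proof -
    have "norm (E w) / norm (w - 1) \<le> M" using lip[OF w(1)] w(2) by (simp add: field_simps)
    moreover have "exp (- \<kappa> * Re (1 - w)) \<le> 1" using Re1[OF w(1)] kap0 by simp
    ultimately have "norm (E w) / norm (w - 1) * exp (- \<kappa> * Re (1 - w)) \<le> M * 1"
      using M by (intro mult_mono) auto
    then show ?thesis by (simp add: normq)
  qed
  have q\<epsilon>: "norm (q w) \<le> \<epsilon>" if w: "norm w = 1" "w \<noteq> 1" for w
  proof (cases "norm (w - 1) < \<delta>")
    case True
    have "norm (E w) / norm (w - 1) \<le> \<epsilon>" using near[OF w(1) True] w(2) by (simp add: field_simps)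
    moreover have "exp (- \<kappa> * Re (1 - w)) \<le> 1" using Re1[of w] w kap0 by simp
    ultimately have "norm (E w) / norm (w - 1) * exp (- \<kappa> * Re (1 - w)) \<le> \<epsilon> * 1"
      using \<epsilon> by (intro mult_mono) auto
    then show ?thesis by (simp add: normq)
  next
    case False
    have "(norm (w - 1))\<^sup>2 = 2 * Re (1 - w)"
    proof -
      have "(Re w)\<^sup>2 + (Im w)\<^sup>2 = 1" using w(1) by (simp add: cmod_power2[symmetric])
      then show ?thesis unfolding cmod_power2 by (simp add: power2_eq_square algebra_simps)
    qed
    moreover have "\<delta>\<^sup>2 \<le> (norm (w - 1))\<^sup>2" using False \<delta> by (intro power_mono) auto
    ultimately have "\<delta>\<^sup>2 \<le> 2 * Re (1 - w)" by linarith
    then have "2 / \<delta>\<^sup>2 * Re (1 - w) \<ge> 1" using \<delta> by (simp add: field_simps)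
    then have "ln (M / \<epsilon>) * 1 \<le> ln (M / \<epsilon>) * (2 / \<delta>\<^sup>2 * Re (1 - w))"
      using \<epsilon> M by (intro mult_left_mono) auto
    also have "\<dots> = \<kappa> * Re (1 - w)" by (simp only: \<kappa>_def mult_ac)
    finally have "exp (- \<kappa> * Re (1 - w)) \<le> exp (- ln (M / \<epsilon>))"
      by (simp only: exp_le_cancel_iff mult_minus_left mult_1_right neg_le_iff_le)
    also have "\<dots> = \<epsilon> / M" using \<epsilon> M by (simp add: exp_minus)
    finally have "exp (- \<kappa> * Re (1 - w)) \<le> \<epsilon> / M" .
    moreover have "norm (E w) / norm (w - 1) \<le> M" using lip[of w] w by (simp add: field_simps)
    ultimately have "norm (E w) / norm (w - 1) * exp (- \<kappa> * Re (1 - w)) \<le> M * (\<epsilon> / M)"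
      using M by (intro mult_mono) auto
    then show ?thesis using M by (simp add: normq)
  qed
  have main: "norm (1 - z) * norm (q z) ^ m \<le> 2 * \<epsilon> ^ m" for m
  proof -
    define Q where "Q z = (if z = 1 then 0 else (1 - z) * q z ^ m)" for z
    have holQ: "Q holomorphic_on ball 0 1"
    proof -
      have "(\<lambda>z. (1 - z) * q z ^ m) holomorphic_on ball 0 1"
        unfolding q_def by (intro holomorphic_intros hol) auto
      then show ?thesis by (rule holomorphic_transform) (auto simp: Q_def)
    qed
    have contQ: "continuous_on (cball 0 1) Q"
      unfolding continuous_on_eq_continuous_within
    proof
      fix w :: complex assume w: "w \<in> cball 0 1"
      show "continuous (at w within cball 0 1) Q"
      proof (cases "w = 1")
        case True
        have "((\<lambda>v. Q v) \<longlongrightarrow> 0) (at 1 within cball 0 1)"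
        proof (rule Lim_null_comparison)
          show "\<forall>\<^sub>F v in at 1 within cball 0 1. norm (Q v) \<le> norm (1 - v) * M ^ m"
            unfolding eventually_at_topological
          proof (intro exI[of _ UNIV] conjI ballI impI)
            fix v :: complex assume "v \<noteq> 1" "v \<in> cball 0 1"
            then show "norm (Q v) \<le> norm (1 - v) * M ^ m"
              using qM[of v] by (auto simp: Q_def norm_mult norm_power intro!: mult_left_mono power_mono)
          qed auto
          show "((\<lambda>v. norm (1 - v) * M ^ m) \<longlongrightarrow> 0) (at (1::complex) within cball 0 1)"
            by (auto intro!: tendsto_eq_intros)
        qed
        moreover have "Q 1 = 0" by (simp add: Q_def)
        ultimately show ?thesis by (simp add: continuous_within True)
      next
        case False
        have "continuous_on (cball 0 1 - {1}) (\<lambda>z. (1 - z) * q z ^ m)"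
          unfolding q_def by (intro continuous_intros continuous_on_subset[OF cont]) auto
        then have "continuous_on (cball 0 1 - {1}) Q"
          by (rule continuous_on_eq) (auto simp: Q_def)
        then have "continuous (at w within cball 0 1 - {1}) Q"
          using w False by (auto simp: continuous_on_eq_continuous_within)
        moreover have "at w within cball 0 1 - {1} = at w within cball 0 1"
          using False by (intro at_within_nhd[of _ "- {1}"]) auto
        ultimately show ?thesis by simp
      qed
    qed
    have "norm (Q z) \<le> 2 * \<epsilon> ^ m"
    proof (rule maximum_modulus_frontier[of Q "ball 0 1"])
      fix w :: complex assume "w \<in> frontier (ball 0 1)"
      then have w: "norm w = 1" by simp
      show "norm (Q w) \<le> 2 * \<epsilon> ^ m"
      proof (cases "w = 1")
        case False
        have "norm (1 - w) \<le> 2" using norm_triangle_ineq4[of 1 w] w by simp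
        moreover have "norm (q w) ^ m \<le> \<epsilon> ^ m" using q\<epsilon>[OF w False] by (simp add: power_mono)
        ultimately have "norm (1 - w) * norm (q w) ^ m \<le> 2 * \<epsilon> ^ m"
          by (intro mult_mono) auto
        then show ?thesis using False by (simp add: Q_def norm_mult norm_power)
      qed (use \<epsilon> in \<open>simp add: Q_def\<close>)
    qed (use holQ contQ z in auto)
    moreover have "z \<noteq> 1" using z by auto
    ultimately show ?thesis by (simp add: Q_def norm_mult norm_power)
  qed
  have z1: "norm (1 - z) > 0" using z by auto
  have "norm (q z) \<le> \<epsilon>" by (rule le_if_powers_dominated[OF z1 \<epsilon>(1) main])
  then have "norm (E z) * exp (- \<kappa> * Re (1 - z)) \<le> \<epsilon> * norm (z - 1)"
    using z1 by (simp add: normq norm_minus_commute field_simps)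
  then have "norm (E z) * (exp (- \<kappa> * Re (1 - z)) * exp (\<kappa> * Re (1 - z))) \<le> \<epsilon> * norm (z - 1) * exp (\<kappa> * Re (1 - z))"
    by (simp only: mult.assoc[symmetric]) (intro mult_right_mono, auto)
  also have "exp (- \<kappa> * Re (1 - z)) * exp (\<kappa> * Re (1 - z)) = 1"
    by (simp add: exp_add[symmetric] del: minus_complex.sel)
  finally show ?thesis by (simp add: \<kappa>_def mult_ac)
qed

text \<open>
  Subtracting the linear function with the boundary derivative \<open>A\<close> as slope leaves a function \<open>E\<close> that
  is \<open>o(|z - 1|)\<close> along the circle, hence inside the disc as well. Cauchy's inequality on a disc around
  \<open>r\<close> of radius comparable to \<open>1 - r\<close> turns this into \<open>deriv E r = o(1)\<close>.
\<close>

lemma radial_derivative_limit: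
  fixes F :: "complex \<Rightarrow> complex"
  assumes cont: "continuous_on (cball 0 1) F" and hol: "F holomorphic_on ball 0 1"
    and lip: "\<And>z. z \<in> cball 0 1 \<Longrightarrow> norm (F z - F 1) \<le> L * norm (z - 1)"
    and bd: "((\<lambda>w. (F w - F 1) / (w - 1)) \<longlongrightarrow> A) (at 1 within sphere 0 1)"
  shows "((\<lambda>r. deriv F (of_real r)) \<longlongrightarrow> A) (at_left 1)"
proof -
  define E where "E z = F z - F 1 - A * (z - 1)" for z
  define M where "M = \<bar>L\<bar> + norm A + 1"
  have M: "M > 0" by (simp add: M_def add_nonneg_pos)
  have contE: "continuous_on (cball 0 1) E"
    unfolding E_def by (intro continuous_intros cont)
  have holE: "E holomorphic_on ball 0 1"
    unfolding E_def by (intro holomorphic_intros hol)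
  have EM: "norm (E z) \<le> M * norm (z - 1)" if "z \<in> cball 0 1" for z
  proof -
    have "norm (E z) \<le> norm (F z - F 1) + norm (A * (z - 1))"
      unfolding E_def by (rule norm_triangle_ineq4)
    also have "\<dots> \<le> \<bar>L\<bar> * norm (z - 1) + norm A * norm (z - 1)"
      using lip[OF that] mult_right_mono[OF abs_ge_self[of L] norm_ge_zero[of "z - 1"]]
      by (simp add: norm_mult)
    also have "\<dots> \<le> M * norm (z - 1)" by (simp add: M_def algebra_simps)
    finally show ?thesis .
  qed
  have derivE: "deriv E r = deriv F r - A" if "r \<in> ball 0 1" for r
  proof -
    have "(F has_field_derivative deriv F r) (at r)"
      using holomorphic_derivI[OF hol open_ball that] .
    then have "(E has_field_derivative deriv F r - A) (at r)"
      unfolding E_def by (auto intro!: derivative_eq_intros)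
    then show ?thesis by (rule DERIV_imp_deriv)
  qed
  show ?thesis
  proof (rule tendstoI)
    fix e :: real assume e: "e > 0"
    \<comment> \<open>The estimates below lose a factor 6.\<close>
    define \<epsilon> where "\<epsilon> = min M (e / 7)"
    have \<epsilon>: "0 < \<epsilon>" "\<epsilon> \<le> M" "6 * \<epsilon> < e" using e M by (auto simp: \<epsilon>_def)
    from tendstoD[OF bd \<epsilon>(1)] obtain \<delta> where \<delta>: "\<delta> > 0" and
      d: "\<And>w. norm w = 1 \<Longrightarrow> w \<noteq> 1 \<Longrightarrow> norm (w - 1) < \<delta> \<Longrightarrow> dist ((F w - F 1) / (w - 1)) A < \<epsilon>"
      unfolding eventually_at by (auto simp: dist_norm)
    have near: "norm (E w) \<le> \<epsilon> * norm (w - 1)" if w: "norm w = 1" "norm (w - 1) < \<delta>" for w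
    proof (cases "w = 1")
      case False
      then have "E w = ((F w - F 1) / (w - 1) - A) * (w - 1)" by (simp add: E_def field_simps)
      then have "norm (E w) = dist ((F w - F 1) / (w - 1)) A * norm (w - 1)"
        by (simp add: norm_mult dist_norm)
      also have "\<dots> \<le> \<epsilon> * norm (w - 1)"
        using d[OF w(1) False w(2)] by (intro mult_right_mono) auto
      finally show ?thesis .
    qed (simp add: E_def)
    define \<kappa> where "\<kappa> = (2 / \<delta>\<^sup>2) * ln (M / \<epsilon>)"
    have kap0: "\<kappa> \<ge> 0" using \<epsilon> M by (simp add: \<kappa>_def)
    \<comment> \<open>At distance less than \<open>\<eta>\<close> from 1 the exponential is at most 2.\<close>
    define \<eta> where "\<eta> = ln 2 / (\<kappa> + 1)"
    have \<eta>: "\<eta> > 0" using kap0 by (simp add: \<eta>_def)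
    have nearE: "norm (E z) \<le> 2 * \<epsilon> * norm (z - 1)" if z: "norm z < 1" "norm (z - 1) < \<eta>" for z
    proof -
      have "Re (1 - z) \<le> norm (z - 1)"
        using complex_Re_le_cmod[of "1 - z"] by (simp add: norm_minus_commute)
      then have "\<kappa> * Re (1 - z) \<le> \<kappa> * \<eta>" using kap0 z(2) by (intro mult_left_mono) auto
      also have "\<dots> \<le> ln 2" using kap0 by (simp add: \<eta>_def field_simps)
      finally have "exp (\<kappa> * Re (1 - z)) \<le> exp (ln 2)" by (simp only: exp_le_cancel_iff)
      then have "exp (\<kappa> * Re (1 - z)) \<le> 2" by simp
      then have "\<epsilon> * exp (\<kappa> * Re (1 - z)) * norm (z - 1) \<le> \<epsilon> * 2 * norm (z - 1)"
        using \<epsilon> by (intro mult_right_mono mult_left_mono) auto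
      moreover have "norm (E z) \<le> \<epsilon> * exp (\<kappa> * Re (1 - z)) * norm (z - 1)"
        unfolding \<kappa>_def using z by (intro boundary_decay_transfers_inside[OF contE holE EM M \<epsilon>(1,2) \<delta> near]) auto
      ultimately show ?thesis by (simp add: mult_ac)
    qed
    have "\<forall>\<^sub>F r in at_left 1. r > (max 0 (1 - \<eta> / 2) :: real)"
      using \<eta> by (intro eventually_at_leftI[of "max 0 (1 - \<eta> / 2)"]) auto
    moreover have "\<forall>\<^sub>F r in at_left 1. r < (1::real)"
      by (intro eventually_at_leftI[of 0]) auto
    ultimately show "\<forall>\<^sub>F r in at_left 1. dist (deriv F (of_real r)) A < e"
    proof eventually_elim
      case (elim r)
      \<comment> \<open>The disc of radius \<open>\<rho>\<close> around \<open>r\<close> stays inside the unit disc, at distance at most \<open>3 \<rho>\<close> from 1.\<close>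
      define \<rho> where "\<rho> = (1 - r) / 2"
      have \<rho>: "\<rho> > 0" using elim by (simp add: \<rho>_def)
      have in_ball: "norm w < 1" if "norm (of_real r - w) \<le> \<rho>" for w :: complex
      proof -
        have "norm w \<le> norm (of_real r :: complex) + norm (of_real r - w)"
          by (metis norm_minus_commute norm_triangle_sub)
        then show ?thesis using that elim by (simp add: \<rho>_def)
      qed
      have "norm ((deriv ^^ 1) E (of_real r)) \<le> fact 1 * (6 * \<epsilon> * \<rho>) / \<rho> ^ 1"
      proof (rule Cauchy_inequality[OF _ _ \<rho>])
        show "E holomorphic_on ball (of_real r) \<rho>"
          by (rule holomorphic_on_subset[OF holE]) (use in_ball in \<open>auto simp: dist_norm\<close>)
        show "continuous_on (cball (of_real r) \<rho>) E"
          using less_imp_le[OF in_ball]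
          by (intro continuous_on_subset[OF contE] subsetI) (simp add: dist_norm)
        fix w :: complex assume w: "norm (of_real r - w) = \<rho>"
        have "norm (w - 1) \<le> norm (w - of_real r) + norm (of_real r - 1 :: complex)"
          by (metis diff_add_cancel add_diff_eq norm_triangle_ineq)
        also have "norm (of_real r - 1 :: complex) = 1 - r"
          using elim by (metis abs_minus_commute abs_of_pos diff_gt_0_iff_gt norm_of_real of_real_1 of_real_diff)
        finally have w1: "norm (w - 1) \<le> 3 * \<rho>" using w by (simp add: \<rho>_def norm_minus_commute)
        moreover have "3 * \<rho> < \<eta>" using elim \<eta> by (simp add: \<rho>_def)
        ultimately have "norm (E w) \<le> 2 * \<epsilon> * norm (w - 1)"
          using in_ball[of w] w by (intro nearE) auto
        also have "\<dots> \<le> 2 * \<epsilon> * (3 * \<rho>)" using w1 \<epsilon> by (intro mult_left_mono) auto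
        finally show "norm (E w) \<le> 6 * \<epsilon> * \<rho>" by simp
      qed
      then have "norm (deriv E (of_real r)) \<le> 6 * \<epsilon>" using \<rho> by simp
      then show ?case using derivE[of "of_real r"] elim \<epsilon> by (simp add: dist_norm)
    qed
  qed
qed

lemma cis_lipschitz: "1-lipschitz_on UNIV cis"
proof (rule lipschitz_onI)
  fix s t :: real
  have "norm (cis s - cis t) \<le> 1 * norm (s - t)"
  proof (rule differentiable_bound[of UNIV cis "\<lambda>x h. h *\<^sub>R (\<i> * cis x)"])
    fix x :: real
    show "(cis has_derivative (\<lambda>h. h *\<^sub>R (\<i> * cis x))) (at x within UNIV)"
      using has_derivative_cis[of "\<lambda>x. x" "\<lambda>x. x" x UNIV] by simp
    show "onorm (\<lambda>h. h *\<^sub>R (\<i> * cis x)) \<le> 1"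
      by (rule onorm_bound) (auto simp: norm_mult)
  qed auto
  then show "dist (cis s) (cis t) \<le> 1 * dist s t" by (simp add: dist_norm)
qed simp

text \<open>
  A primitive \<open>F\<close> of the bounded function \<open>f\<close> is Lipschitz, so it extends to the closed disc and
  \<open>t \<mapsto> F (cis t)\<close> is Lipschitz, hence differentiable almost everywhere. Wherever this derivative exists,
  \<open>f = F'\<close> has a radial limit by \<open>radial_derivative_limit\<close>, applied to \<open>F\<close> rotated so that the boundary
  point becomes 1.
\<close>

theorem Fatou_radial_limit:
  fixes f :: "complex \<Rightarrow> complex"
  assumes hol: "f holomorphic_on ball 0 1" and bdd: "bounded (f ` ball 0 1)"
  obtains N where "negligible N"
    "\<And>t. t \<notin> N \<Longrightarrow> \<exists>l. ((\<lambda>r. f (of_real r * cis t)) \<longlongrightarrow> l) (at_left 1)"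
proof -
  obtain B where B: "\<And>z. z \<in> ball 0 1 \<Longrightarrow> norm (f z) \<le> B"
    using bdd unfolding bounded_iff by blast
  have B0: "0 \<le> B" using B[of 0] norm_ge_zero[of "f 0"] by (simp del: norm_ge_zero)
  obtain F0 where F0: "\<And>z. z \<in> ball 0 1 \<Longrightarrow> (F0 has_field_derivative f z) (at z within ball 0 1)"
    using holomorphic_convex_primitive'[OF convex_ball open_ball hol] by blast
  have "B-lipschitz_on (ball 0 1) F0"
  proof (rule lipschitz_onI)
    fix x y :: complex assume "x \<in> ball 0 1" "y \<in> ball 0 1"
    then show "dist (F0 x) (F0 y) \<le> B * dist x y"
      unfolding dist_norm using F0 B by (intro field_differentiable_bound[of "ball 0 1"]) auto
  qed (rule B0)
  from lipschitz_extend_closure[OF this] obtain F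
    where lipF: "B-lipschitz_on (cball 0 1) F" and FF0: "\<And>z. z \<in> ball 0 1 \<Longrightarrow> F z = F0 z"
    by auto
  have derF: "(F has_field_derivative f z) (at z)" if "z \<in> ball 0 1" for z
  proof (rule has_field_derivative_transform_within_open[of F0 _ _ "ball 0 1"])
    show "(F0 has_field_derivative f z) (at z)"
      using F0[OF that] that by (simp add: at_within_open[OF _ open_ball])
  qed (use that FF0 in auto)
  define G where "G t = F (cis t)" for t
  have lipG: "B-lipschitz_on UNIV G"
  proof -
    have "(B * 1)-lipschitz_on UNIV (F \<circ> cis)"
      by (rule lipschitz_on_compose[OF cis_lipschitz lipschitz_on_subset[OF lipF]]) auto
    then show ?thesis by (simp add: G_def[abs_def] comp_def)
  qed
  have ReG: "B-lipschitz_on UNIV (\<lambda>t. Re (G t))"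
  proof (rule lipschitz_onI)
    fix s t show "dist (Re (G s)) (Re (G t)) \<le> B * dist s t"
      using lipschitz_onD[OF lipG, of s t] abs_Re_le_cmod[of "G s - G t"]
      by (simp add: dist_norm)
  qed (rule B0)
  have ImG: "B-lipschitz_on UNIV (\<lambda>t. Im (G t))"
  proof (rule lipschitz_onI)
    fix s t show "dist (Im (G s)) (Im (G t)) \<le> B * dist s t"
      using lipschitz_onD[OF lipG, of s t] abs_Im_le_cmod[of "G s - G t"]
      by (simp add: dist_norm)
  qed (rule B0)
  obtain N1 where N1: "negligible N1" "\<And>x. x \<notin> N1 \<Longrightarrow> \<exists>D. ((\<lambda>t. Re (G t)) has_real_derivative D) (at x)"
    using lipschitz_negligible_nondifferentiable[OF ReG] by blast
  obtain N2 where N2: "negligible N2" "\<And>x. x \<notin> N2 \<Longrightarrow> \<exists>D. ((\<lambda>t. Im (G t)) has_real_derivative D) (at x)"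
    using lipschitz_negligible_nondifferentiable[OF ImG] by blast
  show ?thesis
  proof
    show "negligible (N1 \<union> N2)" using N1 N2 by (simp add: negligible_Un)
    fix t assume t: "t \<notin> N1 \<union> N2"
    obtain D1 D2 where D: "((\<lambda>t. Re (G t)) has_real_derivative D1) (at t)"
      "((\<lambda>t. Im (G t)) has_real_derivative D2) (at t)"
      using N1(2)[of t] N2(2)[of t] t by auto
    have dq: "((\<lambda>s. (G (t + s) - G t) /\<^sub>R s) \<longlongrightarrow> Complex D1 D2) (at 0)"
    proof -
      have "((\<lambda>s. Complex ((Re (G (t + s)) - Re (G t)) / s) ((Im (G (t + s)) - Im (G t)) / s))
              \<longlongrightarrow> Complex D1 D2) (at 0)"
        using D unfolding DERIV_def by (rule tendsto_Complex)
      moreover have "Complex ((Re (G (t + s)) - Re (G t)) / s) ((Im (G (t + s)) - Im (G t)) / s)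
          = (G (t + s) - G t) /\<^sub>R s" for s
        by (simp add: complex_eq_iff divide_inverse mult.commute)
      ultimately show ?thesis by simp
    qed
    have cq: "((\<lambda>s. (cis s - 1) /\<^sub>R s) \<longlongrightarrow> \<i>) (at 0)"
    proof -
      have "((\<lambda>s. Complex ((cos (0 + s) - cos 0) / s) ((sin (0 + s) - sin 0) / s))
              \<longlongrightarrow> Complex (- sin 0) (cos 0)) (at (0::real))"
        using DERIV_cos[of "0::real"] DERIV_sin[of "0::real"] unfolding DERIV_def by (rule tendsto_Complex)
      moreover have "Complex ((cos (0 + s) - cos 0) / s) ((sin (0 + s) - sin 0) / s) = (cis s - 1) /\<^sub>R s"
        for s :: real by (simp add: complex_eq_iff divide_inverse mult.commute)
      moreover have "Complex (- sin 0) (cos 0) = \<i>" by (simp add: complex_eq_iff)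
      ultimately show ?thesis by simp
    qed
    \<comment> \<open>Passing from the angle \<open>s\<close> to the point \<open>w = cis s\<close> divides the derivative by that of \<open>cis\<close> at 0, which is \<open>\<i>\<close>.\<close>
    have quot: "((\<lambda>s. (G (t + s) - G t) / (cis s - 1)) \<longlongrightarrow> Complex D1 D2 / \<i>) (at 0)"
    proof (rule Lim_transform_eventually[OF tendsto_divide[OF dq cq]])
      show "\<forall>\<^sub>F s in at 0. (G (t + s) - G t) /\<^sub>R s / ((cis s - 1) /\<^sub>R s) = (G (t + s) - G t) / (cis s - 1)"
        unfolding eventually_at by (intro exI[of _ 1]) (auto simp: scaleR_conv_of_real)
    qed simp
    define c where "c = cis t"
    have c1: "norm c = 1" "c \<noteq> 0" by (auto simp: c_def)
    define F' where "F' w = F (c * w)" for w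
    have contF: "continuous_on (cball 0 1) F" by (rule lipschitz_on_continuous_on[OF lipF])
    have "continuous_on (cball 0 1) F'"
      unfolding F'_def by (intro continuous_on_compose2[OF contF] continuous_intros)
        (auto simp: norm_mult c1)
    moreover have derF': "(F' has_field_derivative f (c * z) * c) (at z)" if "z \<in> ball 0 1" for z
    proof -
      have "c * z \<in> ball 0 1" using that by (simp add: norm_mult c1)
      moreover have "((\<lambda>z. c * z) has_field_derivative c) (at z)"
        by (auto intro!: derivative_eq_intros)
      ultimately show ?thesis
        unfolding F'_def by (intro DERIV_chain2[where f = F and g = "\<lambda>z. c * z"] derF)
    qed
    moreover have "F' holomorphic_on ball 0 1"
      using derF' by (metis holomorphic_on_open open_ball)
    moreover have "norm (F' z - F' 1) \<le> B * norm (z - 1)" if "z \<in> cball 0 1" for z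
    proof -
      have "dist (F (c * z)) (F (c * 1)) \<le> B * dist (c * z) (c * 1)"
        using that by (intro lipschitz_onD[OF lipF]) (auto simp: norm_mult c1)
      also have "dist (c * z) (c * 1) = norm (z - 1)"
        by (simp only: dist_norm right_diff_distrib[symmetric] norm_mult c1)
      finally show ?thesis by (simp add: F'_def dist_norm)
    qed
    moreover have "((\<lambda>w. (F' w - F' 1) / (w - 1)) \<longlongrightarrow> Complex D1 D2 / \<i>) (at 1 within sphere 0 1)"
    proof -
      have ev: "\<forall>\<^sub>F w in at 1 within sphere 0 1. w \<in> sphere (0::complex) 1 \<and> w \<noteq> 1"
        by (simp add: eventually_at_filter)
      have "filterlim Arg (at 0) (at 1 within sphere 0 1)"
        unfolding filterlim_at
      proof
        have "continuous (at 1 within sphere 0 1) Arg" by (rule continuous_within_Arg) auto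
        then show "(Arg \<longlongrightarrow> 0) (at 1 within sphere 0 1)" by (simp add: continuous_within)
        show "\<forall>\<^sub>F w in at 1 within sphere 0 1. Arg w \<in> UNIV \<and> Arg w \<noteq> 0"
          using ev
        proof eventually_elim
          case (elim w)
          then have "exp (\<i> * Arg w) = w" using complex_norm_eq_1_exp_eq by simp
          then show ?case using elim by auto
        qed
      qed
      from filterlim_compose[OF quot this]
      have "((\<lambda>w. (G (t + Arg w) - G t) / (cis (Arg w) - 1)) \<longlongrightarrow> Complex D1 D2 / \<i>) (at 1 within sphere 0 1)" .
      then show ?thesis
      proof (rule Lim_transform_eventually)
        show "\<forall>\<^sub>F w in at 1 within sphere 0 1.
            (G (t + Arg w) - G t) / (cis (Arg w) - 1) = (F' w - F' 1) / (w - 1)"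
          using ev
        proof eventually_elim
          case (elim w)
          then have "exp (\<i> * Arg w) = w" using complex_norm_eq_1_exp_eq by simp
          then have "cis (Arg w) = w" by (simp add: cis_conv_exp)
          then show ?case by (simp add: G_def F'_def c_def cis_mult[symmetric])
        qed
      qed
    qed
    ultimately have lim: "((\<lambda>r. deriv F' (of_real r)) \<longlongrightarrow> Complex D1 D2 / \<i>) (at_left 1)"
      by (intro radial_derivative_limit) auto
    have "((\<lambda>r. deriv F' (of_real r) / c) \<longlongrightarrow> Complex D1 D2 / \<i> / c) (at_left 1)"
      by (intro tendsto_divide lim tendsto_const c1)
    moreover have "\<forall>\<^sub>F r in at_left 1. deriv F' (of_real r) / c = f (of_real r * cis t)"
    proof -
      have "\<forall>\<^sub>F r in at_left (1::real). r \<in> {0<..<1}"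
        by (intro eventually_at_leftI[of 0]) auto
      then show ?thesis
      proof eventually_elim
        case (elim r)
        then have "deriv F' (of_real r) = f (c * of_real r) * c"
          by (intro DERIV_imp_deriv derF') auto
        then show ?case using c1 by (simp add: c_def mult.commute)
      qed
    qed
    ultimately have "((\<lambda>r. f (of_real r * cis t)) \<longlongrightarrow> Complex D1 D2 / \<i> / c) (at_left 1)"
      by (rule Lim_transform_eventually)
    then show "\<exists>l. ((\<lambda>r. f (of_real r * cis t)) \<longlongrightarrow> l) (at_left 1)" by blast
  qed
qed

section \<open>Inner functions\<close>

lemma cis_measurable_sphere:
  "cis \<in> measurable (uniform_measure lborel {0..2 * pi}) (restrict_space borel (sphere 0 1))"
proof -
  have "cis \<in> borel_measurable (borel :: real measure)"
    by (intro borel_measurable_continuous_onI continuous_intros)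
  then show ?thesis by (intro measurable_restrict_space2) auto
qed

lemma AE_lborel_not_negligible:
  assumes "negligible N"
  shows "AE t in lborel. t \<notin> N"
proof -
  have "N \<in> null_sets lebesgue" using assms by (simp add: negligible_iff_null_sets)
  then have "AE t in lebesgue. t \<notin> N" by (rule AE_not_in)
  then show ?thesis by (simp add: AE_completion_iff)
qed

text \<open>
  The definition of an inner function speaks of \<open>Lim\<close>, which says something about \<open>f\<close> only where the
  radial limit exists. By Fatou's theorem this is the case almost everywhere.
\<close>

lemma inner_function_radial_modulus:
  assumes "inner_function f"
  shows "AE t in lborel. t \<in> {0..2 * pi} \<longrightarrow>
           ((\<lambda>r. norm (f (of_real r * cis t))) \<longlongrightarrow> 1) (at_left 1)"
proof -
  have hol: "f holomorphic_on ball 0 1" and bdd: "bounded (f ` ball 0 1)"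
    and ae: "AE \<zeta> in circle_measure. norm (radial_limit_disc f \<zeta>) = 1"
    using assms by (auto simp: inner_function_def)
  obtain N where N: "negligible N"
    "\<And>t. t \<notin> N \<Longrightarrow> \<exists>l. ((\<lambda>r. f (of_real r * cis t)) \<longlongrightarrow> l) (at_left 1)"
    using Fatou_radial_limit[OF hol bdd] by blast
  from AE_distrD[OF cis_measurable_sphere ae[unfolded circle_measure_def]]
  have "AE t in uniform_measure lborel {0..2 * pi}. norm (radial_limit_disc f (cis t)) = 1" .
  then have "AE t in lborel. t \<in> {0..2 * pi} \<longrightarrow> norm (radial_limit_disc f (cis t)) = 1"
    by (subst (asm) AE_uniform_measure) auto
  then show ?thesis
    using AE_lborel_not_negligible[OF N(1)]
  proof eventually_elim
    case (elim t)
    show ?case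
    proof
      assume t: "t \<in> {0..2 * pi}"
      obtain l where l: "((\<lambda>r. f (of_real r * cis t)) \<longlongrightarrow> l) (at_left 1)"
        using N(2) elim by blast
      then have "radial_limit_disc f (cis t) = l"
        unfolding radial_limit_disc_def by (intro tendsto_Lim) auto
      then have "norm l = 1" using elim t by simp
      then show "((\<lambda>r. norm (f (of_real r * cis t))) \<longlongrightarrow> 1) (at_left 1)"
        using tendsto_norm[OF l] by simp
    qed
  qed
qed

text \<open>
  Cauchy's formula for \<open>g\<^sup>m\<close> on the circle of radius \<open>\<rho>\<close> bounds \<open>(\<rho> - |a|) |g a|\<^sup>m\<close> by the mean of
  \<open>|g|\<^sup>m\<close>. As \<open>\<rho>\<close> tends to 1, dominated convergence makes the limit of the means at most 1, and
  \<open>m \<rightarrow> \<infinity>\<close> removes the constant \<open>1 - |a|\<close>.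
\<close>

lemma radial_maximum_principle:
  fixes g :: "complex \<Rightarrow> complex"
  assumes hol: "g holomorphic_on ball 0 1"
    and C: "\<And>z. z \<in> ball 0 1 \<Longrightarrow> norm (g z) \<le> C"
    and ae: "AE t in lborel. t \<in> {0..2 * pi} \<longrightarrow>
           (\<forall>e>0. \<forall>\<^sub>F r in at_left 1. norm (g (of_real r * cis t)) \<le> 1 + e)"
    and a: "a \<in> ball 0 1"
  shows "norm (g a) \<le> 1"
proof -
  define \<rho> where "\<rho> j = 1 - 1 / (real j + 2)" for j :: nat
  have \<rho>: "0 < \<rho> j" "\<rho> j < 1" for j by (auto simp: \<rho>_def field_simps)
  have \<rho>_lim: "\<rho> \<longlonglongrightarrow> 1"
    unfolding \<rho>_def by real_asymp
  have \<rho>_lim': "filterlim \<rho> (at_left 1) sequentially"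
    unfolding filterlim_at using \<rho>_lim \<rho> by (auto intro!: always_eventually simp: less_imp_neq)
  have C0: "0 \<le> C" using C[OF a] norm_ge_zero[of "g a"] by linarith
  have main: "(1 - norm a) * norm (g a) ^ m \<le> 1 * 1 ^ m" for m :: nat
  proof -
    \<comment> \<open>Truncation from below at 1 turns an upper bound in the limit into convergence.\<close>
    define h where "h j t = max 1 (norm (g (of_real (\<rho> j) * cis t))) ^ m" for j t
    have contg: "continuous_on (ball 0 1) g" by (rule holomorphic_on_imp_continuous_on[OF hol])
    have conth: "continuous_on UNIV (h j)" for j
      unfolding h_def using \<rho>[of j]
      by (intro continuous_intros continuous_on_compose2[OF contg]) (auto simp: norm_mult)
    have h_int: "h j integrable_on {0..2 * pi}" for j
      by (rule integrable_continuous_interval) (rule continuous_on_subset[OF conth], simp)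
    have h_leb: "integral {0..2 * pi} (h j) = (\<integral>t. indicator {0..2 * pi} t *\<^sub>R h j t \<partial>lborel)" for j
      using set_borel_integral_eq_integral(2)[OF borel_integrable_atLeastAtMost'[of 0 "2 * pi" "h j"]]
        continuous_on_subset[OF conth] by (simp add: set_lebesgue_integral_def)
    have "(\<lambda>j. \<integral>t. indicator {0..2 * pi} t *\<^sub>R h j t \<partial>lborel)
        \<longlonglongrightarrow> (\<integral>t. indicator {0..2 * pi} t *\<^sub>R (1::real) \<partial>lborel)"
    proof (rule integral_dominated_convergence[where w = "\<lambda>t. indicator {0..2 * pi} t *\<^sub>R (max 1 C ^ m)"])
      show "(\<lambda>t. indicator {0..2 * pi} t *\<^sub>R h j t) \<in> borel_measurable lborel" for j
        using borel_measurable_continuous_onI[OF conth[of j]] by measurable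
      show "integrable lborel (\<lambda>t. indicator {0..2 * pi} t *\<^sub>R (max 1 C ^ m))"
        by (intro integrable_scaleR_left integrable_real_indicator) auto
      show "AE t in lborel. (\<lambda>j. indicator {0..2 * pi} t *\<^sub>R h j t)
              \<longlonglongrightarrow> indicator {0..2 * pi} t *\<^sub>R (1::real)"
        using ae
      proof eventually_elim
        case (elim t)
        show ?case
        proof (cases "t \<in> {0..2 * pi}")
          case True
          have "(\<lambda>j. max 1 (norm (g (of_real (\<rho> j) * cis t)))) \<longlonglongrightarrow> 1"
          proof (rule tendstoI)
            fix e :: real assume e: "e > 0"
            have "\<forall>\<^sub>F r in at_left 1. norm (g (of_real r * cis t)) \<le> 1 + e / 2"
              using elim True e by (meson half_gt_zero)
            then have "\<forall>\<^sub>F j in sequentially. norm (g (of_real (\<rho> j) * cis t)) \<le> 1 + e / 2"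
              by (rule eventually_compose_filterlim[OF _ \<rho>_lim'])
            then show "\<forall>\<^sub>F j in sequentially. dist (max 1 (norm (g (of_real (\<rho> j) * cis t)))) 1 < e"
              by eventually_elim (use e in \<open>auto simp: dist_real_def\<close>)
          qed
          from tendsto_power[OF this, of m] show ?thesis using True by (simp add: h_def)
        qed simp
      qed
      show "AE t in lborel. norm (indicator {0..2 * pi} t *\<^sub>R h j t)
          \<le> indicator {0..2 * pi} t *\<^sub>R (max 1 C ^ m)" for j
      proof (rule AE_I2)
        fix t :: real
        have "norm (g (of_real (\<rho> j) * cis t)) \<le> C"
          using \<rho>[of j] by (intro C) (auto simp: norm_mult)
        then have "h j t \<le> max 1 C ^ m" unfolding h_def by (intro power_mono) auto
        moreover have "0 \<le> h j t" unfolding h_def by (intro zero_le_power) auto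
        ultimately show "norm (indicator {0..2 * pi} t *\<^sub>R h j t) \<le> indicator {0..2 * pi} t *\<^sub>R (max 1 C ^ m)"
          by (auto simp: indicator_def)
      qed
    qed simp
    then have lim: "(\<lambda>j. integral {0..2 * pi} (h j)) \<longlonglongrightarrow> 2 * pi"
      by (simp add: h_leb)
    have bound: "(\<rho> j - norm a) * (2 * pi * norm (g a) ^ m) \<le> integral {0..2 * pi} (h j)"
      if ja: "norm a < \<rho> j" for j
    proof -
      define r where "r = \<rho> j"
      have r: "0 < r" "r < 1" "norm a < r" using \<rho>[of j] ja by (auto simp: r_def)
      have sub: "cball 0 r \<subseteq> ball (0::complex) 1" using r by auto
      have "((\<lambda>u. g u ^ m / (u - a)) has_contour_integral (2 * of_real pi * \<i> * g a ^ m)) (circlepath 0 r)"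
        using r sub by (intro Cauchy_integral_circlepath continuous_intros holomorphic_intros
            continuous_on_subset[OF contg] holomorphic_on_subset[OF hol]) auto
      then have hi: "((\<lambda>t. g (0 + of_real r * cis t) ^ m / (0 + of_real r * cis t - a) * of_real r * \<i> * cis t)
          has_integral (2 * of_real pi * \<i> * g a ^ m)) {0..2 * pi}"
        unfolding circlepath_def by (subst (asm) has_contour_integral_part_circlepath_iff) auto
      have "norm (2 * of_real pi * \<i> * g a ^ m) \<le> integral {0..2 * pi} (\<lambda>t. 1 / (r - norm a) * h j t)"
        unfolding integral_unique[OF hi, symmetric]
      proof (rule integral_norm_bound_integral)
        show "(\<lambda>t. g (0 + of_real r * cis t) ^ m / (0 + of_real r * cis t - a) * of_real r * \<i> * cis t)
            integrable_on {0..2 * pi}" using hi by (rule has_integral_integrable)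
        show "(\<lambda>t. 1 / (r - norm a) * h j t) integrable_on {0..2 * pi}"
          by (rule integrable_on_mult_right[OF h_int])
        fix t
        have "r - norm a \<le> norm (of_real r * cis t - a)"
          using norm_triangle_ineq2[of "of_real r * cis t" a] r by (simp add: norm_mult)
        moreover have "norm (g (of_real r * cis t)) ^ m \<le> h j t"
          unfolding h_def r_def by (intro power_mono) auto
        moreover have "0 \<le> h j t" unfolding h_def by (intro zero_le_power) auto
        ultimately have "norm (g (of_real r * cis t)) ^ m * r / norm (of_real r * cis t - a)
            \<le> h j t * 1 / (r - norm a)"
          using r by (intro frac_le mult_mono) auto
        then show "norm (g (0 + of_real r * cis t) ^ m / (0 + of_real r * cis t - a) * of_real r * \<i> * cis t)
            \<le> 1 / (r - norm a) * h j t"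
          using r by (simp add: norm_mult norm_divide norm_power)
      qed
      also have "\<dots> = 1 / (r - norm a) * integral {0..2 * pi} (h j)" by simp
      finally show ?thesis using r by (simp add: norm_mult norm_power r_def field_simps)
    qed
    have "(1 - norm a) * (2 * pi * norm (g a) ^ m) \<le> 2 * pi"
    proof (rule LIMSEQ_le)
      show "(\<lambda>j. (\<rho> j - norm a) * (2 * pi * norm (g a) ^ m)) \<longlonglongrightarrow> (1 - norm a) * (2 * pi * norm (g a) ^ m)"
        by (intro tendsto_intros \<rho>_lim)
      show "(\<lambda>j. integral {0..2 * pi} (h j)) \<longlonglongrightarrow> 2 * pi" by (rule lim)
      have "\<forall>\<^sub>F j in sequentially. norm a < \<rho> j"
        using order_tendstoD(1)[OF \<rho>_lim] a by simp
      then show "\<exists>N. \<forall>j\<ge>N. (\<rho> j - norm a) * (2 * pi * norm (g a) ^ m) \<le> integral {0..2 * pi} (h j)"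
        unfolding eventually_sequentially using bound by blast
    qed
    moreover have "(1 - norm a) * (2 * pi * norm (g a) ^ m) = 2 * pi * ((1 - norm a) * norm (g a) ^ m)"
      by simp
    ultimately show ?thesis
      using mult_le_cancel_left_pos[of "2 * pi" "(1 - norm a) * norm (g a) ^ m" 1] by simp
  qed
  show ?thesis
    using a by (intro le_if_powers_dominated[OF _ _ main]) auto
qed

lemma inner_function_bound:
  assumes "inner_function f" "z \<in> ball 0 1"
  shows "norm (f z) \<le> 1"
proof -
  obtain C where C: "\<And>z. z \<in> ball 0 1 \<Longrightarrow> norm (f z) \<le> C"
    using assms(1) unfolding inner_function_def bounded_iff by blast
  show ?thesis
  proof (rule radial_maximum_principle[OF _ C _ assms(2)])
    show "f holomorphic_on ball 0 1" using assms(1) by (simp add: inner_function_def)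
    show "AE t in lborel. t \<in> {0..2 * pi} \<longrightarrow>
           (\<forall>e>0. \<forall>\<^sub>F r in at_left 1. norm (f (of_real r * cis t)) \<le> 1 + e)"
      using inner_function_radial_modulus[OF assms(1)]
    proof eventually_elim
      case (elim t)
      show ?case
      proof (intro impI allI)
        fix e :: real assume "t \<in> {0..2 * pi}" "e > 0"
        then have "\<forall>\<^sub>F r in at_left 1. norm (f (of_real r * cis t)) < 1 + e"
          using elim order_tendstoD(2)[of "\<lambda>r. norm (f (of_real r * cis t))" 1 "at_left 1" "1 + e"] by simp
        then show "\<forall>\<^sub>F r in at_left 1. norm (f (of_real r * cis t)) \<le> 1 + e"
          by eventually_elim simp
      qed
    qed
  qed
qed

text \<open>
  Radially \<open>|f|\<close> tends to 1, so \<open>|\<phi>| \<le> 1 / |f|\<close> gives the boundary hypothesis of the maximum principle.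
  That \<open>\<phi>\<close> is bounded matters: for the singular inner function \<open>f z = exp (- (1 + z) / (1 - z))\<close> the
  quotient \<open>1 / f\<close> is unbounded although \<open>f * (1 / f) = 1\<close>.
\<close>

lemma inner_function_cancel_bound:
  assumes f: "inner_function f"
    and hol: "\<phi> holomorphic_on ball 0 1" and C: "\<And>z. z \<in> ball 0 1 \<Longrightarrow> norm (\<phi> z) \<le> C"
    and prod: "\<And>z. z \<in> ball 0 1 \<Longrightarrow> norm (f z * \<phi> z) \<le> 1"
    and z: "z \<in> ball 0 1"
  shows "norm (\<phi> z) \<le> 1"
proof (rule radial_maximum_principle[OF hol C _ z])
  show "AE t in lborel. t \<in> {0..2 * pi} \<longrightarrow>
           (\<forall>e>0. \<forall>\<^sub>F r in at_left 1. norm (\<phi> (of_real r * cis t)) \<le> 1 + e)"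
    using inner_function_radial_modulus[OF f]
  proof eventually_elim
    case (elim t)
    show ?case
    proof (intro impI allI)
      fix e :: real assume t: "t \<in> {0..2 * pi}" and e: "e > 0"
      have "\<forall>\<^sub>F r in at_left 1. norm (f (of_real r * cis t)) > 1 / (1 + e)"
        using elim t e order_tendstoD(1)[of "\<lambda>r. norm (f (of_real r * cis t))" 1 "at_left 1" "1 / (1 + e)"] by simp
      moreover have "\<forall>\<^sub>F r in at_left (1::real). r \<in> {0<..<1}"
        by (intro eventually_at_leftI[of 0]) auto
      ultimately show "\<forall>\<^sub>F r in at_left 1. norm (\<phi> (of_real r * cis t)) \<le> 1 + e"
      proof eventually_elim
        case (elim r)
        have "1 / (1 + e) * norm (\<phi> (of_real r * cis t)) \<le> norm (f (of_real r * cis t)) * norm (\<phi> (of_real r * cis t))"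
          using elim(1) by (intro mult_right_mono) auto
        also have "\<dots> \<le> 1" using prod[of "of_real r * cis t"] elim(2) by (simp add: norm_mult)
        finally show ?case using e by (simp add: field_simps)
      qed
    qed
  qed
qed

text \<open>
  If \<open>f\<close> vanished identically, the constant 2 could be cancelled against it.
\<close>

lemma inner_function_nonzero:
  assumes "inner_function f"
  obtains a where "a \<in> ball 0 1" "f a \<noteq> 0"
proof -
  have "\<exists>a\<in>ball 0 1. f a \<noteq> 0"
  proof (rule ccontr)
    assume "\<not> ?thesis"
    then have "norm (2 :: complex) \<le> 1"
      using inner_function_cancel_bound[OF assms, of "\<lambda>_. 2" 2 0] by simp
    then show False by simp
  qed
  then show ?thesis using that by blast
qed

section \<open>Monomials\<close>

abbreviation (input) mon :: "nat set \<Rightarrow> (nat \<Rightarrow> 'a::comm_monoid_mult) \<Rightarrow> (nat \<Rightarrow> nat) \<Rightarrow> 'a" where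
  "mon I z \<alpha> \<equiv> (\<Prod>i\<in>I. z i ^ \<alpha> i)"

lemma norm_mon: "norm (mon I z \<alpha>) = mon I (\<lambda>i. norm (z i :: complex)) \<alpha>"
  by (simp add: prod_norm[symmetric] norm_power)

lemma multi_indices_restrict [simp]: "(\<lambda>i\<in>I. f i) \<in> multi_indices I"
  by (auto simp: multi_indices_def)

lemma multi_indices_eqI:
  "\<alpha> \<in> multi_indices I \<Longrightarrow> \<beta> \<in> multi_indices I \<Longrightarrow> (\<And>i. i \<in> I \<Longrightarrow> \<alpha> i = \<beta> i) \<Longrightarrow> \<alpha> = \<beta>"
  by (metis PiE_ext multi_indices_def)

lemma bounded_multi_indices:
  assumes "finite I" "finite F"
  shows "\<exists>N>0. \<forall>\<alpha>\<in>F. \<forall>i\<in>I. \<alpha> i < (N::nat)"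
proof (intro exI conjI ballI)
  let ?N = "Suc (\<Sum>\<alpha>\<in>F. \<Sum>i\<in>I. \<alpha> i)"
  show "0 < ?N" by simp
  fix \<alpha> i assume *: "\<alpha> \<in> F" "i \<in> I"
  have "\<alpha> i \<le> (\<Sum>i\<in>I. \<alpha> i)" using * assms by (intro member_le_sum) auto
  also have "\<dots> \<le> (\<Sum>\<alpha>\<in>F. \<Sum>i\<in>I. \<alpha> i)" using * assms by (intro member_le_sum) auto
  finally show "\<alpha> i < ?N" by simp
qed

lemma has_sum_finite_sum:
  fixes f :: "'a \<Rightarrow> 'b \<Rightarrow> 'c :: topological_comm_monoid_add"
  assumes "finite X" "\<And>k. k \<in> X \<Longrightarrow> (f k has_sum s k) A"
  shows "((\<lambda>a. \<Sum>k\<in>X. f k a) has_sum (\<Sum>k\<in>X. s k)) A"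
  using assms
proof (induction X)
  case (insert k X)
  have "((\<lambda>a. f k a + (\<Sum>k\<in>X. f k a)) has_sum (s k + (\<Sum>k\<in>X. s k))) A"
    by (rule has_sum_add) (use insert in auto)
  then show ?case using insert.hyps by simp
qed simp

text \<open>
  A finite set of multi-indices lies in a cube, over which the sum factors into geometric sums.
\<close>

lemma summable_mon_nonneg:
  fixes x :: "nat \<Rightarrow> real"
  assumes I: "finite I" and x: "\<And>i. i \<in> I \<Longrightarrow> 0 \<le> x i \<and> x i < 1"
  shows "mon I x summable_on multi_indices I"
proof -
  have bdd: "bdd_above (sum (\<lambda>\<alpha>. mon I x \<alpha>) ` {F. F \<subseteq> multi_indices I \<and> finite F})"
  proof (rule bdd_aboveI2)
    fix F assume F: "F \<in> {F. F \<subseteq> multi_indices I \<and> finite F}"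
    then have finF: "finite F" by simp
    obtain N where N: "\<forall>\<alpha>\<in>F. \<forall>i\<in>I. \<alpha> i < (N::nat)"
      using bounded_multi_indices[OF I finF] by blast
    have "F \<subseteq> (\<Pi>\<^sub>E i\<in>I. {..<N})"
      using F N unfolding multi_indices_def PiE_iff by blast
    then have "sum (mon I x) F \<le> (\<Sum>\<alpha>\<in>(\<Pi>\<^sub>E i\<in>I. {..<N}). mon I x \<alpha>)"
      by (rule sum_mono2[rotated]) (use I x in \<open>auto intro!: prod_nonneg finite_PiE\<close>)
    also have "\<dots> = (\<Prod>i\<in>I. \<Sum>k<N. x i ^ k)"
      using I by (intro prod_sum_PiE[symmetric]) auto
    also have "\<dots> \<le> (\<Prod>i\<in>I. 1 / (1 - x i))"
    proof (rule prod_mono)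
      fix i assume i: "i \<in> I"
      have "(\<Sum>k<N. x i ^ k) \<le> (\<Sum>k. x i ^ k)"
        using x[OF i] by (intro sum_le_suminf summable_geometric) auto
      then show "0 \<le> (\<Sum>k<N. x i ^ k) \<and> (\<Sum>k<N. x i ^ k) \<le> 1 / (1 - x i)"
        using x[OF i] by (auto simp: suminf_geometric intro!: sum_nonneg)
    qed
    finally show "sum (mon I x) F \<le> (\<Prod>i\<in>I. 1 / (1 - x i))" .
  qed
  have nonneg: "0 \<le> mon I x \<alpha>" for \<alpha>
    using x by (intro prod_nonneg) auto
  show ?thesis
    by (rule nonneg_bdd_above_summable_on[OF nonneg bdd])
qed

lemma summable_norm_mon:
  assumes "finite I" "\<And>i. i \<in> I \<Longrightarrow> norm (z i :: complex) < 1"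
  shows "(\<lambda>\<alpha>. norm (mon I z \<alpha>)) summable_on multi_indices I"
  unfolding norm_mon using assms by (intro summable_mon_nonneg) auto

lemma has_sum_mon:
  assumes "finite I" "\<And>i. i \<in> I \<Longrightarrow> norm (z i :: complex) < 1"
  shows "(mon I z has_sum (\<Prod>i\<in>I. 1 / (1 - z i))) (multi_indices I)"
proof -
  have "mon I z summable_on multi_indices I"
    using summable_norm_mon[OF assms] by (simp add: summable_on_iff_abs_summable_on_complex)
  moreover have "infsum (mon I z) (multi_indices I) = (\<Prod>i\<in>I. infsum (\<lambda>k. z i ^ k) UNIV)"
    unfolding multi_indices_def
    by (rule infsum_prod_PiE_abs[OF assms(1)])
      (use assms(2) in \<open>simp add: norm_power summable_on_UNIV_nonneg_real_iff summable_geometric\<close>)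
  moreover have "infsum (\<lambda>k. z i ^ k) UNIV = 1 / (1 - z i)" if "i \<in> I" for i
    using assms(2)[OF that]
    by (intro infsumI norm_summable_imp_has_sum geometric_sums) (auto simp: norm_power summable_geometric)
  ultimately show ?thesis by (simp add: has_sum_iff)
qed

lemma has_power_series_abs:
  assumes "has_power_series I f c" "z \<in> polydisc I"
  shows "(\<lambda>\<alpha>. norm (c \<alpha> * mon I z \<alpha>)) summable_on multi_indices I"
proof -
  have "(\<lambda>\<alpha>. c \<alpha> * mon I z \<alpha>) summable_on multi_indices I"
    using assms unfolding has_power_series_def by (blast intro: has_sum_imp_summable)
  then show ?thesis by (simp only: summable_on_iff_abs_summable_on_complex)
qed

section \<open>Averages over roots of unity\<close>

text \<open>
  Parseval's identity for a finite orthogonal family, in unnormalised form.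
\<close>

lemma orthogonal_combination_norm:
  fixes e :: "'s \<Rightarrow> 'x \<Rightarrow> complex"
  assumes "finite X" "finite S"
    and orth: "\<And>s t. s \<in> S \<Longrightarrow> t \<in> S \<Longrightarrow> (\<Sum>x\<in>X. e s x * cnj (e t x)) = (if s = t then of_real M else 0)"
  shows "(\<Sum>x\<in>X. (norm (\<Sum>s\<in>S. c s * e s x))\<^sup>2) = M * (\<Sum>s\<in>S. (norm (c s))\<^sup>2)"
proof -
  have "complex_of_real (\<Sum>x\<in>X. (norm (\<Sum>s\<in>S. c s * e s x))\<^sup>2)
      = (\<Sum>x\<in>X. (\<Sum>s\<in>S. c s * e s x) * cnj (\<Sum>t\<in>S. c t * e t x))"
    by (simp only: of_real_sum complex_norm_square)
  also have "\<dots> = (\<Sum>x\<in>X. \<Sum>s\<in>S. \<Sum>t\<in>S. (c s * cnj (c t)) * (e s x * cnj (e t x)))"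
    by (simp add: cnj_sum sum_product mult_ac)
  also have "\<dots> = (\<Sum>s\<in>S. \<Sum>x\<in>X. \<Sum>t\<in>S. (c s * cnj (c t)) * (e s x * cnj (e t x)))"
    by (rule sum.swap)
  also have "\<dots> = (\<Sum>s\<in>S. \<Sum>t\<in>S. \<Sum>x\<in>X. (c s * cnj (c t)) * (e s x * cnj (e t x)))"
    by (intro sum.cong refl sum.swap)
  also have "\<dots> = (\<Sum>s\<in>S. \<Sum>t\<in>S. (c s * cnj (c t)) * (if s = t then of_real M else 0))"
    by (intro sum.cong refl) (simp only: sum_distrib_left[symmetric] orth)
  also have "\<dots> = (\<Sum>s\<in>S. of_real M * of_real ((norm (c s))\<^sup>2))"
  proof (intro sum.cong refl)
    fix s assume s: "s \<in> S"
    have "(\<Sum>t\<in>S. (c s * cnj (c t)) * (if s = t then of_real M else 0))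
        = (\<Sum>t\<in>S. if s = t then c s * cnj (c t) * of_real M else 0)"
      by (intro sum.cong) auto
    also have "\<dots> = c s * cnj (c s) * of_real M" using s assms(2) by simp
    also have "\<dots> = of_real M * of_real ((norm (c s))\<^sup>2)"
      by (simp only: complex_norm_square mult_ac)
    finally show "(\<Sum>t\<in>S. (c s * cnj (c t)) * (if s = t then of_real M else 0)) = of_real M * of_real ((norm (c s))\<^sup>2)" .
  qed
  also have "\<dots> = of_real (M * (\<Sum>s\<in>S. (norm (c s))\<^sup>2))"
    by (simp add: sum_distrib_left)
  finally show ?thesis using of_real_eq_iff by blast
qed

text \<open>
  The squared distance of \<open>g\<close> to its orthogonal projection is nonnegative.
\<close>

lemma finite_Bessel:
  fixes e :: "'s \<Rightarrow> 'x \<Rightarrow> complex"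
  assumes "finite X" "finite S" "M > 0"
    and orth: "\<And>s t. s \<in> S \<Longrightarrow> t \<in> S \<Longrightarrow> (\<Sum>x\<in>X. e s x * cnj (e t x)) = (if s = t then of_real M else 0)"
  shows "M * (\<Sum>s\<in>S. (norm ((\<Sum>x\<in>X. g x * cnj (e s x)) / of_real M))\<^sup>2) \<le> (\<Sum>x\<in>X. (norm (g x))\<^sup>2)"
proof -
  define c where "c s = (\<Sum>x\<in>X. g x * cnj (e s x)) / of_real M" for s
  define p where "p x = (\<Sum>s\<in>S. c s * e s x)" for x
  have pp: "(\<Sum>x\<in>X. (norm (p x))\<^sup>2) = M * (\<Sum>s\<in>S. (norm (c s))\<^sup>2)"
    unfolding p_def by (rule orthogonal_combination_norm[OF assms(1,2) orth])
  have "(\<Sum>x\<in>X. g x * cnj (p x)) = (\<Sum>x\<in>X. \<Sum>s\<in>S. cnj (c s) * (g x * cnj (e s x)))"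
    by (simp add: p_def cnj_sum sum_distrib_left mult_ac)
  also have "\<dots> = (\<Sum>s\<in>S. \<Sum>x\<in>X. cnj (c s) * (g x * cnj (e s x)))" by (rule sum.swap)
  also have "\<dots> = (\<Sum>s\<in>S. cnj (c s) * (of_real M * c s))"
  proof (intro sum.cong refl)
    fix s assume "s \<in> S"
    have "(\<Sum>x\<in>X. cnj (c s) * (g x * cnj (e s x))) = cnj (c s) * (\<Sum>x\<in>X. g x * cnj (e s x))"
      by (rule sum_distrib_left[symmetric])
    also have "(\<Sum>x\<in>X. g x * cnj (e s x)) = of_real M * c s" using assms(3) by (simp add: c_def)
    finally show "(\<Sum>x\<in>X. cnj (c s) * (g x * cnj (e s x))) = cnj (c s) * (of_real M * c s)" .
  qed
  also have "\<dots> = of_real (M * (\<Sum>s\<in>S. (norm (c s))\<^sup>2))"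
    by (simp only: sum_distrib_left of_real_mult of_real_sum complex_norm_square mult_ac)
  finally have gp: "(\<Sum>x\<in>X. Re (g x * cnj (p x))) = M * (\<Sum>s\<in>S. (norm (c s))\<^sup>2)"
    by (metis Re_complex_of_real Re_sum)
  have "0 \<le> (\<Sum>x\<in>X. (norm (g x - p x))\<^sup>2)" by (intro sum_nonneg) auto
  also have "\<dots> = (\<Sum>x\<in>X. (norm (g x))\<^sup>2 - 2 * Re (g x * cnj (p x)) + (norm (p x))\<^sup>2)"
    by (intro sum.cong refl) (unfold cmod_power2, simp add: power2_eq_square algebra_simps)
  also have "\<dots> = (\<Sum>x\<in>X. (norm (g x))\<^sup>2) - 2 * (M * (\<Sum>s\<in>S. (norm (c s))\<^sup>2)) + M * (\<Sum>s\<in>S. (norm (c s))\<^sup>2)"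
    by (simp only: sum.distrib sum_subtractf sum_distrib_left[symmetric] gp pp)
  finally show ?thesis by (simp add: c_def)
qed

definition unity_root :: "nat \<Rightarrow> nat \<Rightarrow> complex" where
  "unity_root N k = exp (2 * of_real pi * \<i> * of_nat k / of_nat N)"

lemma norm_unity_root [simp]: "norm (unity_root N k) = 1"
proof -
  have "unity_root N k = exp (\<i> * of_real (2 * pi * real k / real N))"
    by (simp add: unity_root_def mult_ac)
  then show ?thesis by (simp only: norm_exp_i_times)
qed

lemma unity_root_power: "unity_root N k ^ a = unity_root N (k * a)"
  by (simp add: unity_root_def exp_of_nat_mult[symmetric] mult_ac)

lemma unity_root_orthogonal:
  assumes "N > 0"
  shows "(\<Sum>k<N. unity_root N k ^ a * cnj (unity_root N k ^ b))
       = (if a mod N = b mod N then of_nat N else 0)"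
proof -
  define q where "q = unity_root N a * cnj (unity_root N b)"
  have "unity_root N k ^ a * cnj (unity_root N k ^ b) = q ^ k" for k
    by (simp add: q_def power_mult_distrib unity_root_power mult.commute flip: complex_cnj_power)
  then have sum: "(\<Sum>k<N. unity_root N k ^ a * cnj (unity_root N k ^ b)) = (\<Sum>k<N. q ^ k)" by simp
  have inv: "unity_root N b * cnj (unity_root N b) = 1"
    by (metis complex_norm_square norm_unity_root of_real_1 one_power2)
  have "q = 1 \<longleftrightarrow> unity_root N a = unity_root N b"
    unfolding q_def using inv by (metis mult.assoc mult.commute mult.right_neutral)
  then have q1: "q = 1 \<longleftrightarrow> a mod N = b mod N"
    using complex_root_unity_eq[of N a b] assms by (simp add: unity_root_def)
  have "unity_root N a ^ N = 1" for a
    using complex_root_unity[of N a] assms by (simp add: unity_root_def)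
  then have qN: "q ^ N = 1"
    by (simp add: q_def power_mult_distrib flip: complex_cnj_power)
  show ?thesis
  proof (cases "q = 1")
    case False
    then have "(\<Sum>k<N. q ^ k) = (q ^ N - 1) / (q - 1)" by (rule geometric_sum)
    then show ?thesis using False q1 qN sum by simp
  qed (use q1 sum in simp)
qed

text \<open>
  The grid points of radius \<open>r\<close> have as coordinates \<open>r\<close> times the \<open>N\<close>-th roots of unity. Averages over
  them replace integrals over a torus: for fixed \<open>N\<close> all sums are finite, and the characters
  \<open>grid_char\<close> are orthogonal as long as the exponents are distinct modulo \<open>N\<close>.
\<close>

definition grid :: "nat set \<Rightarrow> nat \<Rightarrow> (nat \<Rightarrow> nat) set" where
  "grid I N = (\<Pi>\<^sub>E i\<in>I. {..<N})"

definition grid_point :: "nat set \<Rightarrow> nat \<Rightarrow> real \<Rightarrow> (nat \<Rightarrow> nat) \<Rightarrow> point" where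
  "grid_point I N r k = (\<lambda>i\<in>I. of_real r * unity_root N (k i))"

abbreviation (input) grid_char :: "nat set \<Rightarrow> nat \<Rightarrow> (nat \<Rightarrow> nat) \<Rightarrow> (nat \<Rightarrow> nat) \<Rightarrow> complex" where
  "grid_char I N \<alpha> k \<equiv> mon I (\<lambda>i. unity_root N (k i)) \<alpha>"

lemma finite_grid [simp]: "finite I \<Longrightarrow> finite (grid I N)"
  by (simp add: grid_def finite_PiE)

lemma grid_point_in_polydisc: "0 \<le> r \<Longrightarrow> r < 1 \<Longrightarrow> grid_point I N r k \<in> polydisc I"
  by (auto simp: grid_point_def polydisc_def norm_mult)

lemma mon_grid_point:
  "mon I (grid_point I N r k) \<alpha> = of_real (r ^ (\<Sum>i\<in>I. \<alpha> i)) * grid_char I N \<alpha> k"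
  by (simp add: grid_point_def power_mult_distrib prod.distrib power_sum)

lemma grid_char_orthogonal:
  assumes "finite I" "N > 0"
  shows "(\<Sum>k\<in>grid I N. grid_char I N \<alpha> k * cnj (grid_char I N \<beta> k))
       = (if \<forall>i\<in>I. \<alpha> i mod N = \<beta> i mod N then of_real (real N ^ card I) else 0)"
proof -
  have "(\<Sum>k\<in>grid I N. grid_char I N \<alpha> k * cnj (grid_char I N \<beta> k))
      = (\<Sum>k\<in>grid I N. \<Prod>i\<in>I. unity_root N (k i) ^ \<alpha> i * cnj (unity_root N (k i) ^ \<beta> i))"
    by (simp add: prod.distrib)
  also have "\<dots> = (\<Prod>i\<in>I. \<Sum>k<N. unity_root N k ^ \<alpha> i * cnj (unity_root N k ^ \<beta> i))"
    unfolding grid_def using assms by (intro prod_sum_PiE[symmetric]) auto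
  also have "\<dots> = (\<Prod>i\<in>I. if \<alpha> i mod N = \<beta> i mod N then of_nat N else 0)"
    by (simp only: unity_root_orthogonal[OF assms(2)])
  also have "\<dots> = (if \<forall>i\<in>I. \<alpha> i mod N = \<beta> i mod N then of_real (real N ^ card I) else 0)"
    using assms(1) by (auto simp: prod_zero_iff)
  finally show ?thesis .
qed

text \<open>
  The discrete Fourier coefficient of \<open>g\<close> on the grid of radius \<open>r\<close>.
\<close>

definition grid_coeff :: "nat set \<Rightarrow> nat \<Rightarrow> real \<Rightarrow> (point \<Rightarrow> complex) \<Rightarrow> (nat \<Rightarrow> nat) \<Rightarrow> complex" where
  "grid_coeff I N r g \<beta> =
     (\<Sum>k\<in>grid I N. g (grid_point I N r k) * cnj (grid_char I N \<beta> k)) / of_real (real N ^ card I)"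

text \<open>
  Aliasing: the grid cannot distinguish exponents that agree modulo \<open>N\<close>.
\<close>

lemma grid_coeff_has_sum:
  assumes "finite I" "N > 0" "0 \<le> r" "r < 1" "has_power_series I g d"
  shows "((\<lambda>\<alpha>. if \<forall>i\<in>I. \<alpha> i mod N = \<beta> i mod N then d \<alpha> * of_real (r ^ (\<Sum>i\<in>I. \<alpha> i)) else 0)
           has_sum grid_coeff I N r g \<beta>) (multi_indices I)"
proof -
  let ?M = "complex_of_real (real N ^ card I)"
  have M: "?M \<noteq> 0" using assms(2) by simp
  have "((\<lambda>\<alpha>. \<Sum>k\<in>grid I N. d \<alpha> * mon I (grid_point I N r k) \<alpha> * cnj (grid_char I N \<beta> k))
          has_sum (\<Sum>k\<in>grid I N. g (grid_point I N r k) * cnj (grid_char I N \<beta> k))) (multi_indices I)"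
    using assms by (intro has_sum_finite_sum has_sum_cmult_left)
      (auto simp: has_power_series_def grid_point_in_polydisc)
  then have "((\<lambda>\<alpha>. (\<Sum>k\<in>grid I N. d \<alpha> * mon I (grid_point I N r k) \<alpha> * cnj (grid_char I N \<beta> k)) * inverse ?M)
          has_sum grid_coeff I N r g \<beta>) (multi_indices I)"
    unfolding grid_coeff_def divide_inverse by (rule has_sum_cmult_left)
  moreover have "(\<Sum>k\<in>grid I N. d \<alpha> * mon I (grid_point I N r k) \<alpha> * cnj (grid_char I N \<beta> k)) * inverse ?M
      = (if \<forall>i\<in>I. \<alpha> i mod N = \<beta> i mod N then d \<alpha> * of_real (r ^ (\<Sum>i\<in>I. \<alpha> i)) else 0)" for \<alpha>
  proof -
    have "(\<Sum>k\<in>grid I N. d \<alpha> * mon I (grid_point I N r k) \<alpha> * cnj (grid_char I N \<beta> k))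
        = d \<alpha> * of_real (r ^ (\<Sum>i\<in>I. \<alpha> i)) * (\<Sum>k\<in>grid I N. grid_char I N \<alpha> k * cnj (grid_char I N \<beta> k))"
      by (simp only: mon_grid_point sum_distrib_left mult.assoc)
    also have "\<dots> = d \<alpha> * of_real (r ^ (\<Sum>i\<in>I. \<alpha> i)) * (if \<forall>i\<in>I. \<alpha> i mod N = \<beta> i mod N then ?M else 0)"
      by (simp only: grid_char_orthogonal[OF assms(1,2)])
    finally show ?thesis using M by simp
  qed
  ultimately show ?thesis by (simp only:)
qed

text \<open>
  Up to a small tail the power series lives on a finite set of exponents. Once \<open>N\<close> exceeds all their
  entries, none of them except \<open>\<beta>\<close> itself is aliased to \<open>\<beta>\<close>, and the tail bounds the error.
\<close>

lemma grid_coeff_tendsto: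
  assumes I: "finite I" and r: "0 \<le> r" "r < 1" and ps: "has_power_series I g d"
    and \<beta>: "\<beta> \<in> multi_indices I"
  shows "(\<lambda>N. grid_coeff I N r g \<beta>) \<longlonglongrightarrow> d \<beta> * of_real (r ^ (\<Sum>i\<in>I. \<beta> i))"
proof (rule LIMSEQ_I)
  fix e :: real assume e: "e > 0"
  define t where "t \<alpha> = d \<alpha> * of_real (r ^ (\<Sum>i\<in>I. \<alpha> i))" for \<alpha>
  have t_mon: "t \<alpha> = d \<alpha> * mon I (\<lambda>i\<in>I. of_real r) \<alpha>" for \<alpha>
    by (simp add: t_def power_sum)
  have "(\<lambda>i\<in>I. complex_of_real r) \<in> polydisc I" using r by (auto simp: polydisc_def)
  from has_power_series_abs[OF ps this]
  have w: "(\<lambda>\<alpha>. norm (t \<alpha>)) summable_on multi_indices I" by (simp only: t_mon)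
  define W where "W = infsum (\<lambda>\<alpha>. norm (t \<alpha>)) (multi_indices I)"
  have W: "((\<lambda>\<alpha>. norm (t \<alpha>)) has_sum W) (multi_indices I)"
    unfolding W_def using w by (rule has_sum_infsum)
  obtain F where F: "finite F" "F \<subseteq> multi_indices I" "dist (\<Sum>\<alpha>\<in>F. norm (t \<alpha>)) W \<le> e / 2"
    using has_sum_finite_approximation[OF W, of "e / 2"] e by auto
  have "finite (insert \<beta> F)" using F by simp
  from bounded_multi_indices[OF I this]
  obtain N0 where N0: "0 < N0" "\<And>\<alpha> i. \<alpha> \<in> insert \<beta> F \<Longrightarrow> i \<in> I \<Longrightarrow> \<alpha> i < (N0::nat)"
    by blast
  show "\<exists>no. \<forall>N\<ge>no. norm (grid_coeff I N r g \<beta> - d \<beta> * of_real (r ^ (\<Sum>i\<in>I. \<beta> i))) < e"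
  proof (intro exI allI impI)
    fix N assume N: "N \<ge> N0"
    have N1: "N > 0" using N N0 by linarith
    have cong: "(\<forall>i\<in>I. \<alpha> i mod N = \<beta> i mod N) \<longleftrightarrow> \<alpha> = \<beta>" if "\<alpha> \<in> insert \<beta> F" for \<alpha>
    proof -
      have "\<alpha> i mod N = \<alpha> i" "\<beta> i mod N = \<beta> i" if "i \<in> I" for i
        using N0(2)[OF \<open>\<alpha> \<in> insert \<beta> F\<close> that] N0(2)[of \<beta> i] that N by auto
      then show ?thesis
        using multi_indices_eqI[of \<alpha> I \<beta>] \<beta> F(2) that by auto
    qed
    have h1: "((\<lambda>\<alpha>. if \<forall>i\<in>I. \<alpha> i mod N = \<beta> i mod N then t \<alpha> else 0)
           has_sum grid_coeff I N r g \<beta>) (multi_indices I)"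
      unfolding t_def by (rule grid_coeff_has_sum[OF I N1 r ps])
    have h2: "((\<lambda>\<alpha>. if \<alpha> = \<beta> then - t \<alpha> else 0) has_sum (- t \<beta>)) (multi_indices I)"
      using \<beta> by (intro has_sum_finite_neutralI[of "{\<beta>}"]) auto
    \<comment> \<open>Adding this to the series of norms leaves the tail outside \<open>F\<close>.\<close>
    have h3: "((\<lambda>\<alpha>. if \<alpha> \<in> F then - norm (t \<alpha>) else 0) has_sum (\<Sum>\<alpha>\<in>F. - norm (t \<alpha>))) (multi_indices I)"
      using F by (intro has_sum_finite_neutralI[of F]) auto
    have "norm (grid_coeff I N r g \<beta> + - t \<beta>) \<le> W + (\<Sum>\<alpha>\<in>F. - norm (t \<alpha>))"
    proof (rule norm_infsum_le[OF has_sum_add[OF h1 h2] has_sum_add[OF W h3]])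
      fix \<alpha> assume "\<alpha> \<in> multi_indices I"
      show "norm ((if \<forall>i\<in>I. \<alpha> i mod N = \<beta> i mod N then t \<alpha> else 0) + (if \<alpha> = \<beta> then - t \<alpha> else 0))
          \<le> norm (t \<alpha>) + (if \<alpha> \<in> F then - norm (t \<alpha>) else 0)"
        using cong[of \<alpha>] by (cases "\<alpha> \<in> insert \<beta> F") auto
    qed
    also have "\<dots> \<le> e / 2" using F(3) unfolding dist_real_def sum_negf by linarith
    also have "\<dots> < e" using e by simp
    finally show "norm (grid_coeff I N r g \<beta> - d \<beta> * of_real (r ^ (\<Sum>i\<in>I. \<beta> i))) < e"
      by (simp add: t_def)
  qed
qed

lemma power_series_unique:
  assumes "finite I" "has_power_series I g c" "has_power_series I g d" "\<beta> \<in> multi_indices I"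
  shows "c \<beta> = d \<beta>"
proof -
  have "c \<beta> * of_real ((1/2) ^ (\<Sum>i\<in>I. \<beta> i)) = d \<beta> * of_real ((1/2) ^ (\<Sum>i\<in>I. \<beta> i))"
    by (rule LIMSEQ_unique[OF grid_coeff_tendsto[OF assms(1) _ _ assms(2,4), of "1/2"]
          grid_coeff_tendsto[OF assms(1) _ _ assms(3,4), of "1/2"]]) auto
  then show ?thesis by simp
qed

text \<open>
  For large \<open>N\<close> Bessel's inequality on the grid bounds the coefficients of \<open>g\<close> by the mean square of \<open>g\<close>,
  hence by that of the polynomial, which Parseval's identity computes exactly. Then \<open>N \<rightarrow> \<infinity>\<close> and
  \<open>r \<rightarrow> 1\<close>.
\<close>

lemma dominated_by_polynomial:
  assumes I: "finite I" and ps: "has_power_series I g d"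
    and S: "finite S" "S \<subseteq> multi_indices I" and S': "finite S'" "S' \<subseteq> multi_indices I"
    and le: "\<And>z. z \<in> polydisc I \<Longrightarrow> norm (g z) \<le> C * norm (\<Sum>\<alpha>\<in>S. h \<alpha> * mon I z \<alpha>)"
  shows "(\<Sum>\<beta>\<in>S'. (norm (d \<beta>))\<^sup>2) \<le> C\<^sup>2 * (\<Sum>\<alpha>\<in>S. (norm (h \<alpha>))\<^sup>2)"
proof -
  have "finite (S \<union> S')" using S S' by simp
  from bounded_multi_indices[OF I this]
  obtain N0 where N0: "0 < N0" "\<And>\<alpha> i. \<alpha> \<in> S \<union> S' \<Longrightarrow> i \<in> I \<Longrightarrow> \<alpha> i < (N0::nat)"
    by blast
  have step: "(\<Sum>\<beta>\<in>S'. (norm (d \<beta> * of_real (r ^ (\<Sum>i\<in>I. \<beta> i))))\<^sup>2) \<le> C\<^sup>2 * (\<Sum>\<alpha>\<in>S. (norm (h \<alpha>))\<^sup>2)"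
    if r: "0 \<le> r" "r < 1" for r
  proof (rule LIMSEQ_le_const2)
    show "(\<lambda>N. \<Sum>\<beta>\<in>S'. (norm (grid_coeff I N r g \<beta>))\<^sup>2)
        \<longlonglongrightarrow> (\<Sum>\<beta>\<in>S'. (norm (d \<beta> * of_real (r ^ (\<Sum>i\<in>I. \<beta> i))))\<^sup>2)"
      using S' by (intro tendsto_sum tendsto_power tendsto_norm grid_coeff_tendsto[OF I r ps]) auto
    show "\<exists>N1. \<forall>N\<ge>N1. (\<Sum>\<beta>\<in>S'. (norm (grid_coeff I N r g \<beta>))\<^sup>2) \<le> C\<^sup>2 * (\<Sum>\<alpha>\<in>S. (norm (h \<alpha>))\<^sup>2)"
    proof (intro exI allI impI)
      fix N assume N: "N0 \<le> N"
      have N1: "N > 0" using N N0 by linarith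
      let ?M = "real N ^ card I"
      have M: "?M > 0" using N1 by simp
      have orth: "(\<Sum>k\<in>grid I N. grid_char I N \<alpha> k * cnj (grid_char I N \<beta> k)) = (if \<alpha> = \<beta> then of_real ?M else 0)"
        if ab: "\<alpha> \<in> S \<union> S'" "\<beta> \<in> S \<union> S'" for \<alpha> \<beta>
      proof -
        have "\<alpha> i mod N = \<alpha> i" "\<beta> i mod N = \<beta> i" if "i \<in> I" for i
          using N0(2)[OF ab(1) that] N0(2)[OF ab(2) that] N by auto
        then have "(\<forall>i\<in>I. \<alpha> i mod N = \<beta> i mod N) \<longleftrightarrow> \<alpha> = \<beta>"
          using multi_indices_eqI[of \<alpha> I \<beta>] ab S(2) S'(2) by (metis Un_iff subsetD)
        then show ?thesis using grid_char_orthogonal[OF I N1] by simp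
      qed
      have "?M * (\<Sum>\<beta>\<in>S'. (norm (grid_coeff I N r g \<beta>))\<^sup>2) \<le> (\<Sum>k\<in>grid I N. (norm (g (grid_point I N r k)))\<^sup>2)"
        unfolding grid_coeff_def using I S' M orth by (intro finite_Bessel) auto
      also have "\<dots> \<le> (\<Sum>k\<in>grid I N. C\<^sup>2 * (norm (\<Sum>\<alpha>\<in>S. (h \<alpha> * of_real (r ^ (\<Sum>i\<in>I. \<alpha> i))) * grid_char I N \<alpha> k))\<^sup>2)"
      proof (rule sum_mono)
        fix k
        have "norm (g (grid_point I N r k)) \<le> C * norm (\<Sum>\<alpha>\<in>S. h \<alpha> * mon I (grid_point I N r k) \<alpha>)"
          by (rule le[OF grid_point_in_polydisc[OF r]])
        then have "(norm (g (grid_point I N r k)))\<^sup>2 \<le> (C * norm (\<Sum>\<alpha>\<in>S. h \<alpha> * mon I (grid_point I N r k) \<alpha>))\<^sup>2"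
          by (intro power_mono) auto
        then show "(norm (g (grid_point I N r k)))\<^sup>2 \<le> C\<^sup>2 * (norm (\<Sum>\<alpha>\<in>S. (h \<alpha> * of_real (r ^ (\<Sum>i\<in>I. \<alpha> i))) * grid_char I N \<alpha> k))\<^sup>2"
          by (simp only: mon_grid_point power_mult_distrib mult.assoc)
      qed
      also have "\<dots> = C\<^sup>2 * (?M * (\<Sum>\<alpha>\<in>S. (norm (h \<alpha> * of_real (r ^ (\<Sum>i\<in>I. \<alpha> i))))\<^sup>2))"
        using I S orth by (simp only: sum_distrib_left[symmetric], subst orthogonal_combination_norm) auto
      also have "\<dots> \<le> C\<^sup>2 * (?M * (\<Sum>\<alpha>\<in>S. (norm (h \<alpha>))\<^sup>2))"
      proof -
        have "(norm (h \<alpha> * of_real (r ^ (\<Sum>i\<in>I. \<alpha> i))))\<^sup>2 \<le> (norm (h \<alpha>))\<^sup>2" for \<alpha>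
          using r by (intro power_mono) (auto simp: norm_mult norm_power power_le_one intro!: mult_left_le)
        then show ?thesis using M by (intro mult_left_mono sum_mono) auto
      qed
      finally have "?M * (\<Sum>\<beta>\<in>S'. (norm (grid_coeff I N r g \<beta>))\<^sup>2) \<le> ?M * (C\<^sup>2 * (\<Sum>\<alpha>\<in>S. (norm (h \<alpha>))\<^sup>2))"
        by (simp only: mult_ac)
      then show "(\<Sum>\<beta>\<in>S'. (norm (grid_coeff I N r g \<beta>))\<^sup>2) \<le> C\<^sup>2 * (\<Sum>\<alpha>\<in>S. (norm (h \<alpha>))\<^sup>2)"
        using M by (simp only: mult_le_cancel_left_pos)
    qed
  qed
  show ?thesis
  proof (rule tendsto_upperbound)
    show "((\<lambda>r. \<Sum>\<beta>\<in>S'. (norm (d \<beta> * of_real (r ^ (\<Sum>i\<in>I. \<beta> i))))\<^sup>2) \<longlongrightarrow> (\<Sum>\<beta>\<in>S'. (norm (d \<beta>))\<^sup>2)) (at_left 1)"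
      by (auto intro!: tendsto_eq_intros)
    show "\<forall>\<^sub>F r in at_left 1. (\<Sum>\<beta>\<in>S'. (norm (d \<beta> * of_real (r ^ (\<Sum>i\<in>I. \<beta> i))))\<^sup>2) \<le> C\<^sup>2 * (\<Sum>\<alpha>\<in>S. (norm (h \<alpha>))\<^sup>2)"
      by (intro eventually_at_leftI[of 0] step) auto
  qed simp
qed

section \<open>Products of power series\<close>

definition conv_coeff :: "nat set \<Rightarrow> ((nat \<Rightarrow> nat) \<Rightarrow> complex) \<Rightarrow> ((nat \<Rightarrow> nat) \<Rightarrow> complex) \<Rightarrow> (nat \<Rightarrow> nat) \<Rightarrow> complex" where
  "conv_coeff I c d \<gamma> = (\<Sum>\<alpha>\<in>(\<Pi>\<^sub>E i\<in>I. {..\<gamma> i}). c \<alpha> * d (\<lambda>i\<in>I. \<gamma> i - \<alpha> i))"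

lemma has_sum_product_pairs:
  fixes f :: "'a \<Rightarrow> complex" and g :: "'b \<Rightarrow> complex"
  assumes f: "(f has_sum s) A" and g: "(g has_sum t) B"
  shows "((\<lambda>(x, y). f x * g y) has_sum (s * t)) (A \<times> B)"
proof (rule has_sum_SigmaI)
  show "((\<lambda>y. case (x, y) of (x, y) \<Rightarrow> f x * g y) has_sum (f x * t)) B" for x
    using has_sum_cmult_right[OF g] by simp
  show "((\<lambda>x. f x * t) has_sum (s * t)) A" by (rule has_sum_cmult_left[OF f])
  have nf: "(\<lambda>x. norm (f x)) summable_on A" and ng: "(\<lambda>x. norm (g x)) summable_on B"
    using has_sum_imp_summable[OF f] has_sum_imp_summable[OF g] summable_on_iff_abs_summable_on_complex
    by blast+
  have "(\<lambda>(x, y). norm (f x) * norm (g y)) summable_on A \<times> B"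
  proof (rule summable_on_SigmaI)
    show "((\<lambda>y. case (x, y) of (x, y) \<Rightarrow> norm (f x) * norm (g y)) has_sum (norm (f x) * infsum (\<lambda>y. norm (g y)) B)) B" for x
      using has_sum_cmult_right[OF has_sum_infsum[OF ng]] by simp
    show "(\<lambda>x. norm (f x) * infsum (\<lambda>y. norm (g y)) B) summable_on A"
      by (rule summable_on_cmult_left[OF nf])
  qed auto
  then have "(\<lambda>p. norm (case p of (x, y) \<Rightarrow> f x * g y)) summable_on A \<times> B"
    by (simp add: case_prod_unfold norm_mult)
  then show "(\<lambda>(x, y). f x * g y) summable_on A \<times> B"
    by (simp only: summable_on_iff_abs_summable_on_complex)
qed

text \<open>
  The double series converges absolutely, so it may be summed along the fibres of
  \<open>(\<alpha>, \<beta>) \<mapsto> \<alpha> + \<beta>\<close>, which are finite.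
\<close>

lemma has_power_series_mult:
  assumes I: "finite I" and f: "has_power_series I f c" and g: "has_power_series I g d"
  shows "has_power_series I (\<lambda>z. f z * g z) (conv_coeff I c d)"
  unfolding has_power_series_def
proof
  fix z assume z: "z \<in> polydisc I"
  let ?M = "multi_indices I"
  let ?B = "\<lambda>\<gamma>. (\<Pi>\<^sub>E i\<in>I. {..\<gamma> i :: nat})"
  have "((\<lambda>(\<alpha>, \<beta>). (c \<alpha> * mon I z \<alpha>) * (d \<beta> * mon I z \<beta>)) has_sum (f z * g z)) (?M \<times> ?M)"
    using f g z by (intro has_sum_product_pairs) (auto simp: has_power_series_def)
  also have "?this \<longleftrightarrow> ((\<lambda>(\<gamma>, \<alpha>). c \<alpha> * d (\<lambda>i\<in>I. \<gamma> i - \<alpha> i) * mon I z \<gamma>) has_sum (f z * g z)) (Sigma ?M ?B)"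
  proof (rule has_sum_reindex_bij_witness[symmetric,
        where j = "\<lambda>(\<gamma>, \<alpha>). (\<alpha>, \<lambda>i\<in>I. \<gamma> i - \<alpha> i)" and i = "\<lambda>(\<alpha>, \<beta>). (\<lambda>i\<in>I. \<alpha> i + \<beta> i, \<alpha>)"])
    fix a assume "a \<in> Sigma ?M ?B"
    then obtain \<gamma> \<alpha> where a: "a = (\<gamma>, \<alpha>)" and \<gamma>: "\<gamma> \<in> ?M" and \<alpha>: "\<alpha> \<in> ?B \<gamma>" by auto
    have le: "\<alpha> i \<le> \<gamma> i" if "i \<in> I" for i using \<alpha> that by auto
    have \<alpha>M: "\<alpha> \<in> ?M" using \<alpha> by (auto simp: multi_indices_def)
    have "(\<lambda>i\<in>I. \<alpha> i + (\<lambda>i\<in>I. \<gamma> i - \<alpha> i) i) = \<gamma>"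
      by (rule multi_indices_eqI[OF multi_indices_restrict \<gamma>]) (use le in auto)
    then show "(case case a of (\<gamma>, \<alpha>) \<Rightarrow> (\<alpha>, \<lambda>i\<in>I. \<gamma> i - \<alpha> i) of (\<alpha>, \<beta>) \<Rightarrow> (\<lambda>i\<in>I. \<alpha> i + \<beta> i, \<alpha>)) = a"
      by (simp add: a)
    show "(case a of (\<gamma>, \<alpha>) \<Rightarrow> (\<alpha>, \<lambda>i\<in>I. \<gamma> i - \<alpha> i)) \<in> ?M \<times> ?M"
      using \<alpha>M by (simp add: a)
    have "mon I z \<gamma> = mon I z \<alpha> * mon I z (\<lambda>i\<in>I. \<gamma> i - \<alpha> i)"
      using le by (simp add: prod.distrib[symmetric] power_add[symmetric])
    then show "(case case a of (\<gamma>, \<alpha>) \<Rightarrow> (\<alpha>, \<lambda>i\<in>I. \<gamma> i - \<alpha> i) of (\<alpha>, \<beta>) \<Rightarrow> (c \<alpha> * mon I z \<alpha>) * (d \<beta> * mon I z \<beta>))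
        = (case a of (\<gamma>, \<alpha>) \<Rightarrow> c \<alpha> * d (\<lambda>i\<in>I. \<gamma> i - \<alpha> i) * mon I z \<gamma>)"
      by (simp add: a mult_ac)
  next
    fix b assume "b \<in> ?M \<times> ?M"
    then obtain \<alpha> \<beta> where b: "b = (\<alpha>, \<beta>)" and ab: "\<alpha> \<in> ?M" "\<beta> \<in> ?M" by auto
    have "(\<lambda>i\<in>I. (\<lambda>i\<in>I. \<alpha> i + \<beta> i) i - \<alpha> i) = \<beta>"
      by (rule multi_indices_eqI[OF multi_indices_restrict ab(2)]) auto
    then show "(case case b of (\<alpha>, \<beta>) \<Rightarrow> (\<lambda>i\<in>I. \<alpha> i + \<beta> i, \<alpha>) of (\<gamma>, \<alpha>) \<Rightarrow> (\<alpha>, \<lambda>i\<in>I. \<gamma> i - \<alpha> i)) = b"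
      by (simp add: b)
    have "\<alpha> \<in> ?B (\<lambda>i\<in>I. \<alpha> i + \<beta> i)" using ab(1) by (auto simp: multi_indices_def PiE_iff)
    then show "(case b of (\<alpha>, \<beta>) \<Rightarrow> (\<lambda>i\<in>I. \<alpha> i + \<beta> i, \<alpha>)) \<in> Sigma ?M ?B"
      by (simp add: b)
  qed simp
  finally have S: "((\<lambda>(\<gamma>, \<alpha>). c \<alpha> * d (\<lambda>i\<in>I. \<gamma> i - \<alpha> i) * mon I z \<gamma>) has_sum (f z * g z)) (Sigma ?M ?B)" .
  show "((\<lambda>\<gamma>. conv_coeff I c d \<gamma> * mon I z \<gamma>) has_sum (f z * g z)) ?M"
  proof (rule has_sum_SigmaD[OF S])
    fix \<gamma>
    show "((\<lambda>\<alpha>. case (\<gamma>, \<alpha>) of (\<gamma>, \<alpha>) \<Rightarrow> c \<alpha> * d (\<lambda>i\<in>I. \<gamma> i - \<alpha> i) * mon I z \<gamma>)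
        has_sum conv_coeff I c d \<gamma> * mon I z \<gamma>) (?B \<gamma>)"
      using I by (intro has_sum_finiteI finite_PiE) (auto simp: conv_coeff_def sum_distrib_right)
  qed
qed

lemma has_power_series_add:
  assumes "has_power_series I f c" "has_power_series I g d"
  shows "has_power_series I (\<lambda>z. a * f z + b * g z) (\<lambda>\<alpha>. a * c \<alpha> + b * d \<alpha>)"
  unfolding has_power_series_def
proof
  fix z assume "z \<in> polydisc I"
  then have "((\<lambda>\<alpha>. a * (c \<alpha> * mon I z \<alpha>) + b * (d \<alpha> * mon I z \<alpha>)) has_sum (a * f z + b * g z)) (multi_indices I)"
    using assms by (intro has_sum_add has_sum_cmult_right) (auto simp: has_power_series_def)
  then show "((\<lambda>\<alpha>. (a * c \<alpha> + b * d \<alpha>) * mon I z \<alpha>) has_sum (a * f z + b * g z)) (multi_indices I)"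
    by (simp add: algebra_simps)
qed

section \<open>Holomorphic functions on a polydisc\<close>

lemma polydisc_iff: "z \<in> polydisc I \<longleftrightarrow> z \<in> extensional I \<and> (\<forall>i\<in>I. norm (z i) < 1)"
  by (auto simp: polydisc_def PiE_iff)

lemma polydisc_upd: "z \<in> polydisc I \<Longrightarrow> i \<in> I \<Longrightarrow> norm w < 1 \<Longrightarrow> z(i := w) \<in> polydisc I"
  by (auto simp: polydisc_iff extensional_def)

lemma polydisc_upd_insert: "z \<in> polydisc J \<Longrightarrow> norm w < 1 \<Longrightarrow> z(j := w) \<in> polydisc (insert j J)"
  by (auto simp: polydisc_iff extensional_def)

lemma polydisc_restrict: "z \<in> polydisc I \<Longrightarrow> J \<subseteq> I \<Longrightarrow> restrict z J \<in> polydisc J"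
  by (auto simp: polydisc_iff)

lemma polydisc_zero: "(\<lambda>i\<in>I. 0) \<in> polydisc I"
  by (auto simp: polydisc_iff)

lemma holomorphic_polydisc_cont: "holomorphic_polydisc I f \<Longrightarrow> continuous_on (polydisc I) f"
  by (simp add: holomorphic_polydisc_def)

lemma holomorphic_polydisc_slice:
  "holomorphic_polydisc I f \<Longrightarrow> z \<in> polydisc I \<Longrightarrow> i \<in> I \<Longrightarrow> (\<lambda>w. f (z(i := w))) holomorphic_on ball 0 1"
  by (simp add: holomorphic_polydisc_def)

lemma holomorphic_polydisc_const: "holomorphic_polydisc I (\<lambda>_. c)"
  by (auto simp: holomorphic_polydisc_def)

lemma holomorphic_polydisc_add:
  "holomorphic_polydisc I f \<Longrightarrow> holomorphic_polydisc I g \<Longrightarrow> holomorphic_polydisc I (\<lambda>z. f z + g z)"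
  by (auto simp: holomorphic_polydisc_def intro!: continuous_intros holomorphic_intros)

lemma holomorphic_polydisc_mult:
  "holomorphic_polydisc I f \<Longrightarrow> holomorphic_polydisc I g \<Longrightarrow> holomorphic_polydisc I (\<lambda>z. f z * g z)"
  by (auto simp: holomorphic_polydisc_def intro!: continuous_intros holomorphic_intros)

lemma holomorphic_polydisc_sum:
  "(\<And>a. a \<in> A \<Longrightarrow> holomorphic_polydisc I (f a)) \<Longrightarrow> holomorphic_polydisc I (\<lambda>z. \<Sum>a\<in>A. f a z)"
  by (auto simp: holomorphic_polydisc_def intro!: continuous_intros holomorphic_intros)

lemma holomorphic_polydisc_prod:
  "(\<And>a. a \<in> A \<Longrightarrow> holomorphic_polydisc I (f a)) \<Longrightarrow> holomorphic_polydisc I (\<lambda>z. \<Prod>a\<in>A. f a z)"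
  by (auto simp: holomorphic_polydisc_def intro!: continuous_intros holomorphic_intros)

lemma continuous_on_coordinate: "continuous_on S (\<lambda>z :: point. z i)"
  by (rule continuous_on_subset[OF continuous_on_product_coordinates]) simp

lemma holomorphic_polydisc_coordinate:
  assumes f: "f holomorphic_on ball 0 1" and j: "j \<in> I"
  shows "holomorphic_polydisc I (\<lambda>z. f (z j))"
  unfolding holomorphic_polydisc_def
proof (intro conjI ballI)
  show "continuous_on (polydisc I) (\<lambda>z. f (z j))"
    by (rule continuous_on_compose2[OF holomorphic_on_imp_continuous_on[OF f] continuous_on_coordinate])
      (use j in \<open>auto simp: polydisc_iff\<close>)
  fix z i assume "z \<in> polydisc I" "i \<in> I"
  show "(\<lambda>w. f ((z(i := w)) j)) holomorphic_on ball 0 1"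
    by (cases "i = j") (use f in auto)
qed

lemma holomorphic_polydisc_restrict:
  assumes f: "holomorphic_polydisc J f" and J: "J \<subseteq> I"
  shows "holomorphic_polydisc I (\<lambda>z. f (restrict z J))"
  unfolding holomorphic_polydisc_def
proof (intro conjI ballI)
  have "continuous_on (polydisc I) (\<lambda>z. restrict z J)"
  proof (rule continuous_on_coordinatewise_then_product)
    fix i show "continuous_on (polydisc I) (\<lambda>z. restrict z J i)"
      by (cases "i \<in> J") (auto intro: continuous_on_coordinate)
  qed
  then show "continuous_on (polydisc I) (\<lambda>z. f (restrict z J))"
    by (rule continuous_on_compose2[OF holomorphic_polydisc_cont[OF f]])
      (use J in \<open>auto intro: polydisc_restrict\<close>)
  fix z i assume z: "z \<in> polydisc I" and i: "i \<in> I"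
  show "(\<lambda>w. f (restrict (z(i := w)) J)) holomorphic_on ball 0 1"
  proof (cases "i \<in> J")
    case True
    have "restrict (z(i := w)) J = (restrict z J)(i := w)" for w
      using True by (auto simp: restrict_def)
    then show ?thesis using holomorphic_polydisc_slice[OF f polydisc_restrict[OF z J] True] by simp
  next
    case False
    then have "restrict (z(i := w)) J = restrict z J" for w by (auto simp: restrict_def)
    then show ?thesis by simp
  qed
qed

lemma holomorphic_polydisc_upd:
  assumes f: "holomorphic_polydisc (insert j J) f" and w: "norm w < 1" and j: "j \<notin> J"
  shows "holomorphic_polydisc J (\<lambda>z. f (z(j := w)))"
  unfolding holomorphic_polydisc_def
proof (intro conjI ballI)
  have "continuous_on (polydisc J) (\<lambda>z. z(j := w))"
  proof (rule continuous_on_coordinatewise_then_product)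
    fix i show "continuous_on (polydisc J) (\<lambda>z. (z(j := w)) i)"
      by (cases "i = j") (auto intro: continuous_on_coordinate)
  qed
  then show "continuous_on (polydisc J) (\<lambda>z. f (z(j := w)))"
    by (rule continuous_on_compose2[OF holomorphic_polydisc_cont[OF f]])
      (use w in \<open>auto intro: polydisc_upd_insert\<close>)
  fix z i assume z: "z \<in> polydisc J" and i: "i \<in> J"
  then have "i \<noteq> j" using j by auto
  then have "(z(i := v))(j := w) = (z(j := w))(i := v)" for v by (rule fun_upd_twist)
  then show "(\<lambda>v. f ((z(i := v))(j := w))) holomorphic_on ball 0 1"
    using holomorphic_polydisc_slice[OF f polydisc_upd_insert[OF z w], of i] i by simp
qed

text \<open>
  Weierstrass' theorem in each variable separately.
\<close>

lemma holomorphic_polydisc_uniform_limit: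
  assumes A: "\<And>N. holomorphic_polydisc J (A N)" and lim: "uniform_limit (polydisc J) A a sequentially"
  shows "holomorphic_polydisc J a"
  unfolding holomorphic_polydisc_def
proof (intro conjI ballI)
  show "continuous_on (polydisc J) a"
    by (rule uniform_limit_theorem[OF always_eventually[OF allI[OF holomorphic_polydisc_cont[OF A]]] lim]) simp
  fix z i assume z: "z \<in> polydisc J" and i: "i \<in> J"
  show "(\<lambda>w. a (z(i := w))) holomorphic_on ball 0 1"
  proof (rule holomorphic_uniform_sequence[OF open_ball, where f = "\<lambda>N w. A N (z(i := w))"])
    show "(\<lambda>w. A N (z(i := w))) holomorphic_on ball 0 1" for N
      by (rule holomorphic_polydisc_slice[OF A z i])
    fix x :: complex assume "x \<in> ball 0 1"
    then obtain d where d: "d > 0" "cball x d \<subseteq> ball 0 1"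
      using open_contains_cball open_ball by metis
    have "uniform_limit (cball x d) (\<lambda>N w. A N (z(i := w))) (\<lambda>w. a (z(i := w))) sequentially"
    proof (rule uniform_limitI)
      fix e :: real assume "e > 0"
      from uniform_limitD[OF lim this]
      show "\<forall>\<^sub>F N in sequentially. \<forall>w\<in>cball x d. dist (A N (z(i := w))) (a (z(i := w))) < e"
        by eventually_elim (use d polydisc_upd[OF z i] in \<open>auto simp: subset_eq\<close>)
    qed
    then show "\<exists>d>0. cball x d \<subseteq> ball 0 1 \<and> uniform_limit (cball x d) (\<lambda>N w. A N (z(i := w))) (\<lambda>w. a (z(i := w))) sequentially"
      using d by blast
  qed
qed

section \<open>Power series of bounded holomorphic functions\<close>

lemma bounded_taylor_coeff:
  assumes g: "g holomorphic_on ball 0 1" and C: "\<And>w. w \<in> ball 0 1 \<Longrightarrow> norm (g w) \<le> C"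
  shows "norm ((deriv ^^ k) g 0 / fact k) \<le> C"
proof -
  have bound: "norm ((deriv ^^ k) g 0 / fact k) * r ^ k \<le> C" if r: "0 < r" "r < 1" for r
  proof -
    have sub: "cball 0 r \<subseteq> ball (0::complex) 1" using r by auto
    have "norm ((deriv ^^ k) g 0) \<le> fact k * C / r ^ k"
    proof (rule Cauchy_inequality)
      show "g holomorphic_on ball 0 r" using r by (auto intro: holomorphic_on_subset[OF g])
      show "continuous_on (cball 0 r) g"
        by (rule continuous_on_subset[OF holomorphic_on_imp_continuous_on[OF g] sub])
    qed (use r C in auto)
    then show ?thesis using r by (simp add: norm_divide field_simps)
  qed
  show ?thesis
  proof (rule tendsto_upperbound)
    show "((\<lambda>r. norm ((deriv ^^ k) g 0 / fact k) * r ^ k) \<longlongrightarrow> norm ((deriv ^^ k) g 0 / fact k)) (at_left 1)"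
      by (auto intro!: tendsto_eq_intros)
    show "\<forall>\<^sub>F r in at_left 1. norm ((deriv ^^ k) g 0 / fact k) * r ^ k \<le> C"
      by (intro eventually_at_leftI[of 0] bound) auto
  qed simp
qed

lemma bounded_taylor_has_sum:
  assumes g: "g holomorphic_on ball 0 1" and C: "\<And>w. w \<in> ball 0 1 \<Longrightarrow> norm (g w) \<le> C"
    and w: "norm w < 1"
  shows "((\<lambda>k. (deriv ^^ k) g 0 / fact k * w ^ k) has_sum g w) UNIV"
proof (rule norm_summable_imp_has_sum)
  show "summable (\<lambda>k. norm ((deriv ^^ k) g 0 / fact k * w ^ k))"
  proof (rule summable_comparison_test[OF exI[of _ 0]], intro allI impI)
    fix k
    show "norm (norm ((deriv ^^ k) g 0 / fact k * w ^ k)) \<le> C * norm w ^ k"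
      using mult_right_mono[OF bounded_taylor_coeff[OF g C], of "norm w ^ k" k]
      by (simp add: norm_mult norm_power norm_divide)
    show "summable (\<lambda>k. C * norm w ^ k)" using w by (intro summable_mult summable_geometric) simp
  qed
  show "(\<lambda>k. (deriv ^^ k) g 0 / fact k * w ^ k) sums g w"
    using holomorphic_power_series[OF g, of w] w by simp
qed

text \<open>
  The \<open>k\<close>-th Taylor coefficient is compared with a discrete Fourier coefficient on the circle of radius
  1/2. The bound depends only on \<open>C\<close>, \<open>k\<close> and \<open>N\<close>, which is what makes the approximation uniform when
  \<open>g\<close> depends on parameters.
\<close>

lemma taylor_coeff_average:
  assumes g: "g holomorphic_on ball 0 1" and C: "\<And>w. w \<in> ball 0 1 \<Longrightarrow> norm (g w) \<le> C"
    and k: "k < N"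
  shows "norm (2 ^ k / of_nat N * (\<Sum>m<N. g (unity_root N m / 2) * cnj (unity_root N m ^ k)) - (deriv ^^ k) g 0 / fact k)
           \<le> 2 ^ k * (2 * C * (1/2) ^ N)"
proof -
  define a where "a l = (deriv ^^ l) g 0 / fact l" for l
  have aC: "norm (a l) \<le> C" for l unfolding a_def by (rule bounded_taylor_coeff[OF g C])
  define S where "S = (\<Sum>m<N. g (unity_root N m / 2) * cnj (unity_root N m ^ k)) / of_nat N"
  have N: "N > 0" using k by simp
  have h1: "((\<lambda>l. if l mod N = k then a l * (1/2) ^ l else 0) has_sum S) UNIV"
  proof -
    have "((\<lambda>l. \<Sum>m<N. a l * (unity_root N m / 2) ^ l * cnj (unity_root N m ^ k))
        has_sum (\<Sum>m<N. g (unity_root N m / 2) * cnj (unity_root N m ^ k))) UNIV"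
      unfolding a_def
      by (intro has_sum_finite_sum has_sum_cmult_left bounded_taylor_has_sum[OF g C]) (auto simp: norm_divide)
    then have "((\<lambda>l. (\<Sum>m<N. a l * (unity_root N m / 2) ^ l * cnj (unity_root N m ^ k)) * inverse (of_nat N)) has_sum S) UNIV"
      unfolding S_def divide_inverse by (rule has_sum_cmult_left)
    moreover have "(\<Sum>m<N. a l * (unity_root N m / 2) ^ l * cnj (unity_root N m ^ k)) * inverse (of_nat N)
        = (if l mod N = k then a l * (1/2) ^ l else 0)" for l
    proof -
      have "(\<Sum>m<N. a l * (unity_root N m / 2) ^ l * cnj (unity_root N m ^ k))
          = a l * (1/2) ^ l * (\<Sum>m<N. unity_root N m ^ l * cnj (unity_root N m ^ k))"
        by (simp add: sum_distrib_left power_divide mult_ac)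
      also have "\<dots> = a l * (1/2) ^ l * (if l mod N = k then of_nat N else 0)"
        using k by (simp only: unity_root_orthogonal[OF N] mod_less)
      finally show ?thesis using N by simp
    qed
    ultimately show ?thesis by simp
  qed
  have h2: "((\<lambda>l. if l = k then - (a l * (1/2) ^ l) else 0) has_sum - (a k * (1/2) ^ k)) UNIV"
    by (intro has_sum_finite_neutralI[of "{k}"]) auto
  have "((\<lambda>l. (1/2) ^ l) has_sum (1 / (1 - 1/2 :: real))) UNIV"
    by (intro norm_summable_imp_has_sum geometric_sums) (auto simp: summable_geometric)
  then have "((\<lambda>l. C * (1/2) ^ l) has_sum (C * (1 / (1 - 1/2)))) UNIV"
    by (rule has_sum_cmult_right)
  then have h3: "((\<lambda>l. C * (1/2) ^ l) has_sum (C * 2)) UNIV" by simp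
  \<comment> \<open>As \<open>k < N\<close>, an index \<open>l \<noteq> k\<close> that is aliased to \<open>k\<close> is at least \<open>N\<close>.\<close>
  have h4: "((\<lambda>l. if l < N then - (C * (1/2) ^ l) else 0) has_sum (\<Sum>l<N. - (C * (1/2) ^ l))) UNIV"
    by (intro has_sum_finite_neutralI[of "{..<N}"]) auto
  have "norm (S + - (a k * (1/2) ^ k)) \<le> C * 2 + (\<Sum>l<N. - (C * (1/2) ^ l))"
  proof (rule norm_infsum_le[OF has_sum_add[OF h1 h2] has_sum_add[OF h3 h4]])
    fix l
    have "norm (a l * (1/2) ^ l) \<le> C * (1/2) ^ l"
      using aC[of l] by (simp add: norm_mult norm_power norm_divide power_divide divide_right_mono)
    then show "norm ((if l mod N = k then a l * (1/2) ^ l else 0) + (if l = k then - (a l * (1/2) ^ l) else 0))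
        \<le> C * (1/2) ^ l + (if l < N then - (C * (1/2) ^ l) else 0)"
      using k order_trans[OF norm_ge_zero[of "a l"] aC[of l]] by (cases "l < N") auto
  qed
  also have "(\<Sum>l<N. - (C * (1/2) ^ l)) = - (C * 2 * (1 - (1/2) ^ N))"
  proof -
    have "(\<Sum>l<N. (1/2) ^ l) = 2 * (1 - (1/2 :: real) ^ N)" by (simp add: sum_gp_strict)
    then show ?thesis by (simp only: sum_negf sum_distrib_left[symmetric] mult_ac)
  qed
  finally have S: "norm (S - a k * (1/2) ^ k) \<le> 2 * C * (1/2) ^ N" by (simp add: algebra_simps)
  have "2 ^ k / of_nat N * (\<Sum>m<N. g (unity_root N m / 2) * cnj (unity_root N m ^ k)) - a k = 2 ^ k * (S - a k * (1/2) ^ k)"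
    by (simp add: S_def algebra_simps power_divide)
  then have "norm (2 ^ k / of_nat N * (\<Sum>m<N. g (unity_root N m / 2) * cnj (unity_root N m ^ k)) - a k) = 2 ^ k * norm (S - a k * (1/2) ^ k)"
    by (simp only: norm_mult norm_power norm_numeral)
  also have "\<dots> \<le> 2 ^ k * (2 * C * (1/2) ^ N)" by (rule mult_left_mono[OF S]) simp
  finally show ?thesis by (simp add: a_def)
qed

text \<open>
  The averages in \<open>taylor_coeff_average\<close> are finite combinations of slices of \<open>f\<close>, hence holomorphic in the
  remaining variables, and they converge uniformly.
\<close>

lemma holomorphic_polydisc_taylor_coeff:
  assumes f: "holomorphic_polydisc (insert j J) f" and j: "j \<notin> J"
    and C: "\<And>z. z \<in> polydisc (insert j J) \<Longrightarrow> norm (f z) \<le> C"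
  shows "holomorphic_polydisc J (\<lambda>y. (deriv ^^ k) (\<lambda>w. f (y(j := w))) 0 / fact k)"
proof (rule holomorphic_polydisc_uniform_limit)
  define A where "A N y = 2 ^ k / of_nat N * (\<Sum>m<N. f (y(j := unity_root N m / 2)) * cnj (unity_root N m ^ k))" for N y
  show "holomorphic_polydisc J (A N)" for N
    unfolding A_def by (intro holomorphic_polydisc_mult holomorphic_polydisc_sum holomorphic_polydisc_const
        holomorphic_polydisc_upd[OF f _ j]) (auto simp: norm_divide)
  show "uniform_limit (polydisc J) A (\<lambda>y. (deriv ^^ k) (\<lambda>w. f (y(j := w))) 0 / fact k) sequentially"
  proof (rule uniform_limitI)
    fix e :: real assume e: "e > 0"
    have "(\<lambda>N. 2 ^ k * (2 * C * (1/2) ^ N)) \<longlonglongrightarrow> 2 ^ k * (2 * C * 0)"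
      by (intro tendsto_intros LIMSEQ_power_zero) simp
    then have "(\<lambda>N. 2 ^ k * (2 * C * (1/2) ^ N)) \<longlonglongrightarrow> 0" by simp
    from order_tendstoD(2)[OF this e] eventually_gt_at_top[of k]
    show "\<forall>\<^sub>F N in sequentially. \<forall>y\<in>polydisc J. dist (A N y) ((deriv ^^ k) (\<lambda>w. f (y(j := w))) 0 / fact k) < e"
    proof eventually_elim
      case (elim N)
      show ?case
      proof
        fix y assume y: "y \<in> polydisc J"
        have hol: "(\<lambda>w. f (y(j := w))) holomorphic_on ball 0 1"
          using holomorphic_polydisc_slice[OF f polydisc_upd_insert[OF y, of 0], of j] by simp
        have "norm (A N y - (deriv ^^ k) (\<lambda>w. f (y(j := w))) 0 / fact k) \<le> 2 ^ k * (2 * C * (1/2) ^ N)"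
          unfolding A_def using polydisc_upd_insert[OF y] by (intro taylor_coeff_average[OF hol _ elim(2)] C) auto
        then show "dist (A N y) ((deriv ^^ k) (\<lambda>w. f (y(j := w))) 0 / fact k) < e"
          using elim(1) by (simp add: dist_norm)
      qed
    qed
  qed
qed

text \<open>
  Induction on the number of variables: \<open>f\<close> is expanded in the new variable, and the Taylor coefficients
  are holomorphic in the others with the same bound \<open>C\<close>. This bound on all coefficients makes the
  multiple series absolutely convergent.
\<close>

theorem bounded_holomorphic_power_series:
  assumes "finite I" "holomorphic_polydisc I f" "\<And>z. z \<in> polydisc I \<Longrightarrow> norm (f z) \<le> C"
  shows "\<exists>c. has_power_series I f c \<and> (\<forall>\<alpha>\<in>multi_indices I. norm (c \<alpha>) \<le> C)"
  using assms
proof (induction I arbitrary: f rule: finite_induct)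
  case empty
  have "polydisc {} = {\<lambda>_. undefined}" "multi_indices {} = {\<lambda>_. undefined}"
    by (auto simp: polydisc_def multi_indices_def)
  then show ?case using empty
    by (intro exI[of _ "\<lambda>_. f (\<lambda>_. undefined)"]) (auto simp: has_power_series_def intro!: has_sum_finiteI)
next
  case (insert j J)
  define a where "a k y = (deriv ^^ k) (\<lambda>w. f (y(j := w))) 0 / fact k" for k y
  have slice: "(\<lambda>w. f (y(j := w))) holomorphic_on ball 0 1" if y: "y \<in> polydisc J" for y
    using holomorphic_polydisc_slice[OF insert.prems(1) polydisc_upd_insert[OF y, of 0], of j]
    by (simp only: fun_upd_upd norm_zero zero_less_one insertI1)
  have sliceC: "norm (f (y(j := w))) \<le> C" if "y \<in> polydisc J" "w \<in> ball 0 1" for y w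
    using that by (intro insert.prems(2) polydisc_upd_insert) auto
  have "\<exists>c. has_power_series J (a k) c \<and> (\<forall>\<alpha>\<in>multi_indices J. norm (c \<alpha>) \<le> C)" for k
  proof (rule insert.IH)
    show "holomorphic_polydisc J (a k)"
      unfolding a_def by (rule holomorphic_polydisc_taylor_coeff[OF insert.prems(1) insert.hyps(2) insert.prems(2)])
    show "norm (a k y) \<le> C" if "y \<in> polydisc J" for y
      unfolding a_def by (rule bounded_taylor_coeff[OF slice[OF that] sliceC[OF that]])
  qed
  then obtain c' where c': "\<And>k. has_power_series J (a k) (c' k)"
    "\<And>k \<alpha>. \<alpha> \<in> multi_indices J \<Longrightarrow> norm (c' k \<alpha>) \<le> C" by metis
  define c where "c \<alpha> = c' (\<alpha> j) (restrict \<alpha> J)" for \<alpha>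
  have bound: "norm (c \<alpha>) \<le> C" for \<alpha> unfolding c_def by (rule c'(2)) simp
  have "has_power_series (insert j J) f c"
    unfolding has_power_series_def
  proof
    fix z assume z: "z \<in> polydisc (insert j J)"
    define y where "y = restrict z J"
    have y: "y \<in> polydisc J" unfolding y_def by (rule polydisc_restrict[OF z]) auto
    have zy: "y(j := z j) = z"
      using z insert.hyps(2) by (auto simp: y_def polydisc_iff extensional_def restrict_def)
    have zj: "norm (z j) < 1" using z by (auto simp: polydisc_iff)
    have mon: "mon (insert j J) z \<alpha> = z j ^ \<alpha> j * mon J y (restrict \<alpha> J)" for \<alpha>
      using insert.hyps by (simp add: y_def)
    have glue: "(restrict \<alpha> J)(j := \<alpha> j) = \<alpha>" if "\<alpha> \<in> multi_indices (insert j J)" for \<alpha> :: "nat \<Rightarrow> nat"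
      using that by (auto simp: multi_indices_def PiE_iff extensional_def restrict_def fun_eq_iff)
    have upd: "restrict (\<beta>(j := k)) J = \<beta>" if "\<beta> \<in> multi_indices J" for \<beta> :: "nat \<Rightarrow> nat" and k
      using insert.hyps(2) that by (auto simp: multi_indices_def PiE_iff extensional_def restrict_def fun_eq_iff)
    have mem: "\<beta>(j := k) \<in> multi_indices (insert j J)" if "\<beta> \<in> multi_indices J" for \<beta> :: "nat \<Rightarrow> nat" and k
      using that by (auto simp: multi_indices_def PiE_iff extensional_def)
    have mon_upd: "mon (insert j J) z (\<beta>(j := k)) = z j ^ k * mon J y \<beta>" if "\<beta> \<in> multi_indices J" for \<beta> k
      by (simp only: mon upd[OF that] fun_upd_same)
    have iff: "(g has_sum s) (multi_indices (insert j J)) \<longleftrightarrow> ((\<lambda>(k, \<beta>). g (\<beta>(j := k))) has_sum s) (UNIV \<times> multi_indices J)"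
      for g :: "(nat \<Rightarrow> nat) \<Rightarrow> complex" and s
      by (rule has_sum_reindex_bij_witness[where j = "\<lambda>\<alpha>. (\<alpha> j, restrict \<alpha> J)" and i = "\<lambda>(k, \<beta>). \<beta>(j := k)"])
        (auto simp: glue upd mem)
    have "((\<lambda>(k, \<beta>). c (\<beta>(j := k)) * mon (insert j J) z (\<beta>(j := k))) has_sum f z) (UNIV \<times> multi_indices J)"
    proof (rule has_sum_SigmaI)
      show "((\<lambda>\<beta>. case (k, \<beta>) of (k, \<beta>) \<Rightarrow> c (\<beta>(j := k)) * mon (insert j J) z (\<beta>(j := k))) has_sum (a k y * z j ^ k)) (multi_indices J)" for k
      proof -
        have "((\<lambda>\<beta>. c' k \<beta> * mon J y \<beta> * z j ^ k) has_sum (a k y * z j ^ k)) (multi_indices J)"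
          using c'(1)[of k] y by (intro has_sum_cmult_left) (auto simp: has_power_series_def)
        also have "?this \<longleftrightarrow> ?thesis"
          by (rule has_sum_cong) (simp only: c_def mon_upd upd fun_upd_same prod.case mult_ac)
        finally show ?thesis .
      qed
      show "((\<lambda>k. a k y * z j ^ k) has_sum f z) UNIV"
        using bounded_taylor_has_sum[OF slice[OF y] sliceC[OF y] zj] by (simp add: a_def zy)
      have "(\<lambda>\<alpha>. norm (c \<alpha> * mon (insert j J) z \<alpha>)) summable_on multi_indices (insert j J)"
      proof (rule Infinite_Sum.abs_summable_on_comparison_test')
        show "(\<lambda>\<alpha>. C * norm (mon (insert j J) z \<alpha>)) summable_on multi_indices (insert j J)"
          using insert.hyps z by (intro summable_on_cmult_right summable_norm_mon) (auto simp: polydisc_iff)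
        show "norm (c \<alpha> * mon (insert j J) z \<alpha>) \<le> C * norm (mon (insert j J) z \<alpha>)" for \<alpha>
          unfolding norm_mult by (rule mult_right_mono[OF bound]) simp
      qed
      then have "(\<lambda>\<alpha>. c \<alpha> * mon (insert j J) z \<alpha>) summable_on multi_indices (insert j J)"
        by (simp only: summable_on_iff_abs_summable_on_complex)
      then show "(\<lambda>(k, \<beta>). c (\<beta>(j := k)) * mon (insert j J) z (\<beta>(j := k))) summable_on UNIV \<times> multi_indices J"
        unfolding summable_on_def iff .
    qed
    then show "((\<lambda>\<alpha>. c \<alpha> * mon (insert j J) z \<alpha>) has_sum f z) (multi_indices (insert j J))"
      unfolding iff .
  qed
  then show ?case using bound by blast
qed

section \<open>The Hardy space\<close>

definition H2_sqnorm :: "nat set \<Rightarrow> (point \<Rightarrow> complex) \<Rightarrow> real" where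
  "H2_sqnorm I f = (\<Sum>\<^sub>\<infinity>\<alpha>\<in>multi_indices I. (norm (power_series_coeff I f \<alpha>))\<^sup>2)"

lemma power_series_coeff_eq:
  assumes "finite I" "has_power_series I f c" "\<alpha> \<in> multi_indices I"
  shows "power_series_coeff I f \<alpha> = c \<alpha>"
proof -
  have "has_power_series I f (power_series_coeff I f)"
    unfolding power_series_coeff_def using assms(2) by (rule someI[of "has_power_series I f"])
  from power_series_unique[OF assms(1) this assms(2,3)] show ?thesis .
qed

lemma H2_sqnorm_eq:
  assumes "finite I" "has_power_series I f c"
  shows "H2_sqnorm I f = (\<Sum>\<^sub>\<infinity>\<alpha>\<in>multi_indices I. (norm (c \<alpha>))\<^sup>2)"
  unfolding H2_sqnorm_def by (intro infsum_cong) (simp add: power_series_coeff_eq[OF assms])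

lemma H2I:
  assumes "\<And>z. z \<notin> polydisc I \<Longrightarrow> f z = 0" "holomorphic_polydisc I f" "has_power_series I f c"
    "(\<lambda>\<alpha>. (norm (c \<alpha>))\<^sup>2) summable_on multi_indices I"
  shows "f \<in> H2 I"
  using assms unfolding H2_def by blast

lemma H2_zero_outside: "f \<in> H2 I \<Longrightarrow> z \<notin> polydisc I \<Longrightarrow> f z = 0"
  and H2_holomorphic: "f \<in> H2 I \<Longrightarrow> holomorphic_polydisc I f"
  by (auto simp: H2_def)

lemma H2_coefficients:
  assumes "finite I" "f \<in> H2 I"
  obtains c where "has_power_series I f c"
    "((\<lambda>\<alpha>. (norm (c \<alpha>))\<^sup>2) has_sum H2_sqnorm I f) (multi_indices I)"
proof -
  obtain c where c: "has_power_series I f c" "(\<lambda>\<alpha>. (norm (c \<alpha>))\<^sup>2) summable_on multi_indices I"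
    using assms(2) unfolding H2_def by blast
  then show ?thesis using that H2_sqnorm_eq[OF assms(1) c(1)] by (metis has_sum_infsum)
qed

lemma H2_inner_self:
  assumes "finite I" "f \<in> H2 I"
  shows "H2_inner I f f = of_real (H2_sqnorm I f)"
proof -
  obtain c where c: "has_power_series I f c"
    "((\<lambda>\<alpha>. (norm (c \<alpha>))\<^sup>2) has_sum H2_sqnorm I f) (multi_indices I)"
    by (rule H2_coefficients[OF assms])
  have "((\<lambda>\<alpha>. complex_of_real ((norm (c \<alpha>))\<^sup>2)) has_sum of_real (H2_sqnorm I f)) (multi_indices I)"
    using c(2) by (rule has_sum_of_real)
  also have "?this \<longleftrightarrow> ((\<lambda>\<alpha>. power_series_coeff I f \<alpha> * cnj (power_series_coeff I f \<alpha>))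
      has_sum of_real (H2_sqnorm I f)) (multi_indices I)"
    by (rule has_sum_cong) (simp only: power_series_coeff_eq[OF assms(1) c(1)] complex_norm_square)
  finally show ?thesis unfolding H2_inner_def by (rule infsumI)
qed

lemma H2_combination:
  assumes "f \<in> H2 I" "g \<in> H2 I"
  shows "(\<lambda>z. a * f z + b * g z) \<in> H2 I"
proof -
  obtain c where c: "has_power_series I f c" "(\<lambda>\<alpha>. (norm (c \<alpha>))\<^sup>2) summable_on multi_indices I"
    using assms(1) unfolding H2_def by blast
  obtain d where d: "has_power_series I g d" "(\<lambda>\<alpha>. (norm (d \<alpha>))\<^sup>2) summable_on multi_indices I"
    using assms(2) unfolding H2_def by blast
  show ?thesis
  proof (rule H2I[OF _ _ has_power_series_add[OF c(1) d(1)]])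
    show "holomorphic_polydisc I (\<lambda>z. a * f z + b * g z)"
      using assms by (intro holomorphic_polydisc_add holomorphic_polydisc_mult holomorphic_polydisc_const H2_holomorphic)
    show "(\<lambda>\<alpha>. (norm (a * c \<alpha> + b * d \<alpha>))\<^sup>2) summable_on multi_indices I"
    proof (rule summable_on_comparison_test)
      show "(\<lambda>\<alpha>. 2 * (norm a)\<^sup>2 * (norm (c \<alpha>))\<^sup>2 + 2 * (norm b)\<^sup>2 * (norm (d \<alpha>))\<^sup>2) summable_on multi_indices I"
        by (intro summable_on_add summable_on_cmult_right c(2) d(2))
      fix \<alpha>
      have "(norm (a * c \<alpha> + b * d \<alpha>))\<^sup>2 \<le> (norm (a * c \<alpha>) + norm (b * d \<alpha>))\<^sup>2"
        by (intro power_mono norm_triangle_ineq) auto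
      also have "\<dots> \<le> 2 * (norm (a * c \<alpha>))\<^sup>2 + 2 * (norm (b * d \<alpha>))\<^sup>2"
        using sum_squares_bound[of "norm (a * c \<alpha>)" "norm (b * d \<alpha>)"] by (simp add: power2_sum)
      finally show "(norm (a * c \<alpha> + b * d \<alpha>))\<^sup>2 \<le> 2 * (norm a)\<^sup>2 * (norm (c \<alpha>))\<^sup>2 + 2 * (norm b)\<^sup>2 * (norm (d \<alpha>))\<^sup>2"
        by (simp add: norm_mult power_mult_distrib)
    qed auto
  qed (use assms in \<open>auto simp: H2_zero_outside\<close>)
qed

text \<open>
  The coefficients of \<open>\<phi> h\<close> with index in \<open>S\<close> involve only the coefficients of \<open>h\<close> below some element of
  \<open>S\<close>. So \<open>h\<close> may be replaced by a polynomial, and \<open>dominated_by_polynomial\<close> applies.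
\<close>

lemma multiplier_coefficient_bound:
  assumes I: "finite I" and \<phi>: "has_power_series I \<phi> a" and C: "\<And>z. z \<in> polydisc I \<Longrightarrow> norm (\<phi> z) \<le> C"
    and h: "(\<lambda>\<alpha>. (norm (d \<alpha>))\<^sup>2) summable_on multi_indices I"
    and S: "finite S" "S \<subseteq> multi_indices I"
  shows "(\<Sum>\<beta>\<in>S. (norm (conv_coeff I a d \<beta>))\<^sup>2) \<le> C\<^sup>2 * (\<Sum>\<^sub>\<infinity>\<alpha>\<in>multi_indices I. (norm (d \<alpha>))\<^sup>2)"
proof -
  define T where "T = (\<Union>\<beta>\<in>S. \<Pi>\<^sub>E i\<in>I. {..\<beta> i})"
  have T: "finite T" "T \<subseteq> multi_indices I"
    using I S by (auto simp: T_def finite_PiE multi_indices_def)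
  define d' where "d' \<alpha> = (if \<alpha> \<in> T then d \<alpha> else 0)" for \<alpha>
  have "has_power_series I (\<lambda>z. \<Sum>\<alpha>\<in>T. d \<alpha> * mon I z \<alpha>) d'"
    unfolding has_power_series_def
    using T by (intro ballI has_sum_finite_neutralI[of T]) (auto simp: d'_def)
  from has_power_series_mult[OF I \<phi> this]
  have ps: "has_power_series I (\<lambda>z. \<phi> z * (\<Sum>\<alpha>\<in>T. d \<alpha> * mon I z \<alpha>)) (conv_coeff I a d')" .
  have eq: "conv_coeff I a d' \<beta> = conv_coeff I a d \<beta>" if \<beta>: "\<beta> \<in> S" for \<beta>
    unfolding conv_coeff_def
  proof (rule sum.cong)
    fix \<alpha> assume "\<alpha> \<in> (\<Pi>\<^sub>E i\<in>I. {..\<beta> i})"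
    have "(\<lambda>i\<in>I. \<beta> i - \<alpha> i) \<in> (\<Pi>\<^sub>E i\<in>I. {..\<beta> i})" by auto
    then have "(\<lambda>i\<in>I. \<beta> i - \<alpha> i) \<in> T" using \<beta> unfolding T_def by blast
    then show "a \<alpha> * d' (\<lambda>i\<in>I. \<beta> i - \<alpha> i) = a \<alpha> * d (\<lambda>i\<in>I. \<beta> i - \<alpha> i)" by (simp add: d'_def)
  qed simp
  have "(\<Sum>\<beta>\<in>S. (norm (conv_coeff I a d' \<beta>))\<^sup>2) \<le> C\<^sup>2 * (\<Sum>\<alpha>\<in>T. (norm (d \<alpha>))\<^sup>2)"
    using C by (intro dominated_by_polynomial[OF I ps T S]) (auto simp: norm_mult intro!: mult_right_mono)
  also have "\<dots> \<le> C\<^sup>2 * (\<Sum>\<^sub>\<infinity>\<alpha>\<in>multi_indices I. (norm (d \<alpha>))\<^sup>2)"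
    using T by (intro mult_left_mono finite_sum_le_infsum[OF h]) auto
  finally show ?thesis using eq by simp
qed

theorem H2_multiplier:
  assumes I: "finite I" and \<phi>: "holomorphic_polydisc I \<phi>"
    and C: "\<And>z. z \<in> polydisc I \<Longrightarrow> norm (\<phi> z) \<le> C" and h: "h \<in> H2 I"
  shows "(\<lambda>z. \<phi> z * h z) \<in> H2 I" and "H2_sqnorm I (\<lambda>z. \<phi> z * h z) \<le> C\<^sup>2 * H2_sqnorm I h"
proof -
  obtain a where a: "has_power_series I \<phi> a"
    using bounded_holomorphic_power_series[OF I \<phi> C] by blast
  obtain d where d: "has_power_series I h d"
    "((\<lambda>\<alpha>. (norm (d \<alpha>))\<^sup>2) has_sum H2_sqnorm I h) (multi_indices I)"
    by (rule H2_coefficients[OF I h])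
  note d' = has_sum_imp_summable[OF d(2)]
  have le: "(\<Sum>\<beta>\<in>S. (norm (conv_coeff I a d \<beta>))\<^sup>2) \<le> C\<^sup>2 * H2_sqnorm I h"
    if "finite S" "S \<subseteq> multi_indices I" for S
    using multiplier_coefficient_bound[OF I a C d' that] infsumI[OF d(2)] by simp
  have ps: "has_power_series I (\<lambda>z. \<phi> z * h z) (conv_coeff I a d)"
    by (rule has_power_series_mult[OF I a d(1)])
  have sum: "(\<lambda>\<beta>. (norm (conv_coeff I a d \<beta>))\<^sup>2) summable_on multi_indices I"
    by (rule nonneg_bdd_above_summable_on) (use le in \<open>auto intro!: bdd_aboveI2\<close>)
  show "(\<lambda>z. \<phi> z * h z) \<in> H2 I"
    by (rule H2I[OF _ _ ps sum])
      (use h \<phi> in \<open>auto intro: holomorphic_polydisc_mult H2_holomorphic simp: H2_zero_outside\<close>)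
  show "H2_sqnorm I (\<lambda>z. \<phi> z * h z) \<le> C\<^sup>2 * H2_sqnorm I h"
    unfolding H2_sqnorm_eq[OF I ps] by (rule infsum_le_finite_sums[OF sum le])
qed

section \<open>The reproducing kernel\<close>

definition szego_norm :: "nat set \<Rightarrow> point \<Rightarrow> real" where
  "szego_norm I a = (\<Sum>\<^sub>\<infinity>\<alpha>\<in>multi_indices I. (norm (mon I a \<alpha>))\<^sup>2)"

text \<open>
  \<open>szego_kernel I a\<close> is the reproducing kernel of \<open>H2 I\<close> at \<open>a\<close>, and \<open>szego_norm I a\<close> is the square of its
  norm. The product formula shows that the kernel is bounded, so that it is available as a multiplier.
\<close>

definition szego_kernel :: "nat set \<Rightarrow> point \<Rightarrow> point \<Rightarrow> complex" where
  "szego_kernel I a z = (\<Prod>i\<in>I. 1 / (1 - cnj (a i) * z i))"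

lemma szego_norm_has_sum:
  assumes "finite I" "a \<in> polydisc I"
  shows "((\<lambda>\<alpha>. (norm (mon I a \<alpha>))\<^sup>2) has_sum szego_norm I a) (multi_indices I)"
proof -
  have "(\<lambda>\<alpha>. mon I (\<lambda>i. (norm (a i))\<^sup>2) \<alpha>) summable_on multi_indices I"
    using assms by (intro summable_mon_nonneg) (auto simp: polydisc_iff power_less_one_iff)
  moreover have "mon I (\<lambda>i. (norm (a i))\<^sup>2) \<alpha> = (norm (mon I a \<alpha>))\<^sup>2" for \<alpha>
    by (simp add: norm_mon prod_power_distrib power_mult[symmetric] mult.commute)
  ultimately show ?thesis unfolding szego_norm_def by simp
qed

lemma szego_norm_pos:
  assumes "finite I" "a \<in> polydisc I"
  shows "szego_norm I a > 0"
proof -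
  have "(\<Sum>\<alpha>\<in>{\<lambda>i\<in>I. 0}. (norm (mon I a \<alpha>))\<^sup>2) \<le> szego_norm I a"
    by (rule finite_sum_le_has_sum[OF szego_norm_has_sum[OF assms]]) auto
  then show ?thesis by simp
qed

lemma szego_kernel_power_series:
  assumes "finite I" "a \<in> polydisc I"
  shows "has_power_series I (szego_kernel I a) (\<lambda>\<alpha>. cnj (mon I a \<alpha>))"
  unfolding has_power_series_def
proof
  fix z assume z: "z \<in> polydisc I"
  have "norm (cnj (a i) * z i) < 1" if "i \<in> I" for i
  proof -
    have "norm (a i) * norm (z i) < 1 * 1"
      using assms(2) z that by (intro mult_strict_mono) (auto simp: polydisc_iff)
    then show ?thesis by (simp add: norm_mult)
  qed
  from has_sum_mon[OF assms(1) this]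
  show "((\<lambda>\<alpha>. cnj (mon I a \<alpha>) * mon I z \<alpha>) has_sum szego_kernel I a z) (multi_indices I)"
    by (simp add: szego_kernel_def power_mult_distrib prod.distrib)
qed

lemma szego_kernel_diagonal:
  assumes "finite I" "a \<in> polydisc I"
  shows "szego_kernel I a a = of_real (szego_norm I a)"
proof -
  have "((\<lambda>\<alpha>. cnj (mon I a \<alpha>) * mon I a \<alpha>) has_sum szego_kernel I a a) (multi_indices I)"
    using szego_kernel_power_series[OF assms] assms(2) by (simp add: has_power_series_def)
  moreover have "((\<lambda>\<alpha>. cnj (mon I a \<alpha>) * mon I a \<alpha>) has_sum of_real (szego_norm I a)) (multi_indices I)"
    using has_sum_of_real[OF szego_norm_has_sum[OF assms], where 'a = complex]
    by (simp only: complex_norm_square mult.commute)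
  ultimately show ?thesis by (rule has_sum_unique)
qed

lemma szego_kernel_Hinf:
  assumes I: "finite I" and a: "a \<in> polydisc I"
  shows "szego_kernel I a \<in> Hinf I"
proof -
  have ne: "norm (cnj (a i) * w) \<le> norm (a i)" if "norm w < 1" for i w
    using that by (simp add: norm_mult mult_left_le)
  have "holomorphic_polydisc I (\<lambda>z. 1 / (1 - cnj (a i) * z i))" if i: "i \<in> I" for i
  proof (rule holomorphic_polydisc_coordinate[OF _ i])
    have "cnj (a i) * w \<noteq> 1" if "w \<in> ball 0 1" for w
    proof
      assume "cnj (a i) * w = 1"
      then have "1 \<le> norm (a i)" using ne[of w i] that by simp
      moreover have "norm (a i) < 1" using a i by (simp add: polydisc_iff)
      ultimately show False by simp
    qed
    then show "(\<lambda>w. 1 / (1 - cnj (a i) * w)) holomorphic_on ball 0 1"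
      by (intro holomorphic_intros) auto
  qed
  then have hol: "holomorphic_polydisc I (szego_kernel I a)"
    unfolding szego_kernel_def by (rule holomorphic_polydisc_prod)
  have "norm (szego_kernel I a z) \<le> (\<Prod>i\<in>I. 1 / (1 - norm (a i)))" if z: "z \<in> polydisc I" for z
  proof -
    have "norm (szego_kernel I a z) = (\<Prod>i\<in>I. norm (1 / (1 - cnj (a i) * z i)))"
      by (simp add: szego_kernel_def prod_norm)
    also have "\<dots> \<le> (\<Prod>i\<in>I. 1 / (1 - norm (a i)))"
    proof (rule prod_mono)
      fix i assume i: "i \<in> I"
      have "1 - norm (a i) \<le> norm (1 - cnj (a i) * z i)"
        using norm_triangle_ineq2[of 1 "cnj (a i) * z i"] ne[of "z i" i] z i by (simp add: polydisc_iff)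
      then have "1 / norm (1 - cnj (a i) * z i) \<le> 1 / (1 - norm (a i))"
        using a i by (intro divide_left_mono mult_pos_pos) (auto simp: polydisc_iff intro: less_le_trans)
      then show "0 \<le> norm (1 / (1 - cnj (a i) * z i)) \<and> norm (1 / (1 - cnj (a i) * z i)) \<le> 1 / (1 - norm (a i))"
        by (simp add: norm_divide)
    qed
    finally show ?thesis .
  qed
  then show ?thesis using hol unfolding Hinf_def bounded_iff by blast
qed

text \<open>
  Elements of \<open>H2 I\<close> vanish off the polydisc, so the constant function 1 has to be cut off there.
\<close>

definition one_H2 :: "nat set \<Rightarrow> point \<Rightarrow> complex" where
  "one_H2 I z = (if z \<in> polydisc I then 1 else 0)"

lemma holomorphic_polydisc_cong:
  assumes "holomorphic_polydisc I f" "\<And>z. z \<in> polydisc I \<Longrightarrow> f z = g z"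
  shows "holomorphic_polydisc I g"
  unfolding holomorphic_polydisc_def
proof (intro conjI ballI)
  show "continuous_on (polydisc I) g"
    using holomorphic_polydisc_cont[OF assms(1)] by (rule continuous_on_eq) (use assms(2) in auto)
  fix z i assume zi: "z \<in> polydisc I" "i \<in> I"
  show "(\<lambda>w. g (z(i := w))) holomorphic_on ball 0 1"
  proof (rule holomorphic_transform[OF holomorphic_polydisc_slice[OF assms(1) zi]])
    show "f (z(i := w)) = g (z(i := w))" if "w \<in> ball 0 1" for w
      using that by (intro assms(2) polydisc_upd zi) simp
  qed
qed

lemma has_power_series_cong:
  assumes "has_power_series I f c" "\<And>z. z \<in> polydisc I \<Longrightarrow> f z = g z"
  shows "has_power_series I g c"
  using assms by (simp add: has_power_series_def)

lemma cut_in_H2: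
  assumes "finite I" "holomorphic_polydisc I f" "has_power_series I f c"
    and c: "((\<lambda>\<alpha>. (norm (c \<alpha>))\<^sup>2) has_sum s) (multi_indices I)"
  shows "(\<lambda>z. f z * one_H2 I z) \<in> H2 I" "H2_sqnorm I (\<lambda>z. f z * one_H2 I z) = s"
proof -
  have ps: "has_power_series I (\<lambda>z. f z * one_H2 I z) c"
    by (rule has_power_series_cong[OF assms(3)]) (simp add: one_H2_def)
  show "(\<lambda>z. f z * one_H2 I z) \<in> H2 I"
    by (rule H2I[OF _ _ ps has_sum_imp_summable[OF c]])
      (auto simp: one_H2_def intro: holomorphic_polydisc_cong[OF assms(2)])
  show "H2_sqnorm I (\<lambda>z. f z * one_H2 I z) = s"
    unfolding H2_sqnorm_eq[OF assms(1) ps] using c by (rule infsumI)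
qed

lemma one_H2_in_H2:
  assumes "finite I"
  shows "one_H2 I \<in> H2 I"
proof -
  let ?c = "\<lambda>\<alpha>. if \<alpha> = (\<lambda>i\<in>I. 0) then 1 else 0 :: complex"
  have ps: "has_power_series I (\<lambda>_. 1) ?c"
    unfolding has_power_series_def
  proof
    fix z
    show "((\<lambda>\<alpha>. ?c \<alpha> * mon I z \<alpha>) has_sum 1) (multi_indices I)"
      by (rule has_sum_finite_neutralI[of "{\<lambda>i\<in>I. 0}"]) auto
  qed
  have "((\<lambda>\<alpha>. (norm (?c \<alpha>))\<^sup>2) has_sum 1) (multi_indices I)"
    by (rule has_sum_finite_neutralI[of "{\<lambda>i\<in>I. 0}"]) auto
  from cut_in_H2(1)[OF assms holomorphic_polydisc_const ps this] show ?thesis by simp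
qed

lemma szego_kernel_H2:
  assumes "finite I" "a \<in> polydisc I"
  shows "(\<lambda>z. szego_kernel I a z * one_H2 I z) \<in> H2 I"
    "H2_sqnorm I (\<lambda>z. szego_kernel I a z * one_H2 I z) = szego_norm I a"
proof -
  have "holomorphic_polydisc I (szego_kernel I a)" using szego_kernel_Hinf[OF assms] by (simp add: Hinf_def)
  moreover have "((\<lambda>\<alpha>. (norm (cnj (mon I a \<alpha>)))\<^sup>2) has_sum szego_norm I a) (multi_indices I)"
    using szego_norm_has_sum[OF assms] by (simp only: complex_mod_cnj)
  ultimately show "(\<lambda>z. szego_kernel I a z * one_H2 I z) \<in> H2 I"
    "H2_sqnorm I (\<lambda>z. szego_kernel I a z * one_H2 I z) = szego_norm I a"
    using cut_in_H2[OF assms(1) _ szego_kernel_power_series[OF assms]] by blast+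
qed

lemma H2_point_evaluation:
  assumes I: "finite I" and f: "f \<in> H2 I" and a: "a \<in> polydisc I"
  shows "(norm (f a))\<^sup>2 \<le> H2_sqnorm I f * szego_norm I a"
proof -
  obtain c where c: "has_power_series I f c"
    "((\<lambda>\<alpha>. (norm (c \<alpha>))\<^sup>2) has_sum H2_sqnorm I f) (multi_indices I)"
    by (rule H2_coefficients[OF I f])
  have hs: "((\<lambda>\<alpha>. c \<alpha> * mon I a \<alpha>) has_sum f a) (multi_indices I)"
    using c(1) a by (simp add: has_power_series_def)
  show ?thesis
  proof (rule tendsto_upperbound)
    show "((\<lambda>S. (norm (\<Sum>\<alpha>\<in>S. c \<alpha> * mon I a \<alpha>))\<^sup>2) \<longlongrightarrow> (norm (f a))\<^sup>2) (finite_subsets_at_top (multi_indices I))"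
      using hs unfolding has_sum_def by (intro tendsto_intros)
    show "\<forall>\<^sub>F S in finite_subsets_at_top (multi_indices I).
        (norm (\<Sum>\<alpha>\<in>S. c \<alpha> * mon I a \<alpha>))\<^sup>2 \<le> H2_sqnorm I f * szego_norm I a"
    proof (rule eventually_finite_subsets_at_top_weakI)
      fix S assume S: "finite S" "S \<subseteq> multi_indices I"
      have "(norm (\<Sum>\<alpha>\<in>S. c \<alpha> * mon I a \<alpha>))\<^sup>2 \<le> (\<Sum>\<alpha>\<in>S. norm (c \<alpha>) * norm (mon I a \<alpha>))\<^sup>2"
        by (intro power_mono order_trans[OF norm_sum]) (auto simp: norm_mult)
      also have "\<dots> \<le> (\<Sum>\<alpha>\<in>S. (norm (c \<alpha>))\<^sup>2) * (\<Sum>\<alpha>\<in>S. (norm (mon I a \<alpha>))\<^sup>2)"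
        by (rule Cauchy_Schwarz_ineq_sum)
      also have "\<dots> \<le> H2_sqnorm I f * szego_norm I a"
      proof (rule mult_mono)
        show "(\<Sum>\<alpha>\<in>S. (norm (c \<alpha>))\<^sup>2) \<le> H2_sqnorm I f"
          using S by (intro finite_sum_le_has_sum[OF c(2)]) auto
        show "(\<Sum>\<alpha>\<in>S. (norm (mon I a \<alpha>))\<^sup>2) \<le> szego_norm I a"
          using S by (intro finite_sum_le_has_sum[OF szego_norm_has_sum[OF I a]]) auto
        show "0 \<le> H2_sqnorm I f" using c(2) by (rule has_sum_nonneg) auto
      qed (auto intro: sum_nonneg)
      finally show "(norm (\<Sum>\<alpha>\<in>S. c \<alpha> * mon I a \<alpha>))\<^sup>2 \<le> H2_sqnorm I f * szego_norm I a" .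
    qed
  qed simp
qed

text \<open>
  A multiplier bound is needed on the kernels only: with \<open>k\<close> the kernel at \<open>a\<close>, evaluating \<open>k g\<close> at \<open>a\<close>
  gives \<open>\<parallel>k\<parallel>\<^sup>2 |g a| \<le> \<parallel>k g\<parallel> \<parallel>k\<parallel> \<le> C \<parallel>k\<parallel>\<^sup>2\<close>.
\<close>

lemma pointwise_bound_from_kernels:
  assumes I: "finite I" and g: "g \<in> H2 I" and a: "a \<in> polydisc I" and C: "0 \<le> C"
    and le: "H2_sqnorm I (\<lambda>z. szego_kernel I a z * g z) \<le> C\<^sup>2 * szego_norm I a"
  shows "norm (g a) \<le> C"
proof -
  let ?K = "szego_norm I a"
  have K: "?K > 0" by (rule szego_norm_pos[OF I a])
  have Hinf: "szego_kernel I a \<in> Hinf I" by (rule szego_kernel_Hinf[OF I a])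
  then obtain B where hol: "holomorphic_polydisc I (szego_kernel I a)"
    and B: "\<And>z. z \<in> polydisc I \<Longrightarrow> norm (szego_kernel I a z) \<le> B"
    unfolding Hinf_def bounded_iff by blast
  have "(norm (szego_kernel I a a * g a))\<^sup>2 \<le> H2_sqnorm I (\<lambda>z. szego_kernel I a z * g z) * ?K"
    by (rule H2_point_evaluation[OF I H2_multiplier(1)[OF I hol B g] a])
  also have "\<dots> \<le> C\<^sup>2 * ?K * ?K" using le K by (intro mult_right_mono) auto
  finally have "(?K * norm (g a))\<^sup>2 \<le> (?K * C)\<^sup>2"
    using K by (simp add: szego_kernel_diagonal[OF I a] norm_mult power_mult_distrib power2_eq_square mult_ac)
  then have "?K * norm (g a) \<le> ?K * C" using K C by (intro power2_le_imp_le[of "?K * norm (g a)"]) auto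
  then show ?thesis using K by simp
qed

section \<open>Density of the nonvanishing set\<close>

text \<open>
  The points \<open>p\<close> and \<open>q\<close> are moved together one coordinate at a time. The new common value \<open>w\<close> of a
  coordinate must keep \<open>u q > 0\<close>, which allows an open set of values, and must keep \<open>f p \<noteq> 0\<close>, which by the
  identity theorem in one variable does not fail on a whole open set.
\<close>

lemma zero_set_nowhere_dense:
  assumes I: "finite I" and f: "holomorphic_polydisc I f" and p: "p \<in> polydisc I" "f p \<noteq> 0"
    and u: "continuous_on (polydisc I) (u :: point \<Rightarrow> real)" and q: "q \<in> polydisc I" "u q > 0"
  obtains x where "x \<in> polydisc I" "f x \<noteq> 0" "u x > 0"
proof -
  have "\<exists>p q. p \<in> polydisc I \<and> q \<in> polydisc I \<and> f p \<noteq> 0 \<and> u q > 0 \<and> (\<forall>i\<in>A. p i = q i)"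
    if "finite A" "A \<subseteq> I" for A
    using that
  proof (induction A rule: finite_induct)
    case empty
    then show ?case using p q by blast
  next
    case (insert i A)
    then obtain p q where pq: "p \<in> polydisc I" "q \<in> polydisc I" "f p \<noteq> 0" "u q > 0" "\<forall>i\<in>A. p i = q i"
      by blast
    have i: "i \<in> I" using insert by blast
    define S where "S = ball 0 1 \<inter> (\<lambda>w. u (q(i := w))) -` {0<..}"
    have "continuous_on (ball 0 1) (\<lambda>w. q(i := w))"
    proof (rule continuous_on_coordinatewise_then_product)
      fix j show "continuous_on (ball 0 1) (\<lambda>w. (q(i := w)) j)" by (cases "j = i") auto
    qed
    then have "continuous_on (ball 0 1) (\<lambda>w. u (q(i := w)))"
      by (rule continuous_on_compose2[OF u]) (use polydisc_upd[OF pq(2) i] in auto)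
    then have S: "open S" unfolding S_def by (rule continuous_open_preimage) auto
    have qS: "q i \<in> S" using pq(2,4) i by (simp add: S_def polydisc_iff)
    have "\<exists>w\<in>S. f (p(i := w)) \<noteq> 0"
    proof (rule ccontr)
      assume "\<not> ?thesis"
      then have z: "f (p(i := w)) = 0" if "w \<in> S" for w using that by blast
      have "f (p(i := p i)) = 0"
      proof (rule analytic_continuation_open[of S "ball 0 1" "\<lambda>w. f (p(i := w))" "\<lambda>_. 0"])
        show "(\<lambda>w. f (p(i := w))) holomorphic_on ball 0 1"
          by (rule holomorphic_polydisc_slice[OF f pq(1) i])
        show "p i \<in> ball 0 1" using pq(1) i by (simp add: polydisc_iff)
      qed (use S qS z in \<open>auto simp: S_def\<close>)
      then show False using pq(3) by simp
    qed
    then obtain w where w: "w \<in> S" "f (p(i := w)) \<noteq> 0" by blast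
    show ?case
    proof (intro exI conjI)
      show "p(i := w) \<in> polydisc I" "q(i := w) \<in> polydisc I"
        using w(1) pq i by (auto simp: S_def intro!: polydisc_upd)
      show "f (p(i := w)) \<noteq> 0" by (rule w(2))
      show "u (q(i := w)) > 0" using w(1) by (simp add: S_def)
      show "\<forall>j\<in>insert i A. (p(i := w)) j = (q(i := w)) j" using pq(5) by simp
    qed
  qed
  from this[OF I order_refl] obtain p q where pq: "p \<in> polydisc I" "q \<in> polydisc I" "f p \<noteq> 0" "u q > 0" "\<forall>i\<in>I. p i = q i"
    by blast
  then have "p = q" by (intro extensionalityI[of p I q]) (auto simp: polydisc_iff)
  then show ?thesis using that pq by blast
qed

lemma le_by_density:
  assumes "finite I" "holomorphic_polydisc I f" "p \<in> polydisc I" "f p \<noteq> 0"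
    and "continuous_on (polydisc I) (u :: point \<Rightarrow> real)"
    and "\<And>z. z \<in> polydisc I \<Longrightarrow> f z \<noteq> 0 \<Longrightarrow> u z \<le> 0" and "q \<in> polydisc I"
  shows "u q \<le> 0"
  using zero_set_nowhere_dense[OF assms(1-5,7)] assms(6) by (metis not_le)

lemma eq_by_density:
  assumes "finite I" "holomorphic_polydisc I f" "p \<in> polydisc I" "f p \<noteq> 0"
    and "continuous_on (polydisc I) g" "continuous_on (polydisc I) h"
    and "\<And>z. z \<in> polydisc I \<Longrightarrow> f z \<noteq> 0 \<Longrightarrow> g z = (h z :: complex)" and "q \<in> polydisc I"
  shows "g q = h q"
proof -
  have "norm (g q - h q) \<le> 0"
    by (rule le_by_density[OF assms(1-4), of "\<lambda>z. norm (g z - h z)"])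
      (use assms(5-8) in \<open>auto intro!: continuous_intros\<close>)
  then show ?thesis by simp
qed

section \<open>Unitary intertwiners\<close>

text \<open>
  The witness in the definition of unitary equivalence, named so that its inverse can be discussed.
\<close>

definition unitary_intertwiner ::
    "nat set \<Rightarrow> (point \<Rightarrow> complex) set \<Rightarrow> (point \<Rightarrow> complex) set \<Rightarrow> ((point \<Rightarrow> complex) \<Rightarrow> point \<Rightarrow> complex) \<Rightarrow> bool" where
  "unitary_intertwiner I M1 M2 U \<longleftrightarrow>
     bij_betw U M1 M2 \<and>
     (\<forall>f\<in>M1. \<forall>g\<in>M1. \<forall>a b. U (\<lambda>z. a * f z + b * g z) = (\<lambda>z. a * U f z + b * U g z)) \<and>
     (\<forall>f\<in>M1. \<forall>g\<in>M1. H2_inner I (U f) (U g) = H2_inner I f g) \<and>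
     (\<forall>\<phi>\<in>Hinf I. \<forall>f\<in>M1. U (\<lambda>z. \<phi> z * f z) = (\<lambda>z. \<phi> z * U f z))"

definition Hinf_submodule :: "nat set \<Rightarrow> (point \<Rightarrow> complex) set \<Rightarrow> bool" where
  "Hinf_submodule I M \<longleftrightarrow> M \<subseteq> H2 I \<and>
     (\<forall>f\<in>M. \<forall>g\<in>M. \<forall>a b. (\<lambda>z. a * f z + b * g z) \<in> M) \<and>
     (\<forall>\<phi>\<in>Hinf I. \<forall>f\<in>M. (\<lambda>z. \<phi> z * f z) \<in> M)"

lemma unitary_intertwiner_inverse:
  assumes U: "unitary_intertwiner I M1 M2 U" and M1: "Hinf_submodule I M1"
  shows "unitary_intertwiner I M2 M1 (inv_into M1 U)"
proof -
  define V where "V = inv_into M1 U"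
  have bij: "bij_betw U M1 M2" using U by (simp add: unitary_intertwiner_def)
  have V: "V f \<in> M1" "U (V f) = f" if "f \<in> M2" for f
    using bij that by (auto simp: V_def bij_betw_def inv_into_into f_inv_into_f)
  have VU: "V (U f) = f" if "f \<in> M1" for f
    using bij that by (simp add: V_def bij_betw_def)
  have "bij_betw V M2 M1" unfolding V_def by (rule bij_betw_inv_into[OF bij])
  moreover have "V (\<lambda>z. a * f z + b * g z) = (\<lambda>z. a * V f z + b * V g z)" if "f \<in> M2" "g \<in> M2" for f g a b
  proof -
    have "(\<lambda>z. a * V f z + b * V g z) \<in> M1" using M1 V that by (simp add: Hinf_submodule_def)
    moreover have "U (\<lambda>z. a * V f z + b * V g z) = (\<lambda>z. a * f z + b * g z)"
      using U V that by (simp add: unitary_intertwiner_def)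
    ultimately show ?thesis by (metis VU)
  qed
  moreover have "H2_inner I (V f) (V g) = H2_inner I f g" if "f \<in> M2" "g \<in> M2" for f g
    using U V that unfolding unitary_intertwiner_def by metis
  moreover have "V (\<lambda>z. \<phi> z * f z) = (\<lambda>z. \<phi> z * V f z)" if "\<phi> \<in> Hinf I" "f \<in> M2" for \<phi> f
  proof -
    have "(\<lambda>z. \<phi> z * V f z) \<in> M1" using M1 V that by (simp add: Hinf_submodule_def)
    moreover have "U (\<lambda>z. \<phi> z * V f z) = (\<lambda>z. \<phi> z * f z)"
      using U V that by (simp add: unitary_intertwiner_def)
    ultimately show ?thesis by (metis VU)
  qed
  ultimately show ?thesis unfolding unitary_intertwiner_def V_def[symmetric] by blast
qed

lemma HinfE:
  assumes "\<phi> \<in> Hinf I"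
  obtains B where "holomorphic_polydisc I \<phi>" "\<And>z. z \<in> polydisc I \<Longrightarrow> norm (\<phi> z) \<le> B"
  using assms unfolding Hinf_def bounded_iff by blast

lemma HinfI:
  assumes "holomorphic_polydisc I \<phi>" "\<And>z. z \<in> polydisc I \<Longrightarrow> norm (\<phi> z) \<le> B"
  shows "\<phi> \<in> Hinf I"
  using assms unfolding Hinf_def bounded_iff by blast

lemma Hinf_mult_H2:
  assumes "finite I" "\<phi> \<in> Hinf I" "h \<in> H2 I"
  shows "(\<lambda>z. \<phi> z * h z) \<in> H2 I"
  by (rule HinfE[OF assms(2)]) (rule H2_multiplier(1)[OF assms(1) _ _ assms(3)])

lemma unitary_intertwiner_sqnorm:
  assumes "finite I" "unitary_intertwiner I M1 M2 U" "M1 \<subseteq> H2 I" "M2 \<subseteq> H2 I" "f \<in> M1"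
  shows "U f \<in> M2" "H2_sqnorm I (U f) = H2_sqnorm I f"
proof -
  show Uf: "U f \<in> M2" using assms unfolding unitary_intertwiner_def bij_betw_def by blast
  have "H2_inner I (U f) (U f) = H2_inner I f f" using assms unfolding unitary_intertwiner_def by blast
  then show "H2_sqnorm I (U f) = H2_sqnorm I f"
    using H2_inner_self[OF assms(1)] Uf assms(3-5) by (metis of_real_eq_iff subsetD)
qed

text \<open>
  The kernel \<open>k\<close> at \<open>a\<close> commutes with \<open>U\<close>, so \<open>\<parallel>k U \<phi>\<parallel> = \<parallel>U (k \<phi>)\<parallel> = \<parallel>k \<phi>\<parallel> \<le> C \<parallel>k\<parallel>\<close>.
\<close>

lemma unitary_intertwiner_generator_bound:
  assumes I: "finite I" and U: "unitary_intertwiner I M1 M2 U"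
    and M1: "M1 \<subseteq> H2 I" and M2: "M2 \<subseteq> H2 I"
    and \<phi>: "holomorphic_polydisc I \<phi>" and C: "\<And>z. z \<in> polydisc I \<Longrightarrow> norm (\<phi> z) \<le> C"
    and gen: "\<And>h. h \<in> H2 I \<Longrightarrow> (\<lambda>z. \<phi> z * h z) \<in> M1"
    and a: "a \<in> polydisc I"
  shows "norm (U (\<lambda>z. \<phi> z * one_H2 I z) a) \<le> C"
proof -
  let ?m = "\<lambda>z. \<phi> z * one_H2 I z" and ?k = "szego_kernel I a"
  have m: "?m \<in> M1" by (rule gen[OF one_H2_in_H2[OF I]])
  have k: "?k \<in> Hinf I" by (rule szego_kernel_Hinf[OF I a])
  have comm: "(\<lambda>z. ?k z * ?m z) = (\<lambda>z. \<phi> z * (?k z * one_H2 I z))" by (simp add: fun_eq_iff mult_ac)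
  have km: "(\<lambda>z. ?k z * ?m z) \<in> M1" unfolding comm by (rule gen[OF szego_kernel_H2(1)[OF I a]])
  show ?thesis
  proof (rule pointwise_bound_from_kernels[OF I _ a])
    show "U ?m \<in> H2 I" using unitary_intertwiner_sqnorm(1)[OF I U M1 M2 m] M2 by blast
    show "0 \<le> C" using order_trans[OF norm_ge_zero C[OF a]] .
    have "U (\<lambda>z. ?k z * ?m z) = (\<lambda>z. ?k z * U ?m z)"
      using U k m by (simp only: unitary_intertwiner_def)
    then have "H2_sqnorm I (\<lambda>z. ?k z * U ?m z) = H2_sqnorm I (\<lambda>z. \<phi> z * (?k z * one_H2 I z))"
      using unitary_intertwiner_sqnorm(2)[OF I U M1 M2 km] by (simp only: comm)
    also have "\<dots> \<le> C\<^sup>2 * H2_sqnorm I (\<lambda>z. ?k z * one_H2 I z)"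
      by (rule H2_multiplier(2)[OF I \<phi> C szego_kernel_H2(1)[OF I a]])
    finally show "H2_sqnorm I (\<lambda>z. ?k z * U ?m z) \<le> C\<^sup>2 * szego_norm I a"
      by (simp only: szego_kernel_H2(2)[OF I a])
  qed
qed

lemma polynomial_Hinf:
  assumes "finite I" "finite S"
  shows "(\<lambda>z. \<Sum>\<alpha>\<in>S. d \<alpha> * mon I z \<alpha>) \<in> Hinf I"
proof (rule HinfI)
  show "holomorphic_polydisc I (\<lambda>z. \<Sum>\<alpha>\<in>S. d \<alpha> * mon I z \<alpha>)"
    by (intro holomorphic_polydisc_sum holomorphic_polydisc_mult holomorphic_polydisc_const
        holomorphic_polydisc_prod holomorphic_polydisc_coordinate[where f = "\<lambda>w. w ^ _"] holomorphic_intros)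
  fix z assume z: "z \<in> polydisc I"
  have "norm (mon I z \<alpha>) \<le> 1" for \<alpha>
    unfolding norm_mon using z by (intro prod_le_1) (auto simp: polydisc_iff power_le_one)
  then show "norm (\<Sum>\<alpha>\<in>S. d \<alpha> * mon I z \<alpha>) \<le> (\<Sum>\<alpha>\<in>S. norm (d \<alpha>))"
    by (intro sum_norm_le) (simp add: norm_mult mult_left_le)
qed

lemma H2_truncation:
  assumes I: "finite I" and h: "has_power_series I h d" "h \<in> H2 I"
    and d: "((\<lambda>\<alpha>. (norm (d \<alpha>))\<^sup>2) has_sum s) (multi_indices I)"
    and S: "finite S" "S \<subseteq> multi_indices I"
  defines "r \<equiv> \<lambda>z. h z - (\<Sum>\<alpha>\<in>S. d \<alpha> * mon I z \<alpha>) * one_H2 I z"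
  shows "r \<in> H2 I" "H2_sqnorm I r = s - (\<Sum>\<alpha>\<in>S. (norm (d \<alpha>))\<^sup>2)"
proof -
  let ?p = "\<lambda>z. \<Sum>\<alpha>\<in>S. d \<alpha> * mon I z \<alpha>"
  have p: "(\<lambda>z. ?p z * one_H2 I z) \<in> H2 I"
    by (rule Hinf_mult_H2[OF I polynomial_Hinf[OF I S(1)] one_H2_in_H2[OF I]])
  show "r \<in> H2 I"
    using H2_combination[OF h(2) p, of 1 "-1"] by (simp add: r_def)
  let ?d = "\<lambda>\<alpha>. if \<alpha> \<in> S then d \<alpha> else 0"
  have ps: "has_power_series I ?p ?d"
    unfolding has_power_series_def using S by (intro ballI has_sum_finite_neutralI[of S]) auto
  have "has_power_series I r (\<lambda>\<alpha>. 1 * d \<alpha> + (-1) * ?d \<alpha>)"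
    by (rule has_power_series_cong[OF has_power_series_add[OF h(1) ps]]) (simp add: r_def one_H2_def)
  from H2_sqnorm_eq[OF I this]
  have "H2_sqnorm I r = (\<Sum>\<^sub>\<infinity>\<alpha>\<in>multi_indices I. (norm (1 * d \<alpha> + (-1) * ?d \<alpha>))\<^sup>2)" .
  moreover have "((\<lambda>\<alpha>. (norm (1 * d \<alpha> + (-1) * ?d \<alpha>))\<^sup>2) has_sum (s + (\<Sum>\<alpha>\<in>S. - (norm (d \<alpha>))\<^sup>2))) (multi_indices I)"
  proof -
    have "((\<lambda>\<alpha>. if \<alpha> \<in> S then - (norm (d \<alpha>))\<^sup>2 else 0) has_sum (\<Sum>\<alpha>\<in>S. - (norm (d \<alpha>))\<^sup>2)) (multi_indices I)"
      using S by (intro has_sum_finite_neutralI[of S]) auto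
    from has_sum_add[OF d this] show ?thesis
      by (rule has_sum_cong[THEN iffD1, rotated]) auto
  qed
  ultimately show "H2_sqnorm I r = s - (\<Sum>\<alpha>\<in>S. (norm (d \<alpha>))\<^sup>2)"
    by (simp add: infsumI sum_negf)
qed

text \<open>
  For a polynomial \<open>h\<close> this is the intertwining relation. In general \<open>h\<close> is the limit of its truncations,
  and isometry together with continuity of point evaluation carries the relation to the limit.
\<close>

lemma unitary_intertwiner_on_generator:
  assumes I: "finite I" and U: "unitary_intertwiner I M1 M2 U"
    and M1: "M1 \<subseteq> H2 I" and M2: "M2 \<subseteq> H2 I"
    and \<phi>: "holomorphic_polydisc I \<phi>" and C: "\<And>z. z \<in> polydisc I \<Longrightarrow> norm (\<phi> z) \<le> C"
    and gen: "\<And>h. h \<in> H2 I \<Longrightarrow> (\<lambda>z. \<phi> z * h z) \<in> M1"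
    and h: "h \<in> H2 I"
  shows "U (\<lambda>z. \<phi> z * h z) = (\<lambda>z. h z * U (\<lambda>z. \<phi> z * one_H2 I z) z)"
proof
  fix a
  let ?m = "\<lambda>z. \<phi> z * one_H2 I z"
  let ?F = "finite_subsets_at_top (multi_indices I)"
  have lin: "\<forall>f\<in>M1. \<forall>g\<in>M1. \<forall>a b. U (\<lambda>z. a * f z + b * g z) = (\<lambda>z. a * U f z + b * U g z)"
    using U unfolding unitary_intertwiner_def by (elim conjE)
  have m: "?m \<in> M1" by (rule gen[OF one_H2_in_H2[OF I]])
  have h': "(\<lambda>z. \<phi> z * h z) \<in> M1" by (rule gen[OF h])
  have Uh: "U (\<lambda>z. \<phi> z * h z) \<in> H2 I"
    using unitary_intertwiner_sqnorm(1)[OF I U M1 M2 h'] M2 by blast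
  show "U (\<lambda>z. \<phi> z * h z) a = h a * U ?m a"
  proof (cases "a \<in> polydisc I")
    case False
    then show ?thesis using H2_zero_outside[OF Uh] H2_zero_outside[OF h] by simp
  next
    case a: True
    obtain d where d: "has_power_series I h d"
      "((\<lambda>\<alpha>. (norm (d \<alpha>))\<^sup>2) has_sum H2_sqnorm I h) (multi_indices I)"
      by (rule H2_coefficients[OF I h])
    define p where "p S z = (\<Sum>\<alpha>\<in>S. d \<alpha> * mon I z \<alpha>)" for S z
    \<comment> \<open>The error caused by truncating \<open>h\<close> to the exponents in \<open>S\<close>; it tends to 0 along the finite sets \<open>S\<close>.\<close>
    define R where "R S = C\<^sup>2 * (H2_sqnorm I h - (\<Sum>\<alpha>\<in>S. (norm (d \<alpha>))\<^sup>2)) * szego_norm I a" for S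
    have bound: "(norm (U (\<lambda>z. \<phi> z * h z) a - p S a * U ?m a))\<^sup>2 \<le> R S"
      if S: "finite S" "S \<subseteq> multi_indices I" for S
    proof -
      let ?r = "\<lambda>z. h z - p S z * one_H2 I z"
      have r: "?r \<in> H2 I" "H2_sqnorm I ?r = H2_sqnorm I h - (\<Sum>\<alpha>\<in>S. (norm (d \<alpha>))\<^sup>2)"
        unfolding p_def by (rule H2_truncation[OF I d(1) h d(2) S])+
      have pH: "p S \<in> Hinf I" unfolding p_def by (rule polynomial_Hinf[OF I S(1)])
      have comm: "(\<lambda>z. p S z * ?m z) = (\<lambda>z. \<phi> z * (p S z * one_H2 I z))" by (simp add: fun_eq_iff mult_ac)
      have pm: "(\<lambda>z. p S z * ?m z) \<in> M1"
        unfolding comm by (rule gen[OF Hinf_mult_H2[OF I pH one_H2_in_H2[OF I]]])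
      have Up: "U (\<lambda>z. p S z * ?m z) = (\<lambda>z. p S z * U ?m z)"
        using U pH m by (simp only: unitary_intertwiner_def)
      have "U (\<lambda>z. 1 * (\<phi> z * h z) + (-1) * (p S z * ?m z))
          = (\<lambda>z. 1 * U (\<lambda>z. \<phi> z * h z) z + (-1) * U (\<lambda>z. p S z * ?m z) z)"
        by (rule lin[rule_format, OF h' pm])
      moreover have "(\<lambda>z. 1 * (\<phi> z * h z) + (-1) * (p S z * ?m z)) = (\<lambda>z. \<phi> z * ?r z)"
        by (simp add: fun_eq_iff algebra_simps)
      ultimately have Ur: "U (\<lambda>z. \<phi> z * ?r z) = (\<lambda>z. U (\<lambda>z. \<phi> z * h z) z - p S z * U ?m z)"
        by (simp only: Up) simp
      note r' = gen[OF r(1)]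
      have "(norm (U (\<lambda>z. \<phi> z * ?r z) a))\<^sup>2 \<le> H2_sqnorm I (U (\<lambda>z. \<phi> z * ?r z)) * szego_norm I a"
        using unitary_intertwiner_sqnorm(1)[OF I U M1 M2 r'] M2 by (intro H2_point_evaluation[OF I _ a]) blast
      also have "\<dots> \<le> (C\<^sup>2 * H2_sqnorm I ?r) * szego_norm I a"
        unfolding unitary_intertwiner_sqnorm(2)[OF I U M1 M2 r']
        using szego_norm_pos[OF I a] by (intro mult_right_mono H2_multiplier(2)[OF I \<phi> C r(1)]) auto
      finally show ?thesis by (simp only: Ur r(2) R_def)
    qed
    have "((\<lambda>S. \<Sum>\<alpha>\<in>S. (norm (d \<alpha>))\<^sup>2) \<longlongrightarrow> H2_sqnorm I h) ?F"
      using d(2) by (simp add: has_sum_def)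
    then have "(R \<longlongrightarrow> C\<^sup>2 * (H2_sqnorm I h - H2_sqnorm I h) * szego_norm I a) ?F"
      unfolding R_def by (intro tendsto_intros)
    then have R0: "(R \<longlongrightarrow> 0) ?F" by simp
    have "((\<lambda>S. (norm (U (\<lambda>z. \<phi> z * h z) a - p S a * U ?m a))\<^sup>2) \<longlongrightarrow> 0) ?F"
      by (rule tendsto_sandwich[OF _ _ tendsto_const R0])
        (auto intro!: always_eventually eventually_finite_subsets_at_top_weakI bound)
    moreover have "((\<lambda>S. (norm (U (\<lambda>z. \<phi> z * h z) a - p S a * U ?m a))\<^sup>2)
        \<longlongrightarrow> (norm (U (\<lambda>z. \<phi> z * h z) a - h a * U ?m a))\<^sup>2) ?F"
    proof -
      have "((\<lambda>S. p S a) \<longlongrightarrow> h a) ?F"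
        using d(1) a unfolding has_power_series_def has_sum_def p_def by blast
      then show ?thesis by (intro tendsto_intros)
    qed
    ultimately have "(norm (U (\<lambda>z. \<phi> z * h z) a - h a * U ?m a))\<^sup>2 = 0"
      using tendsto_unique[OF finite_subsets_at_top_neq_bot] by blast
    then show ?thesis by simp
  qed
qed

section \<open>Holomorphic functions of constant modulus\<close>

lemma constant_modulus_disc:
  assumes f: "f holomorphic_on ball 0 1" and c: "\<And>w. w \<in> ball 0 1 \<Longrightarrow> norm (f w) = r"
    and "v \<in> ball 0 1" "w \<in> ball 0 1"
  shows "f v = f w"
proof -
  have "f constant_on ball 0 1"
    by (rule maximum_modulus_principle[OF f open_ball connected_ball open_ball order_refl, of 0]) (use c in auto)
  then show ?thesis using assms(3,4) by (auto simp: constant_on_def)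
qed

text \<open>
  By the one-variable result \<open>f\<close> does not change when a single coordinate is changed, and \<open>p\<close> becomes \<open>q\<close>
  after finitely many such changes.
\<close>

lemma unimodular_polydisc_constant:
  assumes I: "finite I" and f: "holomorphic_polydisc I f"
    and one: "\<And>z. z \<in> polydisc I \<Longrightarrow> norm (f z) = 1" and p: "p \<in> polydisc I" and q: "q \<in> polydisc I"
  shows "f p = f q"
proof -
  have "f p = f q"
    if "finite A" "A \<subseteq> I" "p \<in> polydisc I" "q \<in> polydisc I" "\<And>i. i \<in> I - A \<Longrightarrow> p i = q i" for A p q
    using that
  proof (induction A arbitrary: p rule: finite_induct)
    case empty
    then have "p = q" by (intro extensionalityI[of p I q]) (auto simp: polydisc_iff)
    then show ?case by simp
  next
    case (insert i A)
    have i: "i \<in> I" using insert.prems by blast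
    have qi: "norm (q i) < 1" and pi: "norm (p i) < 1" using insert.prems i by (auto simp: polydisc_iff)
    have "f (p(i := p i)) = f (p(i := q i))"
      using qi pi polydisc_upd[OF insert.prems(2) i]
      by (intro constant_modulus_disc[OF holomorphic_polydisc_slice[OF f insert.prems(2) i], of 1] one) auto
    also have "\<dots> = f q"
    proof (rule insert.IH)
      show "p(i := q i) \<in> polydisc I" by (rule polydisc_upd[OF insert.prems(2) i qi])
      show "(p(i := q i)) j = q j" if "j \<in> I - A" for j using that insert.prems(4) by auto
    qed (use insert.prems in auto)
    finally show ?case by simp
  qed
  from this[OF I order_refl p q] show ?thesis by simp
qed

section \<open>Nonvanishing from the boundary condition\<close>

lemma emeasure_circle_measure: "emeasure circle_measure (space circle_measure) = 1"
proof -
  have "emeasure circle_measure (space circle_measure) = emeasure (uniform_measure lborel {0..2 * pi}) UNIV"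
    unfolding circle_measure_def using emeasure_distr[OF cis_measurable_sphere sets.top]
    by (simp add: space_restrict_space vimage_def)
  also have "\<dots> = 1"
    by (subst emeasure_uniform_measure) (auto simp: ennreal_divide_self)
  finally show ?thesis .
qed

lemma emeasure_torus_measure:
  assumes "finite I"
  shows "emeasure (torus_measure I) (space (torus_measure I)) = 1"
proof -
  have "finite_measure circle_measure" by (rule finite_measureI) (simp add: emeasure_circle_measure)
  then have "product_sigma_finite (\<lambda>_ :: nat. circle_measure)"
    by (simp add: product_sigma_finite_def finite_measure_def)
  from product_sigma_finite.emeasure_PiM[OF this assms, of "\<lambda>_. space circle_measure"]
  show ?thesis by (simp add: torus_measure_def space_PiM emeasure_circle_measure)
qed

text \<open>
  If \<open>f\<close> vanished on the polydisc, all its radial limits would be 0; but \<open>1 / f\<^sup>*\<close> is required to be defined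
  almost everywhere, and the torus has positive measure.
\<close>

lemma inverse_in_Linf_nonzero:
  assumes "finite I" "inverse_in_Linf I f"
  obtains p where "p \<in> polydisc I" "f p \<noteq> 0"
proof -
  have "\<exists>p\<in>polydisc I. f p \<noteq> 0"
  proof (rule ccontr)
    assume z: "\<not> ?thesis"
    have "AE \<zeta> in torus_measure I. False"
      using assms(2)[unfolded inverse_in_Linf_def, THEN conjunct1] AE_space
    proof eventually_elim
      case (elim \<zeta>)
      have \<zeta>: "norm (\<zeta> i) = 1" if "i \<in> I" for i
        using elim(2) that
        by (auto simp: torus_measure_def space_PiM circle_measure_def space_restrict_space PiE_iff)
      have "((\<lambda>r. f (\<lambda>i\<in>I. complex_of_real r * \<zeta> i)) \<longlongrightarrow> 0) (at_left 1)"
      proof (rule tendsto_eventually)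
        show "\<forall>\<^sub>F r in at_left 1. f (\<lambda>i\<in>I. complex_of_real r * \<zeta> i) = 0"
        proof (rule eventually_at_leftI[of 0])
          fix r :: real assume "r \<in> {0<..<1}"
          then have "(\<lambda>i\<in>I. complex_of_real r * \<zeta> i) \<in> polydisc I"
            using \<zeta> by (auto simp: polydisc_iff norm_mult)
          then show "f (\<lambda>i\<in>I. complex_of_real r * \<zeta> i) = 0" using z by blast
        qed simp
      qed
      then have "radial_limit I f \<zeta> = 0"
        unfolding radial_limit_def by (intro tendsto_Lim) auto
      then show ?case using elim(1) by simp
    qed
    then have "emeasure (torus_measure I) (space (torus_measure I)) = 0"
      by (simp only: eventually_False ae_filter_eq_bot_iff)
    then show False using emeasure_torus_measure[OF assms(1)] by simp
  qed
  then show ?thesis using that by blast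
qed

section \<open>Modules with two generators\<close>

definition two_generator_module :: "nat \<Rightarrow> (complex \<Rightarrow> complex) \<Rightarrow> (point \<Rightarrow> complex) \<Rightarrow> (point \<Rightarrow> complex) set" where
  "two_generator_module n f1 f2 =
     {\<lambda>z. f1 (z 1) * h z + f2 (restrict z {2..n}) * k z | h k. h \<in> H2 {1..n} \<and> k \<in> H2 {1..n}}"

lemma zero_in_H2: "finite I \<Longrightarrow> (\<lambda>_. 0) \<in> H2 I"
  using H2_combination[OF one_H2_in_H2 one_H2_in_H2, of I 0 0] by simp

lemma two_generator_moduleI:
  "h \<in> H2 {1..n} \<Longrightarrow> k \<in> H2 {1..n} \<Longrightarrow>
    (\<lambda>z. f1 (z 1) * h z + f2 (restrict z {2..n}) * k z) \<in> two_generator_module n f1 f2"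
  unfolding two_generator_module_def by blast

lemma two_generator_module_gen1:
  assumes "h \<in> H2 {1..n}"
  shows "(\<lambda>z. f1 (z 1) * h z) \<in> two_generator_module n f1 f2"
  using two_generator_moduleI[OF assms zero_in_H2, of f1 f2] by simp

lemma two_generator_module_gen2:
  assumes "h \<in> H2 {1..n}"
  shows "(\<lambda>z. f2 (restrict z {2..n}) * h z) \<in> two_generator_module n f1 f2"
  using two_generator_moduleI[OF zero_in_H2 assms, of f1 f2] by simp

lemma inner_function_Hinf:
  assumes "inner_function f1" "1 \<le> n"
  shows "(\<lambda>z. f1 (z 1)) \<in> Hinf {1..n}"
proof (rule HinfI[where B = 1])
  show "holomorphic_polydisc {1..n} (\<lambda>z. f1 (z 1))"
    using assms by (intro holomorphic_polydisc_coordinate) (auto simp: inner_function_def)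
  show "norm (f1 (z 1)) \<le> 1" if "z \<in> polydisc {1..n}" for z
    using that assms by (intro inner_function_bound) (auto simp: polydisc_iff)
qed

lemma restrict_Hinf:
  assumes "f2 \<in> Hinf J" "J \<subseteq> I"
  shows "(\<lambda>z. f2 (restrict z J)) \<in> Hinf I"
proof -
  obtain B where "holomorphic_polydisc J f2" "\<And>z. z \<in> polydisc J \<Longrightarrow> norm (f2 z) \<le> B"
    using assms(1) unfolding Hinf_def bounded_iff by blast
  then show ?thesis
    using assms(2) by (intro HinfI[where B = B]) (auto intro: holomorphic_polydisc_restrict polydisc_restrict)
qed

lemma two_generator_module_submodule:
  assumes n: "1 \<le> n" and f1: "inner_function f1" and f2: "f2 \<in> Hinf {2..n}"
  shows "Hinf_submodule {1..n} (two_generator_module n f1 f2)"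
proof -
  let ?I = "{1..n}" and ?M = "two_generator_module n f1 f2"
  have f1': "(\<lambda>z. f1 (z 1)) \<in> Hinf ?I" by (rule inner_function_Hinf[OF f1 n])
  have f2': "(\<lambda>z. f2 (restrict z {2..n})) \<in> Hinf ?I" by (rule restrict_Hinf[OF f2]) auto
  have "?M \<subseteq> H2 ?I"
  proof
    fix x assume "x \<in> ?M"
    then obtain h k where hk: "h \<in> H2 ?I" "k \<in> H2 ?I"
      and x: "x = (\<lambda>z. f1 (z 1) * h z + f2 (restrict z {2..n}) * k z)"
      unfolding two_generator_module_def by blast
    show "x \<in> H2 ?I"
      using H2_combination[OF Hinf_mult_H2[OF _ f1' hk(1)] Hinf_mult_H2[OF _ f2' hk(2)], of 1 1]
      by (simp add: x)
  qed
  moreover have "(\<lambda>z. a * x z + b * y z) \<in> ?M" if xy: "x \<in> ?M" "y \<in> ?M" for x y a b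
  proof -
    obtain h k where hk: "h \<in> H2 ?I" "k \<in> H2 ?I"
      and x: "x = (\<lambda>z. f1 (z 1) * h z + f2 (restrict z {2..n}) * k z)"
      using xy(1) unfolding two_generator_module_def by blast
    obtain h' k' where hk': "h' \<in> H2 ?I" "k' \<in> H2 ?I"
      and y: "y = (\<lambda>z. f1 (z 1) * h' z + f2 (restrict z {2..n}) * k' z)"
      using xy(2) unfolding two_generator_module_def by blast
    have eq: "(\<lambda>z. a * x z + b * y z)
        = (\<lambda>z. f1 (z 1) * (a * h z + b * h' z) + f2 (restrict z {2..n}) * (a * k z + b * k' z))"
      by (simp add: x y fun_eq_iff algebra_simps)
    show ?thesis
      unfolding eq by (rule two_generator_moduleI[OF H2_combination[OF hk(1) hk'(1)] H2_combination[OF hk(2) hk'(2)]])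
  qed
  moreover have "(\<lambda>z. \<phi> z * x z) \<in> ?M" if "\<phi> \<in> Hinf ?I" "x \<in> ?M" for \<phi> x
  proof -
    obtain h k where hk: "h \<in> H2 ?I" "k \<in> H2 ?I"
      and x: "x = (\<lambda>z. f1 (z 1) * h z + f2 (restrict z {2..n}) * k z)"
      using \<open>x \<in> ?M\<close> unfolding two_generator_module_def by blast
    have eq: "(\<lambda>z. \<phi> z * x z)
        = (\<lambda>z. f1 (z 1) * (\<phi> z * h z) + f2 (restrict z {2..n}) * (\<phi> z * k z))"
      by (simp add: x fun_eq_iff algebra_simps)
    show ?thesis
      unfolding eq by (intro two_generator_moduleI Hinf_mult_H2 that(1) hk finite_atLeastAtMost)
  qed
  ultimately show ?thesis unfolding Hinf_submodule_def by blast
qed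

text \<open>
  Computing \<open>U (f1 f2)\<close> in two ways gives the relation between the two images. The bound of \<open>U m2\<close> by \<open>f2\<close>
  at a point \<open>z\<close> with \<open>f2 \<noteq> 0\<close> comes from freezing all variables but the first: the quotient
  \<open>\<phi> = U m2 / f2\<close> is bounded because \<open>U m2\<close> is, and \<open>f1 \<phi> = U m1\<close> is bounded by 1, so the inner factor
  cancels.
\<close>

lemma intertwiner_generators:
  fixes n f1 f2
  defines "I \<equiv> {1..n}" and "J \<equiv> {2..n}"
  defines "m1 \<equiv> \<lambda>z. f1 (z 1) * one_H2 I z" and "m2 \<equiv> \<lambda>z. f2 (restrict z J) * one_H2 I z"
  assumes n: "1 \<le> n" and f1: "inner_function f1" and f2: "f2 \<in> Hinf J"
    and p: "p \<in> polydisc J" "f2 p \<noteq> 0"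
    and U: "unitary_intertwiner I (two_generator_module n f1 f2) M2 U" and M2: "M2 \<subseteq> H2 I"
  shows "U m1 \<in> H2 I" "U m2 \<in> H2 I"
    and "\<And>z. f2 (restrict z J) * U m1 z = f1 (z 1) * U m2 z"
    and "\<And>z. z \<in> polydisc I \<Longrightarrow> norm (U m2 z) \<le> norm (f2 (restrict z J))"
    and "\<And>h k. h \<in> H2 I \<Longrightarrow> k \<in> H2 I \<Longrightarrow>
          U (\<lambda>z. f1 (z 1) * h z + f2 (restrict z J) * k z) = (\<lambda>z. h z * U m1 z + k z * U m2 z)"
proof -
  let ?M = "two_generator_module n f1 f2"
  have I: "finite I" by (simp add: I_def)
  have sub: "Hinf_submodule I ?M" unfolding I_def using n f1 f2 by (intro two_generator_module_submodule) (auto simp: J_def)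
  then have M1: "?M \<subseteq> H2 I" by (simp add: Hinf_submodule_def)
  have f1': "(\<lambda>z. f1 (z 1)) \<in> Hinf I" unfolding I_def by (rule inner_function_Hinf[OF f1 n])
  have f2': "(\<lambda>z. f2 (restrict z J)) \<in> Hinf I" by (rule restrict_Hinf[OF f2]) (auto simp: I_def J_def)
  have f1h: "holomorphic_polydisc I (\<lambda>z. f1 (z 1))" and f2h: "holomorphic_polydisc I (\<lambda>z. f2 (restrict z J))"
    using f1' f2' by (auto simp: Hinf_def)
  have z1: "norm (z 1) < 1" if "z \<in> polydisc I" for z using that n by (auto simp: polydisc_iff I_def)
  have b1: "norm (f1 (z 1)) \<le> 1" if "z \<in> polydisc I" for z
    using z1[OF that] by (intro inner_function_bound[OF f1]) auto
  obtain B where b2: "\<And>z. z \<in> polydisc I \<Longrightarrow> norm (f2 (restrict z J)) \<le> B"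
    using f2' unfolding Hinf_def bounded_iff by blast
  have g1: "(\<lambda>z. f1 (z 1) * h z) \<in> ?M" and g2: "(\<lambda>z. f2 (restrict z J) * h z) \<in> ?M" if "h \<in> H2 I" for h
    using two_generator_module_gen1 two_generator_module_gen2 that unfolding I_def J_def by blast+
  have m: "m1 \<in> ?M" "m2 \<in> ?M"
    unfolding m1_def m2_def by (intro g1 g2 one_H2_in_H2[OF I])+
  show F: "U m1 \<in> H2 I" "U m2 \<in> H2 I"
    using unitary_intertwiner_sqnorm(1)[OF I U M1 M2] m M2 by auto
  have hom: "U (\<lambda>z. \<phi> z * x z) = (\<lambda>z. \<phi> z * U x z)" if "\<phi> \<in> Hinf I" "x \<in> ?M" for \<phi> x
    using U that by (simp only: unitary_intertwiner_def)
  have "U (\<lambda>z. f2 (restrict z J) * m1 z) = U (\<lambda>z. f1 (z 1) * m2 z)"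
    by (rule arg_cong[of _ _ U]) (simp add: fun_eq_iff m1_def m2_def mult_ac)
  then have eq: "(\<lambda>z. f2 (restrict z J) * U m1 z) = (\<lambda>z. f1 (z 1) * U m2 z)"
    by (simp only: hom[OF f2' m(1)] hom[OF f1' m(2)])
  show cross: "f2 (restrict z J) * U m1 z = f1 (z 1) * U m2 z" for z
    using fun_cong[OF eq] by simp
  have F1: "norm (U m1 z) \<le> 1" if "z \<in> polydisc I" for z
    unfolding m1_def
    by (rule unitary_intertwiner_generator_bound[where \<phi> = "\<lambda>z. f1 (z 1)" and C = 1, OF I U M1 M2 f1h])
      (use b1 g1 that in auto)
  have F2: "norm (U m2 z) \<le> B" if "z \<in> polydisc I" for z
    unfolding m2_def
    by (rule unitary_intertwiner_generator_bound[where \<phi> = "\<lambda>z. f2 (restrict z J)" and C = B, OF I U M1 M2 f2h])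
      (use b2 g2 that in auto)
  have one: "1 \<in> I" "1 \<notin> J" using n by (auto simp: I_def J_def)
  have IJ: "I = insert 1 J" using n by (auto simp: I_def J_def)
  have nonzero: "norm (U m2 z) \<le> norm (f2 (restrict z J))"
    if z: "z \<in> polydisc I" and nz: "f2 (restrict z J) \<noteq> 0" for z
  proof -
    define \<phi> where "\<phi> w = U m2 (z(1 := w)) / f2 (restrict z J)" for w
    have res: "restrict (z(1 := w)) J = restrict z J" for w using one by (auto simp: restrict_def)
    have up: "z(1 := w) \<in> polydisc I" if "w \<in> ball 0 1" for w
      using that by (intro polydisc_upd[OF z one(1)]) simp
    have "norm (\<phi> (z 1)) \<le> 1"
    proof (rule inner_function_cancel_bound[where \<phi> = \<phi> and C = "B / norm (f2 (restrict z J))", OF f1])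
      show "\<phi> holomorphic_on ball 0 1"
        unfolding \<phi>_def using nz
        by (intro holomorphic_intros holomorphic_polydisc_slice[OF H2_holomorphic[OF F(2)] z one(1)]) auto
      show "norm (\<phi> w) \<le> B / norm (f2 (restrict z J))" if "w \<in> ball 0 1" for w
        unfolding \<phi>_def norm_divide by (intro divide_right_mono F2 up that) auto
      show "norm (f1 w * \<phi> w) \<le> 1" if "w \<in> ball 0 1" for w
      proof -
        have "f2 (restrict z J) * U m1 (z(1 := w)) = f1 w * U m2 (z(1 := w))"
          using cross[of "z(1 := w)"] by (simp only: res fun_upd_same)
        then have "f1 w * \<phi> w = U m1 (z(1 := w))"
          using nz by (simp add: \<phi>_def field_simps)
        then show ?thesis using F1[OF up[OF that]] by simp
      qed
      show "z 1 \<in> ball 0 1" using z1[OF z] by simp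
    qed
    then show ?thesis using nz by (simp add: \<phi>_def norm_divide field_simps)
  qed
  show "norm (U m2 z) \<le> norm (f2 (restrict z J))" if z: "z \<in> polydisc I" for z
  proof -
    have "restrict (p(1 := 0)) J = p"
      using p(1) one by (auto simp: restrict_def polydisc_iff extensional_def)
    then have p': "p(1 := 0) \<in> polydisc I" "f2 (restrict (p(1 := 0)) J) \<noteq> 0"
      using polydisc_upd_insert[OF p(1), of 0 1] p(2) by (auto simp: IJ)
    have "norm (U m2 z) - norm (f2 (restrict z J)) \<le> 0"
    proof (rule le_by_density[OF I f2h p' _ _ z])
      show "continuous_on (polydisc I) (\<lambda>z. norm (U m2 z) - norm (f2 (restrict z J)))"
        by (intro continuous_intros holomorphic_polydisc_cont[OF f2h]
            holomorphic_polydisc_cont[OF H2_holomorphic[OF F(2)]])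
      show "norm (U m2 z) - norm (f2 (restrict z J)) \<le> 0"
        if "z \<in> polydisc I" "f2 (restrict z J) \<noteq> 0" for z
        using nonzero[OF that] by linarith
    qed
    then show ?thesis by simp
  qed
  show "U (\<lambda>z. f1 (z 1) * h z + f2 (restrict z J) * k z) = (\<lambda>z. h z * U m1 z + k z * U m2 z)"
    if hk: "h \<in> H2 I" "k \<in> H2 I" for h k
  proof -
    have lin: "\<forall>f\<in>?M. \<forall>g\<in>?M. \<forall>a b. U (\<lambda>z. a * f z + b * g z) = (\<lambda>z. a * U f z + b * U g z)"
      using U unfolding unitary_intertwiner_def by (elim conjE)
    have "U (\<lambda>z. 1 * (f1 (z 1) * h z) + 1 * (f2 (restrict z J) * k z))
        = (\<lambda>z. 1 * U (\<lambda>z. f1 (z 1) * h z) z + 1 * U (\<lambda>z. f2 (restrict z J) * k z) z)"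
      by (rule lin[rule_format, OF g1[OF hk(1)] g2[OF hk(2)]])
    moreover have "U (\<lambda>z. f1 (z 1) * h z) = (\<lambda>z. h z * U m1 z)"
      unfolding m1_def
      by (rule unitary_intertwiner_on_generator[where \<phi> = "\<lambda>z. f1 (z 1)" and C = 1, OF I U M1 M2 f1h])
        (use b1 g1 hk in auto)
    moreover have "U (\<lambda>z. f2 (restrict z J) * k z) = (\<lambda>z. k z * U m2 z)"
      unfolding m2_def
      by (rule unitary_intertwiner_on_generator[where \<phi> = "\<lambda>z. f2 (restrict z J)" and C = B, OF I U M1 M2 f2h])
        (use b2 g2 hk in auto)
    ultimately show ?thesis by simp
  qed
qed

text \<open>
  With \<open>G2\<close> the image of \<open>g2\<close> under the inverse of \<open>U\<close>, computing \<open>U (f2 G2)\<close> in two ways gives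
  \<open>F2 G2 = f2 g2\<close>, while \<open>|F2| \<le> |f2|\<close> and \<open>|G2| \<le> |g2|\<close>. Hence \<open>|F2| = |f2|\<close> away from the zeros of
  \<open>q = f2 g2\<close>. There, as \<open>f2\<close> does not involve the first variable, \<open>F2\<close> has constant modulus in it and so
  is independent of it. Therefore the quotient \<open>F2 / f2 = F1 / f1\<close> involves only the other variables; it is
  represented by the holomorphic function \<open>c\<close>, which has modulus one and is constant.
\<close>

theorem intertwiner_is_scalar:
  assumes n: "2 \<le> n" and f1: "inner_function f1" and g1: "inner_function g1"
    and f2: "f2 \<in> Hinf {2..n}" and g2: "g2 \<in> Hinf {2..n}"
    and nf: "pf \<in> polydisc {2..n}" "f2 pf \<noteq> 0" and ng: "pg \<in> polydisc {2..n}" "g2 pg \<noteq> 0"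
    and U: "unitary_intertwiner {1..n} (two_generator_module n f1 f2) (two_generator_module n g1 g2) U"
  obtains \<kappa> where "\<kappa> \<noteq> 0" "\<And>x. x \<in> two_generator_module n f1 f2 \<Longrightarrow> U x = (\<lambda>z. \<kappa> * x z)"
proof -
  define I where "I = {1..n}"
  define J where "J = {2..n}"
  let ?M1 = "two_generator_module n f1 f2" and ?M2 = "two_generator_module n g1 g2"
  have I: "finite I" and J: "finite J" by (auto simp: I_def J_def)
  have IJ: "I = insert 1 J" and one: "1 \<in> I" "1 \<notin> J" using n by (auto simp: I_def J_def)
  have n1: "1 \<le> n" using n by simp
  note U = U[folded I_def] and f2 = f2[folded J_def] and g2 = g2[folded J_def]
    and nf = nf[folded J_def] and ng = ng[folded J_def]
  have sub1: "Hinf_submodule I ?M1"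
    unfolding I_def by (rule two_generator_module_submodule[OF n1 f1 f2[unfolded J_def]])
  have sub2: "Hinf_submodule I ?M2"
    unfolding I_def by (rule two_generator_module_submodule[OF n1 g1 g2[unfolded J_def]])
  have M1: "?M1 \<subseteq> H2 I" and M2: "?M2 \<subseteq> H2 I" using sub1 sub2 by (auto simp: Hinf_submodule_def)
  define V where "V = inv_into ?M1 U"
  have V: "unitary_intertwiner I ?M2 ?M1 V"
    unfolding V_def by (rule unitary_intertwiner_inverse[OF U sub1])
  define F1 where "F1 = U (\<lambda>z. f1 (z 1) * one_H2 I z)"
  define F2 where "F2 = U (\<lambda>z. f2 (restrict z J) * one_H2 I z)"
  define G2 where "G2 = V (\<lambda>z. g2 (restrict z J) * one_H2 I z)"
  note gensU = intertwiner_generators[OF n1 f1 f2[unfolded J_def] nf[unfolded J_def] U[unfolded I_def] M2[unfolded I_def],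
      folded I_def J_def, folded F1_def F2_def]
  note gensV = intertwiner_generators[OF n1 g1 g2[unfolded J_def] ng[unfolded J_def] V[unfolded I_def] M1[unfolded I_def],
      folded I_def J_def, folded G2_def]
  have F: "F1 \<in> H2 I" "F2 \<in> H2 I" and G: "G2 \<in> H2 I" using gensU(1,2) gensV(2) by auto
  have cross: "f2 (restrict z J) * F1 z = f1 (z 1) * F2 z" for z by (rule gensU(3))
  have F2f2: "norm (F2 z) \<le> norm (f2 (restrict z J))" if "z \<in> polydisc I" for z by (rule gensU(4)[OF that])
  have G2g2: "norm (G2 z) \<le> norm (g2 (restrict z J))" if "z \<in> polydisc I" for z by (rule gensV(4)[OF that])
  have prod: "G2 z * F2 z = f2 (restrict z J) * g2 (restrict z J)" if z: "z \<in> polydisc I" for z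
  proof -
    have m: "(\<lambda>z. g2 (restrict z J) * one_H2 I z) \<in> ?M2"
      unfolding I_def J_def by (rule two_generator_module_gen2[OF one_H2_in_H2]) simp
    have "bij_betw U ?M1 ?M2" using U by (simp add: unitary_intertwiner_def)
    then have G2: "G2 \<in> ?M1" and UG2: "U G2 = (\<lambda>z. g2 (restrict z J) * one_H2 I z)"
      using m by (auto simp: G2_def V_def bij_betw_def inv_into_into f_inv_into_f)
    have f2I: "(\<lambda>z. f2 (restrict z J)) \<in> Hinf I"
      by (rule restrict_Hinf[OF f2]) (auto simp: IJ)
    have "U (\<lambda>z. f2 (restrict z J) * G2 z) = (\<lambda>z. f2 (restrict z J) * U G2 z)"
      using U f2I G2 by (simp only: unitary_intertwiner_def)
    moreover have "U (\<lambda>z. f2 (restrict z J) * G2 z) = (\<lambda>z. G2 z * F2 z)"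
      using gensU(5)[OF zero_in_H2[OF I] G] by simp
    ultimately have "(\<lambda>z. G2 z * F2 z) = (\<lambda>z. f2 (restrict z J) * (g2 (restrict z J) * one_H2 I z))"
      by (simp only: UG2)
    from fun_cong[OF this, of z] show ?thesis using z by (simp add: one_H2_def)
  qed
  define q where "q z = f2 (restrict z J) * g2 (restrict z J)" for z
  have f2h: "holomorphic_polydisc J f2" and g2h: "holomorphic_polydisc J g2" using f2 g2 by (auto simp: Hinf_def)
  have f2I: "holomorphic_polydisc I (\<lambda>z. f2 (restrict z J))" and g2I: "holomorphic_polydisc I (\<lambda>z. g2 (restrict z J))"
    by (intro holomorphic_polydisc_restrict[OF f2h] holomorphic_polydisc_restrict[OF g2h], auto simp: IJ)+
  have qh: "holomorphic_polydisc I q" unfolding q_def by (intro holomorphic_polydisc_mult f2I g2I)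
  obtain p where p: "p \<in> polydisc I" "q p \<noteq> 0"
  proof -
    have "continuous_on (polydisc J) (\<lambda>z. norm (g2 z))"
      by (intro continuous_intros holomorphic_polydisc_cont[OF g2h])
    from zero_set_nowhere_dense[OF J f2h nf this ng(1)] ng(2)
    obtain x where x: "x \<in> polydisc J" "f2 x \<noteq> 0" "norm (g2 x) > 0" by auto
    have "restrict (x(1 := 0)) J = x"
      using x(1) one by (auto simp: restrict_def polydisc_iff extensional_def)
    then show ?thesis
      using that[of "x(1 := 0)"] x polydisc_upd_insert[OF x(1), of 0 1] by (simp add: q_def IJ)
  qed
  note dense_le = le_by_density[OF I qh p] and dense_eq = eq_by_density[OF I qh p]
  have modulus: "norm (F2 z) = norm (f2 (restrict z J))" if z: "z \<in> polydisc I" and qz: "q z \<noteq> 0" for z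
  proof (rule antisym[OF F2f2[OF z]])
    have "norm (f2 (restrict z J)) * norm (g2 (restrict z J)) = norm (F2 z) * norm (G2 z)"
      using prod[OF z] by (simp add: norm_mult[symmetric] mult.commute)
    also have "\<dots> \<le> norm (F2 z) * norm (g2 (restrict z J))"
      by (intro mult_left_mono G2g2[OF z]) auto
    finally show "norm (f2 (restrict z J)) \<le> norm (F2 z)" using qz by (simp add: q_def)
  qed
  obtain a where a: "a \<in> ball 0 1" "f1 a \<noteq> 0" by (rule inner_function_nonzero[OF f1])
  have res: "restrict (z(1 := w)) J = restrict z J" for z :: point and w
    using one by (auto simp: restrict_def)
  have upd: "z(1 := w) \<in> polydisc I" if "z \<in> polydisc I" "w \<in> ball 0 1" for z w
    using that by (intro polydisc_upd[OF _ one(1)]) auto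
  \<comment> \<open>As a function on \<open>polydisc I\<close>, the slice is a function of the other variables composed with their projection.\<close>
  have freeze: "holomorphic_polydisc I (\<lambda>z. x (z(1 := a)))" if "x \<in> H2 I" for x
  proof -
    have "holomorphic_polydisc J (\<lambda>z. x (z(1 := a)))"
      using H2_holomorphic[OF that] a(1) one by (intro holomorphic_polydisc_upd) (auto simp: IJ)
    then have "holomorphic_polydisc I (\<lambda>z. x ((restrict z J)(1 := a)))"
      by (rule holomorphic_polydisc_restrict[where f = "\<lambda>z. x (z(1 := a))"]) (auto simp: IJ)
    then show ?thesis
    proof (rule holomorphic_polydisc_cong)
      fix z assume "z \<in> polydisc I"
      then have "(restrict z J)(1 := a) = z(1 := a)"
        by (auto simp: restrict_def polydisc_iff extensional_def IJ)
      then show "x ((restrict z J)(1 := a)) = x (z(1 := a))" by simp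
    qed
  qed
  have F2_indep: "F2 z = F2 (z(1 := a))" if z: "z \<in> polydisc I" for z
  proof (rule dense_eq[OF _ _ _ z])
    show "continuous_on (polydisc I) F2" by (intro holomorphic_polydisc_cont H2_holomorphic F)
    show "continuous_on (polydisc I) (\<lambda>z. F2 (z(1 := a)))" by (intro holomorphic_polydisc_cont freeze F)
    fix z assume z: "z \<in> polydisc I" and qz: "q z \<noteq> 0"
    have "F2 (z(1 := z 1)) = F2 (z(1 := a))"
    proof (rule constant_modulus_disc[where f = "\<lambda>w. F2 (z(1 := w))" and r = "norm (f2 (restrict z J))"])
      show "(\<lambda>w. F2 (z(1 := w))) holomorphic_on ball 0 1"
        by (rule holomorphic_polydisc_slice[OF H2_holomorphic[OF F(2)] z one(1)])
      show "norm (F2 (z(1 := w))) = norm (f2 (restrict z J))" if "w \<in> ball 0 1" for w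
        using modulus[OF upd[OF z that]] qz unfolding q_def res by blast
      show "z 1 \<in> ball 0 1" using z one by (auto simp: polydisc_iff)
    qed (rule a(1))
    then show "F2 z = F2 (z(1 := a))" by simp
  qed
  \<comment> \<open>Dividing by the number \<open>f1 a\<close> rather than by \<open>f2\<close> makes \<open>c\<close> holomorphic on the whole polydisc.\<close>
  define c where "c z = F1 (z(1 := a)) / f1 a" for z
  have ch: "holomorphic_polydisc I c"
    unfolding c_def divide_inverse by (intro holomorphic_polydisc_mult holomorphic_polydisc_const freeze F)
  have cF2: "F2 z = c z * f2 (restrict z J)" if z: "z \<in> polydisc I" for z
  proof -
    have "f2 (restrict z J) * F1 (z(1 := a)) = f1 a * F2 (z(1 := a))"
      using cross[of "z(1 := a)"] by (simp only: res fun_upd_same)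
    then show ?thesis unfolding F2_indep[OF z] c_def using a(2) by (simp add: field_simps)
  qed
  have cF1: "F1 z = c z * f1 (z 1)" if z: "z \<in> polydisc I" for z
  proof (rule dense_eq[OF _ _ _ z])
    show "continuous_on (polydisc I) F1" by (intro holomorphic_polydisc_cont H2_holomorphic F)
    have "holomorphic_polydisc I (\<lambda>z. f1 (z 1))"
      using f1 one by (intro holomorphic_polydisc_coordinate) (auto simp: inner_function_def)
    then show "continuous_on (polydisc I) (\<lambda>z. c z * f1 (z 1))"
      by (intro continuous_intros holomorphic_polydisc_cont ch)
    fix z assume "z \<in> polydisc I" "q z \<noteq> 0"
    then show "F1 z = c z * f1 (z 1)" using cross[of z] cF2[of z] by (simp add: q_def)
  qed
  have c1: "norm (c z) = 1" if z: "z \<in> polydisc I" for z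
  proof -
    have eq: "norm (c z) = 1" if "z \<in> polydisc I" "q z \<noteq> 0" for z
      using modulus[OF that] cF2[OF that(1)] that(2) by (simp add: q_def norm_mult)
    have "norm (c z) - 1 \<le> 0"
      by (rule dense_le[OF _ _ z]) (use eq in \<open>auto intro!: continuous_intros holomorphic_polydisc_cont ch\<close>)
    moreover have "1 - norm (c z) \<le> 0"
      by (rule dense_le[OF _ _ z]) (use eq in \<open>auto intro!: continuous_intros holomorphic_polydisc_cont ch\<close>)
    ultimately show ?thesis by simp
  qed
  define \<kappa> where "\<kappa> = c (\<lambda>i\<in>I. 0)"
  have c\<kappa>: "c z = \<kappa>" if "z \<in> polydisc I" for z
    unfolding \<kappa>_def by (rule unimodular_polydisc_constant[OF I ch c1 that polydisc_zero])
  show ?thesis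
  proof
    show "\<kappa> \<noteq> 0" using c1[OF polydisc_zero] by (auto simp: \<kappa>_def)
    fix x assume "x \<in> ?M1"
    then obtain h k where hk: "h \<in> H2 I" "k \<in> H2 I"
      and x: "x = (\<lambda>z. f1 (z 1) * h z + f2 (restrict z J) * k z)"
      unfolding two_generator_module_def I_def J_def by blast
    have "U x z = \<kappa> * x z" for z
    proof (cases "z \<in> polydisc I")
      case True
      have "U x z = h z * F1 z + k z * F2 z" unfolding x gensU(5)[OF hk] by simp
      also have "\<dots> = \<kappa> * x z"
        using cF1[OF True] cF2[OF True] c\<kappa>[OF True] by (simp add: x algebra_simps)
      finally show ?thesis .
    next
      case False
      then show ?thesis
        unfolding x gensU(5)[OF hk] using H2_zero_outside[OF hk(1)] H2_zero_outside[OF hk(2)] by simp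
    qed
    then show "U x = (\<lambda>z. \<kappa> * x z)" by blast
  qed
qed

theorem theorem4p2:
  fixes n :: nat
    and f1 g1 :: "complex \<Rightarrow> complex"
    and f2 g2 :: "point \<Rightarrow> complex"
    and M1 M2 :: "(point \<Rightarrow> complex) set"
  assumes "n \<ge> 2"
    and "inner_function f1" and "inner_function g1"
    and "f2 \<in> Hinf {2..n}" and "g2 \<in> Hinf {2..n}"
    and "inverse_in_Linf {2..n} f2" and "inverse_in_Linf {2..n} g2"
    and "M1 = {\<lambda>z. f1 (z 1) * h z + f2 (restrict z {2..n}) * k z | h k.
                 h \<in> H2 {1..n} \<and> k \<in> H2 {1..n}}"
    and "M2 = {\<lambda>z. g1 (z 1) * h z + g2 (restrict z {2..n}) * k z | h k.
                 h \<in> H2 {1..n} \<and> k \<in> H2 {1..n}}"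
    and "unitarily_equivalent {1..n} M1 M2"
  shows "M1 = M2"
proof -
  have M1: "M1 = two_generator_module n f1 f2" and M2: "M2 = two_generator_module n g1 g2"
    using assms(8,9) by (auto simp: two_generator_module_def)
  obtain U where U: "unitary_intertwiner {1..n} M1 M2 U"
    using assms(10) unfolding unitarily_equivalent_def unitary_intertwiner_def by blast
  obtain pf where pf: "pf \<in> polydisc {2..n}" "f2 pf \<noteq> 0"
    by (rule inverse_in_Linf_nonzero[OF finite_atLeastAtMost assms(6)])
  obtain pg where pg: "pg \<in> polydisc {2..n}" "g2 pg \<noteq> 0"
    by (rule inverse_in_Linf_nonzero[OF finite_atLeastAtMost assms(7)])
  obtain \<kappa> where \<kappa>: "\<kappa> \<noteq> 0" "\<And>x. x \<in> M1 \<Longrightarrow> U x = (\<lambda>z. \<kappa> * x z)"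
    using intertwiner_is_scalar[OF assms(1-5) pf pg U[unfolded M1 M2]] unfolding M1 by blast
  have scale: "(\<lambda>z. b * x z) \<in> M1" if "x \<in> M1" for x b
  proof -
    have "Hinf_submodule {1..n} M1"
      unfolding M1 using assms by (intro two_generator_module_submodule) auto
    then have "(\<lambda>z. b * x z + 0 * x z) \<in> M1" using that unfolding Hinf_submodule_def by blast
    then show ?thesis by simp
  qed
  have image: "U ` M1 = M2" using U by (simp add: unitary_intertwiner_def bij_betw_def)
  show ?thesis
  proof (intro equalityI subsetI)
    fix x assume x: "x \<in> M1"
    have eq: "U (\<lambda>z. inverse \<kappa> * x z) = x"
      unfolding \<kappa>(2)[OF scale[OF x]] using \<kappa>(1) by (simp add: mult.assoc[symmetric])
    show "x \<in> M2"
      using imageI[OF scale[OF x, of "inverse \<kappa>"], of U] unfolding image eq .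
  next
    fix y assume "y \<in> M2"
    then obtain x where "x \<in> M1" "y = U x" using image by blast
    then show "y \<in> M1" using \<kappa>(2) scale by simp
  qed
qed

end
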